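(* Work in the setting of the context (semi-Markov kernel densities $\mathcal Q$, true density $q_0\in\mathcal Q$, subsets $\mathcal Q_n\subset\mathcal Q$, prior distributions $\Pi_n$ on $\mathcal Q$, $n\in\mathbb N^*$). Assume the following minorization/majorization condition: there exist two measures $\nu^*$ and $\eta^*$ on $\mathcal E$ and two positive integers $k,l$ such that for every $q\in\mathcal Q$ and every $x\in E$, $$\frac1k\sum_{u=1}^k P_q^{(u)}(x,\cdot)\ \ge\ \nu^*(\cdot)\qquad\text{and}\qquad P_q^{(l)}(x,\cdot)\ \le\ \eta^*(\cdot).$$ Then there exists a constant $\xi\in(0,1)$, not depending on $n$, $q_0$, $(\mathcal Q_n)$, $(\Pi_n)$ or $(\epsilon_n)$, such that the following holds. Let $(\epsilon_n)$ be a sequence of positive numbers with $\lim_{n\to\infty}\epsilon_n=0$ and $\lim_{n\to\infty}n\epsilon_n^2=+\infty$, and suppose that for every $n$: (i) $\displaystyle \sup_{\epsilon>\epsilon_n}\log N\bigl(\epsilon\xi,\,B_{d_{\nu^*},n}(q_0,\epsilon),\,d_{\eta^*}\bigr)\le n\epsilon_n^2$; (ii) for some constant $c>0$ (not depending on $n$), $\Pi_n\bigl(\mathcal U(q_0,\epsilon_n)\bigr)>e^{-cn\epsilon_n^2}$; (iii) with the same constant $c$, $\Pi_n\bigl(\mathcal Q\setminus\mathcal Q_n\bigr)\le e^{-2n(c+1)\epsilon_n^2}$. Then for all $M$ large enough, $$\Pi_n^{\mathcal H_n}\bigl(\{q\in\mathcal Q:\ d_{\nu^*}(q_0,q)>\epsilon_nM\}\bigr)\longrightarrow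 0\quad\text{in } L_1(\mathbb P_0^{(n)})\ \text{ as } n\to\infty ,$$ i.e. the $\mathbb P_0^{(n)}$-expectation of the left-hand side tends to $0$.
   Context: Setting. $(E,\mathcal E)$ is a measurable space, $\mathbb R^+=[0,\infty)$ with Borel $\sigma$-algebra $\mathbb B^+$, and $\nu$ is a $\sigma$-finite measure on $(E\times\mathbb R^+,\mathcal E\otimes\mathbb B^+)$. A semi-Markov kernel density is a measurable nonnegative $q=q_x(y,t)$ ($x,y\in E$, $t\in\mathbb R^+$) with $\int q_x\,d\nu=1$ for all $x$; the associated semi-Markov kernel is $Q_x(dy,dt)=q_x(y,t)\,d\nu(y,t)$. $\mathcal Q$ is a given set of semi-Markov kernel densities. Under $q$, the homogeneous Markov renewal process $(J_n,S_n)_{n\ge0}$, $0\le S_0\le S_1\le\cdots$, with sojourn times $X_0=S_0$, $X_n=S_n-S_{n-1}$ ($n\ge1$), satisfies $\mathbb P(J_{n+1}\in B,X_{n+1}\le t\mid J_0,\dots,J_n,S_0,\dots,S_n)=Q_{J_n}(B\times[0,t])$ a.s. The embedded Markov chain $(J_n)$ has one-step transition kernel $P_q(x,B)=Q_x(B\times\mathbb R^+)$ and $n$-step transition kernel $P_q^{(n)}(x,B)$. Standing assumptions (for every $q\in\mathcal Q$): (A1) the chain $(J_n)$ is ergodic with stationary probability measure $\rho_q$; (A2) with $m(x)=\int_0^\infty\mathbb P(S_1-S_0>t\mid J_0=x)\,dt$, $\int_E\rho_q(dx)m(x)<\infty$; (A3) for all $n$, $x,y$, the conditional distribution function $t\mapsto\mathbb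 P(S_{n+1}-S_n\le t\mid J_n=x,J_{n+1}=y)$ is not the function $\mathbf 1_{\mathbb R^+}(t)$ (the conditional law is not the Dirac mass at $0$). The initial law of $(J_0,X_0)$ under $q$ is the stationary distribution $\widetilde\rho_q(A\times\Gamma)=\int_E\rho_q(dx)Q_x(A\times\Gamma)$, whose $\nu$-density is also denoted $\widetilde\rho_q(y,t)$. Distances. For two semi-Markov kernels with densities $q_1,q_2$ (kernels from $x$ written $Q_{x;1},Q_{x;2}$, densities $q_{x;1},q_{x;2}$), $h_\nu^2(Q_{x;1},Q_{x;2})=\frac12\int_{E\times\mathbb R^+}(\sqrt{q_{x;1}}-\sqrt{q_{x;2}})^2\,d\nu$; for a measure $\mu$ on $\mathcal E$, $d_\mu^2(q_1,q_2)=\int_E h_\nu^2(Q_{x;1},Q_{x;2})\,d\mu(x)$ (a semi-distance). For $\mathcal Q_n\subset\mathcal Q$, $B_{d,n}(q_0,\epsilon)=\{q\in\mathcal Q_n: d(q_0,q)\le\epsilon\}$. $N(\epsilon,A,d)$ is the minimum number of $d$-balls of radius $\epsilon$ needed to cover $A$. Observations, prior, posterior. $\mathcal H_n=\{J_0,\dots,J_n,S_0,\dots,S_n\}$; $\mathbb P_q^{(n)}$ is the law of $\mathcal H_n$ under $q$, and $\mathbb P_0^{(n)}=\mathbb P_{q_0}^{(n)}$ with expectation $\mathbb E_0^{(n)}$ and variance $\mathbb V_0^{(n)}$. The likelihood is $\mathcal L_n(q)=\widetilde\rho_q(J_0,S_0)\prod_{\ell=1}^n q_{J_{\ell-1}}(J_\ell,X_\ell)$.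 For a prior probability distribution $\Pi_n$ on $\mathcal Q$, the posterior is $\Pi_n^{\mathcal H_n}(A)=\int_A\mathcal L_n(q)\,d\Pi_n(q)\big/\int_{\mathcal Q}\mathcal L_n(q)\,d\Pi_n(q)$. Kullback–Leibler neighborhoods. $K(\mathbb P_0^{(n)},\mathbb P_q^{(n)})=\mathbb E_0^{(n)}\bigl[\log\frac{\mathcal L_n(q_0)}{\mathcal L_n(q)}\bigr]$, $V_0(\mathbb P_0^{(n)},\mathbb P_q^{(n)})=\mathbb V_0^{(n)}\bigl[\log\frac{\mathcal L_n(q_0)}{\mathcal L_n(q)}\bigr]$, and $\mathcal U(q_0,\epsilon)=\{q\in\mathcal Q: K(\mathbb P_0^{(n)},\mathbb P_q^{(n)})\le n\epsilon^2,\ V_0(\mathbb P_0^{(n)},\mathbb P_q^{(n)})\le n\epsilon^2\}$. *)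

theory Defs
  imports "HOL-Probability.Probability"
begin

subsection \<open>Extended-valued auxiliaries\<close>

definition sqrt_ennreal :: "ennreal \<Rightarrow> ennreal" where
  "sqrt_ennreal x = (if x = \<infinity> then \<infinity> else ennreal (sqrt (enn2real x)))"

definition ln_ennreal :: "ennreal \<Rightarrow> ereal" where
  "ln_ennreal x = (if x = 0 then - \<infinity> else if x = \<infinity> then \<infinity> else ereal (ln (enn2real x)))"

text \<open>The Bochner integral of a non-integrable function is 0, which would make upper bounds on
  Kullback-Leibler quantities vacuous.  Hence mean and variance are taken as extended numbers.
  Recall that \<^const>\<open>e2ennreal\<close> sends negative numbers to 0.\<close>

definition ext_expectation :: "'a measure \<Rightarrow> ('a \<Rightarrow> ereal) \<Rightarrow> ereal" where
  "ext_expectation M f =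
     enn2ereal (\<integral>\<^sup>+ x. e2ennreal (f x) \<partial>M) - enn2ereal (\<integral>\<^sup>+ x. e2ennreal (- f x) \<partial>M)"

definition ext_variance :: "'a measure \<Rightarrow> ('a \<Rightarrow> ereal) \<Rightarrow> ereal" where
  "ext_variance M f = enn2ereal (\<integral>\<^sup>+ x. e2ennreal ((f x - ext_expectation M f)\<^sup>2) \<partial>M)"

subsection \<open>Semi-Markov kernels and the embedded chain\<close>

abbreviation half_line :: "real measure" where
  "half_line \<equiv> restrict_space borel {0..}"

type_synonym 'e kernel_density = "'e \<Rightarrow> 'e \<times> real \<Rightarrow> real"

definition semi_markov_density ::
    "'e measure \<Rightarrow> ('e \<times> real) measure \<Rightarrow> 'e kernel_density \<Rightarrow> bool" where
  "semi_markov_density E \<nu> q \<longleftrightarrow>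
     (\<lambda>(x, z). q x z) \<in> borel_measurable (E \<Otimes>\<^sub>M (E \<Otimes>\<^sub>M half_line)) \<and>
     (\<forall>x\<in>space E. \<forall>z\<in>space (E \<Otimes>\<^sub>M half_line). 0 \<le> q x z) \<and>
     (\<forall>x\<in>space E. (\<integral>\<^sup>+ z. ennreal (q x z) \<partial>\<nu>) = 1)"

definition semi_markov_kernel ::
    "('e \<times> real) measure \<Rightarrow> 'e kernel_density \<Rightarrow> 'e \<Rightarrow> ('e \<times> real) measure" where
  "semi_markov_kernel \<nu> q x = density \<nu> (\<lambda>z. ennreal (q x z))"

definition chain_kernel ::
    "'e measure \<Rightarrow> ('e \<times> real) measure \<Rightarrow> 'e kernel_density \<Rightarrow> 'e \<Rightarrow> 'e measure" where
  "chain_kernel E \<nu> q x = distr (semi_markov_kernel \<nu> q x) E fst"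

primrec kernel_pow :: "'e measure \<Rightarrow> ('e \<Rightarrow> 'e measure) \<Rightarrow> nat \<Rightarrow> 'e \<Rightarrow> 'e measure" where
  "kernel_pow E K 0 x = return E x"
| "kernel_pow E K (Suc n) x = bind (kernel_pow E K n x) K"

text \<open>Ergodicity is taken in the usual sense for chains on general state spaces: convergence of the
  transition probabilities in total variation, from every starting point, to the stationary law.\<close>

definition ergodic_chain :: "'e measure \<Rightarrow> ('e \<Rightarrow> 'e measure) \<Rightarrow> 'e measure \<Rightarrow> bool" where
  "ergodic_chain E K \<rho> \<longleftrightarrow>
     prob_space \<rho> \<and> sets \<rho> = sets E \<and> bind \<rho> K = \<rho> \<and>
     (\<forall>x\<in>space E.
        (\<lambda>n. SUP A\<in>sets E. \<bar>measure (kernel_pow E K n x) A - measure \<rho> A\<bar>) \<longlonglongrightarrow> 0)"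

text \<open>The conditional probability of a sojourn longer than \<open>t\<close> in state \<open>x\<close> is
  \<open>Q\<^sub>x (E \<times> (t, \<infinity>))\<close>.\<close>

definition mean_sojourn ::
    "'e measure \<Rightarrow> ('e \<times> real) measure \<Rightarrow> 'e kernel_density \<Rightarrow> 'e \<Rightarrow> ennreal" where
  "mean_sojourn E \<nu> q x =
     (\<integral>\<^sup>+ t\<in>{0..}. emeasure (semi_markov_kernel \<nu> q x) (space E \<times> {t<..}) \<partial>lborel)"

subsection \<open>The observed process\<close>

type_synonym 'e history = "(nat \<Rightarrow> 'e) \<times> (nat \<Rightarrow> real)"

definition history_space :: "'e measure \<Rightarrow> nat \<Rightarrow> 'e history measure" where
  "history_space E n =
     restrict_space (Pi\<^sub>M {..n} (\<lambda>_. E) \<Otimes>\<^sub>M Pi\<^sub>M {..n} (\<lambda>_. half_line))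
       {(j, s). \<forall>i<n. s i \<le> s (Suc i)}"

definition history ::
    "(nat \<Rightarrow> 'w \<Rightarrow> 'e) \<Rightarrow> (nat \<Rightarrow> 'w \<Rightarrow> real) \<Rightarrow> nat \<Rightarrow> 'w \<Rightarrow> 'e history" where
  "history J S n \<omega> = ((\<lambda>i\<in>{..n}. J i \<omega>), (\<lambda>i\<in>{..n}. S i \<omega>))"

definition history_law ::
    "'e measure \<Rightarrow> 'w measure \<Rightarrow> (nat \<Rightarrow> 'w \<Rightarrow> 'e) \<Rightarrow> (nat \<Rightarrow> 'w \<Rightarrow> real) \<Rightarrow> nat
      \<Rightarrow> 'e history measure" where
  "history_law E M J S n = distr M (history_space E n) (history J S n)"

definition markov_renewal_process ::
    "'e measure \<Rightarrow> ('e \<Rightarrow> ('e \<times> real) measure) \<Rightarrow> 'w measure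
      \<Rightarrow> (nat \<Rightarrow> 'w \<Rightarrow> 'e) \<Rightarrow> (nat \<Rightarrow> 'w \<Rightarrow> real) \<Rightarrow> bool" where
  "markov_renewal_process E Q M J S \<longleftrightarrow>
     prob_space M \<and>
     (\<forall>n. J n \<in> measurable M E \<and> S n \<in> borel_measurable M) \<and>
     (\<forall>\<omega>\<in>space M. 0 \<le> S 0 \<omega> \<and> (\<forall>n. S n \<omega> \<le> S (Suc n) \<omega>)) \<and>
     (\<forall>n. \<forall>B\<in>sets E. \<forall>t\<ge>0. AE \<omega> in M.
        real_cond_exp M (vimage_algebra (space M) (history J S n) (history_space E n))
          (indicator {\<omega>\<in>space M. J (Suc n) \<omega> \<in> B \<and> S (Suc n) \<omega> - S n \<omega> \<le> t}) \<omega>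
        = measure (Q (J n \<omega>)) (B \<times> {0..t}))"

text \<open>For every \<open>n\<close>, \<open>F (x, y)\<close> is a regular version of the conditional law of
  \<open>S\<^bsub>n+1\<^esub> - S\<^sub>n\<close> given \<open>J\<^sub>n = x\<close> and \<open>J\<^bsub>n+1\<^esub> = y\<close>.  Conditional laws are determined only up to
  null sets, hence the existential quantifier.\<close>

definition nondegenerate_sojourns ::
    "'e measure \<Rightarrow> 'w measure \<Rightarrow> (nat \<Rightarrow> 'w \<Rightarrow> 'e) \<Rightarrow> (nat \<Rightarrow> 'w \<Rightarrow> real) \<Rightarrow> bool" where
  "nondegenerate_sojourns E M J S \<longleftrightarrow>
     (\<forall>n. \<exists>F \<in> measurable (E \<Otimes>\<^sub>M E) (prob_algebra borel).
        (\<forall>t. AE \<omega> in M.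
           real_cond_exp M (vimage_algebra (space M) (\<lambda>\<omega>. (J n \<omega>, J (Suc n) \<omega>)) (E \<Otimes>\<^sub>M E))
             (indicator {\<omega>\<in>space M. S (Suc n) \<omega> - S n \<omega> \<le> t}) \<omega>
           = cdf (F (J n \<omega>, J (Suc n) \<omega>)) t) \<and>
        (\<forall>x\<in>space E. \<forall>y\<in>space E. cdf (F (x, y)) \<noteq> indicator {0..}))"

text \<open>The measurable space of parameters is \<open>\<QQ>\<close>; its carrier is the given set of densities.  The same
  processes \<open>J\<close>, \<open>S\<close> are considered under the laws \<open>Pr q\<close>, and \<open>\<rho> q\<close> is the stationary law of the
  embedded chain.  Joint measurability in the parameter is what makes the posterior meaningful.\<close>

locale semi_markov_model =
  fixes E :: "'e measure"
    and \<nu> :: "('e \<times> real) measure"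
    and \<QQ> :: "'e kernel_density measure"
    and \<rho> :: "'e kernel_density \<Rightarrow> 'e measure"
    and Pr :: "'e kernel_density \<Rightarrow> 'w measure"
    and J :: "nat \<Rightarrow> 'w \<Rightarrow> 'e"
    and S :: "nat \<Rightarrow> 'w \<Rightarrow> real"
  assumes sets_nu: "sets \<nu> = sets (E \<Otimes>\<^sub>M half_line)"
    and sigma_finite_nu: "sigma_finite_measure \<nu>"
    and density: "q \<in> space \<QQ> \<Longrightarrow> semi_markov_density E \<nu> q"
    and jointly_measurable:
      "(\<lambda>(q, x, z). q x z) \<in> borel_measurable (\<QQ> \<Otimes>\<^sub>M (E \<Otimes>\<^sub>M (E \<Otimes>\<^sub>M half_line)))"
    and renewal: "q \<in> space \<QQ> \<Longrightarrow>
      markov_renewal_process E (semi_markov_kernel \<nu> q) (Pr q) J S"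
    and initial_law: "q \<in> space \<QQ> \<Longrightarrow>
      distr (Pr q) (E \<Otimes>\<^sub>M half_line) (\<lambda>\<omega>. (J 0 \<omega>, S 0 \<omega>)) = bind (\<rho> q) (semi_markov_kernel \<nu> q)"
    and ergodic: "q \<in> space \<QQ> \<Longrightarrow> ergodic_chain E (chain_kernel E \<nu> q) (\<rho> q)"
    and finite_mean_sojourn: "q \<in> space \<QQ> \<Longrightarrow> (\<integral>\<^sup>+ x. mean_sojourn E \<nu> q x \<partial>\<rho> q) < \<infinity>"
    and nondegenerate: "q \<in> space \<QQ> \<Longrightarrow> nondegenerate_sojourns E (Pr q) J S"

subsection \<open>Semi-distances and covering numbers\<close>

definition hellinger_sq ::
    "('e \<times> real) measure \<Rightarrow> 'e kernel_density \<Rightarrow> 'e kernel_density \<Rightarrow> 'e \<Rightarrow> ennreal" where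
  "hellinger_sq \<nu> q1 q2 x = (\<integral>\<^sup>+ z. ennreal ((sqrt (q1 x z) - sqrt (q2 x z))\<^sup>2) \<partial>\<nu>) / 2"

text \<open>The value may be infinite, since \<open>\<mu>\<close> need not be finite.\<close>

definition semi_dist ::
    "('e \<times> real) measure \<Rightarrow> 'e measure \<Rightarrow> 'e kernel_density \<Rightarrow> 'e kernel_density \<Rightarrow> ennreal" where
  "semi_dist \<nu> \<mu> q1 q2 = sqrt_ennreal (\<integral>\<^sup>+ x. hellinger_sq \<nu> q1 q2 x \<partial>\<mu>)"

definition closed_ball :: "'a set \<Rightarrow> ('a \<Rightarrow> 'a \<Rightarrow> ennreal) \<Rightarrow> 'a \<Rightarrow> real \<Rightarrow> 'a set" where
  "closed_ball X d a r = {b \<in> X. d a b \<le> ennreal r}"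

text \<open>Centres range over the ambient space \<open>X\<close>; the infimum is \<open>\<infinity>\<close> if no finite cover exists.\<close>

definition covering_number ::
    "'a set \<Rightarrow> real \<Rightarrow> 'a set \<Rightarrow> ('a \<Rightarrow> 'a \<Rightarrow> ennreal) \<Rightarrow> enat" where
  "covering_number X r A d =
     Inf {enat (card C) | C. finite C \<and> C \<subseteq> X \<and> A \<subseteq> (\<Union>c\<in>C. closed_ball X d c r)}"

subsection \<open>Likelihood, posterior, Kullback--Leibler neighbourhoods\<close>

definition initial_density ::
    "('e kernel_density \<Rightarrow> 'e measure) \<Rightarrow> 'e kernel_density \<Rightarrow> 'e \<times> real \<Rightarrow> ennreal" where
  "initial_density \<rho> q z = (\<integral>\<^sup>+ x. ennreal (q x z) \<partial>\<rho> q)"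

definition likelihood ::
    "('e kernel_density \<Rightarrow> 'e measure) \<Rightarrow> nat \<Rightarrow> 'e kernel_density \<Rightarrow> 'e history \<Rightarrow> ennreal" where
  "likelihood \<rho> n q = (\<lambda>(j, s). initial_density \<rho> q (j 0, s 0) *
     (\<Prod>l=1..n. ennreal (q (j (l - 1)) (j l, s l - s (l - 1)))))"

definition posterior ::
    "('e kernel_density \<Rightarrow> 'e measure) \<Rightarrow> nat \<Rightarrow> 'e kernel_density measure \<Rightarrow> 'e history
      \<Rightarrow> 'e kernel_density set \<Rightarrow> ennreal" where
  "posterior \<rho> n prior h A =
     (\<integral>\<^sup>+ q\<in>A. likelihood \<rho> n q h \<partial>prior) / (\<integral>\<^sup>+ q. likelihood \<rho> n q h \<partial>prior)"

definition log_likelihood_ratio ::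
    "('e kernel_density \<Rightarrow> 'e measure) \<Rightarrow> nat \<Rightarrow> 'e kernel_density \<Rightarrow> 'e kernel_density
      \<Rightarrow> 'e history \<Rightarrow> ereal" where
  "log_likelihood_ratio \<rho> n q0 q h = ln_ennreal (likelihood \<rho> n q0 h / likelihood \<rho> n q h)"

text \<open>\<open>P0\<close> is the law of the history of length \<open>n\<close> under \<open>q0\<close>.\<close>

definition KL_neighbourhood ::
    "'e kernel_density set \<Rightarrow> ('e kernel_density \<Rightarrow> 'e measure) \<Rightarrow> nat \<Rightarrow> 'e history measure
      \<Rightarrow> 'e kernel_density \<Rightarrow> real \<Rightarrow> 'e kernel_density set" where
  "KL_neighbourhood Qs \<rho> n P0 q0 r =
     {q \<in> Qs. ext_expectation P0 (log_likelihood_ratio \<rho> n q0 q) \<le> ereal (real n * r\<^sup>2) \<and>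
              ext_variance P0 (log_likelihood_ratio \<rho> n q0 q) \<le> ereal (real n * r\<^sup>2)}"

end

theory Submission
  imports Defs "HOL-Real_Asymp.Real_Asymp"
begin

text \<open>The posterior mass of a set is controlled by tests of \<open>q0\<close> against Hellinger balls together with a
  lower bound on the evidence.

  The tests follow Birge's idea for Markov chains.  With \<open>u\<close>, \<open>v\<close> the square roots of two densities,
  the ratio \<open>(2u + v) / (u + 2v)\<close> lies between 1/2 and 2 and its mean drops by a multiple of the squared
  Hellinger distance, uniformly over a small Hellinger ball.  The drop depends on the state
  \<open>J\<^sub>n\<close>, so the observations are cut into blocks: waiting \<open>l\<close> steps bounds the law of the state
  by \<open>\<eta>\<^sup>*\<close>, and averaging over the next \<open>k\<close> steps bounds it from below by \<open>\<nu>\<^sup>*\<close>.  The products of block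
  averages therefore decay exponentially, both under \<open>q0\<close> and (with \<open>u\<close> and \<open>v\<close> exchanged) under every
  member of the ball; the arithmetic-harmonic mean inequality links the two products.  Covering
  shells \<open>j M \<epsilon>\<^sub>n < d(q0, q) \<le> (j + 1) M \<epsilon>\<^sub>n\<close> by small balls yields the final tests.

  For the evidence, Chebyshev's inequality shows for each single \<open>q\<close> in the Kullback-Leibler neighbourhood
  that the likelihood ratio is rarely below \<open>exp (- 2 n \<epsilon>\<^sub>n\<^sup>2)\<close>; by Fubini and Markov, with high
  probability this holds for half of the prior mass of the neighbourhood.\<close>

subsection \<open>A bounded substitute for the likelihood ratio\<close>

text \<open>Separation is measured in one semi-distance and approximation in another. The gain of a
  test is bounded below only through \<open>\<nu>s\<close>, the cost of replacing a parameter by the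
  centre of its ball is bounded above only through \<open>\<eta>s\<close>; hence shells for
  \<open>\<nu>s\<close> and covers for \<open>\<eta>s\<close>. A block mean is at most
  \<open>exp (8 * \<delta> - d / 6)\<close>, with \<open>d\<close> a lower bound on the squared
  \<open>\<nu>s\<close>-separation and \<delta> the squared \<open>\<eta>s\<close>-radius. For a
  shell of outer radius r and covering radius r/40 one may take d = 199 r^2 / 1600 and \<delta> =
  r^2 / 1600; then d / 6 - 8 \<delta> = 151 r^2 / 9600 exceeds r^2 / 100. This is why \<xi> = 1/40
  works.

  Scores are averaged, not multiplied, inside a block because the minorization concerns the average
  of \<open>k\<close> laws, not each of them. The price is that reciprocal scores do not have
  reciprocal averages; the inequality that survives has the direction needed for the tests.

  Since subtraction of extended numbers is truncated, gains are added to the left-hand side and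
  moved across only once finiteness is known.\<close>

definition hellinger_weight :: "real \<Rightarrow> real \<Rightarrow> real" where
  "hellinger_weight u v = 1 + (u - v) / (2 * v + u)"

text \<open>The definition is written as \<open>1 + (u - v) / (2 * v + u)\<close> because a quotient
  with zero denominator is 0: two vanishing densities get weight 1, so reciprocity and the bounds
  below hold without exception.\<close>

lemma hellinger_weight_eq:
  assumes "0 \<le> u" "0 \<le> v" "0 < 2 * v + u"
  shows "hellinger_weight u v = (2 * u + v) / (2 * v + u)"
  using assms by (simp add: hellinger_weight_def field_simps)

lemma hellinger_weight_inverse:
  assumes "0 \<le> u" "0 \<le> v"
  shows "hellinger_weight u v * hellinger_weight v u = 1"
proof (cases "u = 0 \<and> v = 0")
  case True
  then show ?thesis by (simp add: hellinger_weight_def)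
next
  case False
  then have "0 < 2 * v + u" "0 < 2 * u + v" using assms by auto
  then show ?thesis
    using assms by (simp add: hellinger_weight_eq)
qed

lemma hellinger_weight_bounds:
  assumes "0 \<le> u" "0 \<le> v"
  shows "1/2 \<le> hellinger_weight u v" "hellinger_weight u v \<le> 2"
proof -
  have "1/2 \<le> hellinger_weight u v \<and> hellinger_weight u v \<le> 2"
  proof (cases "u = 0 \<and> v = 0")
    case True
    then show ?thesis by (simp add: hellinger_weight_def)
  next
    case False
    then have "0 < 2 * v + u" using assms by auto
    then show ?thesis
      using assms by (simp add: hellinger_weight_eq field_simps)
  qed
  then show "1/2 \<le> hellinger_weight u v" "hellinger_weight u v \<le> 2" by auto
qed

lemma hellinger_weight_pos: "0 \<le> u \<Longrightarrow> 0 \<le> v \<Longrightarrow> 0 < hellinger_weight u v"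
  using hellinger_weight_bounds(1)[of u v] by linarith

lemma borel_measurable_hellinger_weight [measurable (raw)]:
  assumes [measurable]: "f \<in> borel_measurable M" "g \<in> borel_measurable M"
  shows "(\<lambda>x. hellinger_weight (f x) (g x)) \<in> borel_measurable M"
  unfolding hellinger_weight_def by measurable

text \<open>The terms \<open>v\<^sup>2 / 6\<close> and \<open>u\<^sup>2 / 6\<close> cancel after integration; they remove the first-order term of
  the expansion at \<open>u = v\<close>.\<close>

lemma hellinger_weight_square_le:
  fixes u v w :: real
  assumes "0 \<le> u" "0 \<le> v"
  shows "w\<^sup>2 * hellinger_weight u v + (u - v)\<^sup>2 / 12 + v\<^sup>2 / 6 \<le> w\<^sup>2 + 4 * (w - v)\<^sup>2 + u\<^sup>2 / 6"
proof (cases "u = 0 \<and> v = 0")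
  case True
  then show ?thesis by (simp add: hellinger_weight_def)
next
  case False
  define D where "D = 2 * v + u"
  have D: "0 < D" using False assms by (auto simp: D_def)
  define g where "g = (u - v) / D"
  have Dg: "D * g = u - v" using D by (simp add: g_def)
  have g1: "\<bar>g\<bar> \<le> 1"
    using D assms by (simp add: g_def D_def abs_le_iff field_simps)
  have vg: "\<bar>v * g\<bar> \<le> \<bar>u - v\<bar> / 2"
  proof -
    have "v \<le> D / 2" using assms by (simp add: D_def)
    then have "v * \<bar>g\<bar> \<le> D / 2 * \<bar>g\<bar>" by (intro mult_right_mono) auto
    also have "\<dots> = \<bar>D * g\<bar> / 2" using D by (simp add: abs_mult)
    finally show ?thesis using assms Dg by (simp add: abs_mult)
  qed
  \<comment> \<open>The case \<open>w = v\<close>. The right-hand side is just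
    \<open>v * (u - v) / 3\<close>; multiplied by \<open>D\<close> it exceeds
    \<open>v\<^sup>2 * (u - v)\<close> by \<open>v * (u - v)\<^sup>2 / 3\<close>. Half of the gain
    \<open>(u - v)\<^sup>2 / 6\<close> pays for the cross term below.\<close>
  have a: "v\<^sup>2 * g \<le> - ((u - v)\<^sup>2 / 6) - (v\<^sup>2 - u\<^sup>2) / 6"
  proof -
    have "D * (v\<^sup>2 * g) = v\<^sup>2 * (u - v)" using Dg by (metis mult.left_commute)
    moreover have "D * (- ((u - v)\<^sup>2 / 6) - (v\<^sup>2 - u\<^sup>2) / 6) - v\<^sup>2 * (u - v) = (u - v)\<^sup>2 * (2 * v) / 6"
      by (simp add: D_def field_simps power2_eq_square)
    moreover have "0 \<le> (u - v)\<^sup>2 * (2 * v) / 6" using assms by simp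
    ultimately have "D * (v\<^sup>2 * g) \<le> D * (- ((u - v)\<^sup>2 / 6) - (v\<^sup>2 - u\<^sup>2) / 6)" by linarith
    then show ?thesis using D by (simp add: mult_le_cancel_left_pos)
  qed
  \<comment> \<open>A weighted arithmetic-geometric mean inequality: it spends 1/12 of the available
    1/6 and costs \<open>3 * (w - v)\<^sup>2\<close>; the quadratic term \<open>c\<close> raises
    this coefficient to 4.\<close>
  have b: "2 * (w - v) * (v * g) \<le> (u - v)\<^sup>2 / 12 + 3 * (w - v)\<^sup>2"
  proof -
    have "2 * (w - v) * (v * g) \<le> 2 * \<bar>w - v\<bar> * \<bar>v * g\<bar>"
      by (metis abs_ge_self abs_mult abs_numeral)
    also have "\<dots> \<le> 2 * \<bar>w - v\<bar> * (\<bar>u - v\<bar> / 2)" using vg by (intro mult_left_mono) auto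
    finally have "2 * (w - v) * (v * g) \<le> \<bar>w - v\<bar> * \<bar>u - v\<bar>" by simp
    moreover have "0 \<le> (\<bar>u - v\<bar> / 6 - \<bar>w - v\<bar>)\<^sup>2" by simp
    then have "\<bar>w - v\<bar> * \<bar>u - v\<bar> \<le> (u - v)\<^sup>2 / 12 + 3 * (w - v)\<^sup>2"
      by (simp add: power2_diff power_divide algebra_simps)
    ultimately show ?thesis by linarith
  qed
  have c: "(w - v)\<^sup>2 * g \<le> (w - v)\<^sup>2"
    using g1 mult_left_mono[of g 1 "(w - v)\<^sup>2"] by auto
  have "w\<^sup>2 * g = v\<^sup>2 * g + 2 * (w - v) * (v * g) + (w - v)\<^sup>2 * g"
    by (simp add: power2_eq_square algebra_simps)
  moreover have "w\<^sup>2 * hellinger_weight u v = w\<^sup>2 + w\<^sup>2 * g"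
    by (simp add: hellinger_weight_def g_def D_def algebra_simps)
  moreover have "(v\<^sup>2 - u\<^sup>2) / 6 = v\<^sup>2 / 6 - u\<^sup>2 / 6" by (simp add: diff_divide_distrib)
  ultimately show ?thesis using a b c by linarith
qed

lemma ennreal_add_right_le_cancel:
  assumes "a + ennreal c \<le> b + ennreal c"
  shows "a \<le> b"
  using assms ennreal_add_left_cancel_le[of "ennreal c" a b]
  by (simp add: add.commute[of _ "ennreal c"])

text \<open>The pointwise inequality with \<open>w\<^sup>2 = q\<close>,
  \<open>u\<^sup>2 = qa\<close>, \<open>v\<^sup>2 = qb\<close> is integrated with nonnegative terms
  only. Since \<open>qa\<close> and \<open>qb\<close> both have integral 1, each side carries the
  same finite surplus 1/6, which cancels.\<close>

lemma hellinger_weight_nn_integral_le: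
  fixes q qa qb :: "'z \<Rightarrow> real"
  assumes [measurable]: "q \<in> borel_measurable N" "qa \<in> borel_measurable N" "qb \<in> borel_measurable N"
    and nonneg: "\<And>z. z \<in> space N \<Longrightarrow> 0 \<le> q z" "\<And>z. z \<in> space N \<Longrightarrow> 0 \<le> qa z"
      "\<And>z. z \<in> space N \<Longrightarrow> 0 \<le> qb z"
    and total: "(\<integral>\<^sup>+z. ennreal (q z) \<partial>N) = 1" "(\<integral>\<^sup>+z. ennreal (qa z) \<partial>N) = 1"
      "(\<integral>\<^sup>+z. ennreal (qb z) \<partial>N) = 1"
  shows "(\<integral>\<^sup>+z. ennreal (q z) * ennreal (hellinger_weight (sqrt (qa z)) (sqrt (qb z))) \<partial>N)
      + (\<integral>\<^sup>+z. ennreal ((sqrt (qa z) - sqrt (qb z))\<^sup>2) \<partial>N) * ennreal (1/12)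
    \<le> 1 + ennreal 4 * (\<integral>\<^sup>+z. ennreal ((sqrt (q z) - sqrt (qb z))\<^sup>2) \<partial>N)" (is "?A + ?B * _ \<le> 1 + _ * ?C")
proof -
  let ?g = "\<lambda>z. hellinger_weight (sqrt (qa z)) (sqrt (qb z))"
  have "(?A + ?B * ennreal (1/12)) + ennreal (1/6)
      = (\<integral>\<^sup>+z. ennreal (q z) * ennreal (?g z) + ennreal ((sqrt (qa z) - sqrt (qb z))\<^sup>2) * ennreal (1/12)
          + ennreal (qb z) * ennreal (1/6) \<partial>N)"
    by (simp add: nn_integral_add nn_integral_multc total)
  also have "\<dots> \<le> (\<integral>\<^sup>+z. ennreal (q z) + ennreal 4 * ennreal ((sqrt (q z) - sqrt (qb z))\<^sup>2)
          + ennreal (qa z) * ennreal (1/6) \<partial>N)"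
  proof (rule nn_integral_mono)
    fix z assume z: "z \<in> space N"
    note n = nonneg[OF z]
    have g0: "0 \<le> ?g z" using hellinger_weight_pos[of "sqrt (qa z)" "sqrt (qb z)"] n by simp
    have "q z * ?g z + (sqrt (qa z) - sqrt (qb z))\<^sup>2 * (1/12) + qb z * (1/6)
       \<le> q z + 4 * (sqrt (q z) - sqrt (qb z))\<^sup>2 + qa z * (1/6)"
      using hellinger_weight_square_le[of "sqrt (qa z)" "sqrt (qb z)" "sqrt (q z)"] n by simp
    then show "ennreal (q z) * ennreal (?g z) + ennreal ((sqrt (qa z) - sqrt (qb z))\<^sup>2) * ennreal (1/12)
          + ennreal (qb z) * ennreal (1/6)
       \<le> ennreal (q z) + ennreal 4 * ennreal ((sqrt (q z) - sqrt (qb z))\<^sup>2) + ennreal (qa z) * ennreal (1/6)"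
      using n g0
      by (simp add: ennreal_mult[symmetric] ennreal_plus[symmetric] ennreal_leI
        del: ennreal_plus ennreal_numeral)
  qed
  also have "\<dots> = (1 + ennreal 4 * ?C) + ennreal (1/6)"
    by (simp add: nn_integral_add nn_integral_multc nn_integral_cmult total)
  finally show ?thesis
    by (rule ennreal_add_right_le_cancel)
qed

subsection \<open>Extended nonnegative numbers\<close>

lemma sqrt_ennreal_le_iff:
  assumes "0 \<le> r"
  shows "sqrt_ennreal x \<le> ennreal r \<longleftrightarrow> x \<le> ennreal (r\<^sup>2)"
proof (cases x)
  case (real y)
  moreover have "sqrt y \<le> r \<longleftrightarrow> y \<le> r\<^sup>2"
    using assms sqrt_le_D[of y r] real_le_lsqrt[of r y] real by auto
  ultimately show ?thesis using assms by (simp add: sqrt_ennreal_def)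
next
  case top
  then show ?thesis by (simp add: sqrt_ennreal_def top_unique)
qed

lemma ln_ennreal_le_iff:
  "ln_ennreal x \<le> ereal a \<longleftrightarrow> x \<le> ennreal (exp a)"
proof (cases x)
  case (real y)
  show ?thesis
  proof (cases "y = 0")
    case False
    then have "0 < y" using real by simp
    then show ?thesis using real by (simp add: ln_ennreal_def) (metis exp_le_cancel_iff exp_ln)
  qed (simp add: real ln_ennreal_def)
next
  case top
  then show ?thesis by (simp add: ln_ennreal_def top_unique)
qed

lemma borel_measurable_ln_ennreal [measurable]: "ln_ennreal \<in> borel_measurable borel"
proof -
  have "(\<lambda>x. if x = 0 then - \<infinity> else if x = \<infinity> then \<infinity> else ereal (ln (enn2real x))) \<in> borel_measurable borel"
    by measurable
  then show ?thesis by (simp add: ln_ennreal_def[abs_def])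
qed

text \<open>Domination on sets passes to nonnegative integrands by the usual induction over
  measurable functions. The weighted sum serves the average over \<open>k\<close> steps in the
  minorization and, with one summand, the majorization.\<close>

lemma nn_integral_le_of_emeasure_le_sum:
  assumes f: "f \<in> borel_measurable \<mu>"
    and sets: "\<And>i. i \<in> I \<Longrightarrow> sets (N i) = sets \<mu>"
    and le: "\<And>A. A \<in> sets \<mu> \<Longrightarrow> emeasure \<mu> A \<le> c * (\<Sum>i\<in>I. emeasure (N i) A)"
  shows "(\<integral>\<^sup>+x. f x \<partial>\<mu>) \<le> c * (\<Sum>i\<in>I. \<integral>\<^sup>+x. f x \<partial>N i)"
  using f
proof induct
  case (cong f g)
  have "(\<Sum>i\<in>I. \<integral>\<^sup>+x. f x \<partial>N i) = (\<Sum>i\<in>I. \<integral>\<^sup>+x. g x \<partial>N i)"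
    using cong(3) sets_eq_imp_space_eq[OF sets] by (intro sum.cong nn_integral_cong) auto
  then show ?case using cong by (simp cong: nn_integral_cong)
next
  case (set A)
  then show ?case using le[OF set] sets by (simp cong: sum.cong)
next
  case (mult u a)
  have "(\<Sum>i\<in>I. \<integral>\<^sup>+x. a * u x \<partial>N i) = a * (\<Sum>i\<in>I. \<integral>\<^sup>+x. u x \<partial>N i)"
    using mult sets by (simp add: sum_distrib_left nn_integral_cmult cong: measurable_cong_sets)
  then show ?case using mult by (simp add: nn_integral_cmult mult.left_commute mult_left_mono)
next
  case (add u v)
  have "(\<Sum>i\<in>I. \<integral>\<^sup>+x. v x + u x \<partial>N i) = (\<Sum>i\<in>I. \<integral>\<^sup>+x. v x \<partial>N i) + (\<Sum>i\<in>I. \<integral>\<^sup>+x. u x \<partial>N i)"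
    using add sets by (simp add: sum.distrib[symmetric] nn_integral_add cong: measurable_cong_sets)
  then show ?case using add by (simp add: nn_integral_add distrib_left add_mono)
next
  case (seq U)
  have "(\<integral>\<^sup>+x. (SUP n. U n) x \<partial>\<mu>) = (SUP n. \<integral>\<^sup>+x. U n x \<partial>\<mu>)"
    using seq by (simp add: nn_integral_monotone_convergence_SUP image_comp)
  also have "\<dots> \<le> c * (\<Sum>i\<in>I. \<integral>\<^sup>+x. (SUP n. U n) x \<partial>N i)"
  proof (rule SUP_least)
    fix n
    have "(\<integral>\<^sup>+x. U n x \<partial>\<mu>) \<le> c * (\<Sum>i\<in>I. \<integral>\<^sup>+x. U n x \<partial>N i)" using seq by simp
    also have "\<dots> \<le> c * (\<Sum>i\<in>I. \<integral>\<^sup>+x. (SUP n. U n) x \<partial>N i)"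
      by (intro mult_left_mono sum_mono nn_integral_mono) (auto intro: SUP_upper)
    finally show "(\<integral>\<^sup>+x. U n x \<partial>\<mu>) \<le> c * (\<Sum>i\<in>I. \<integral>\<^sup>+x. (SUP n. U n) x \<partial>N i)" .
  qed
  finally show ?case .
qed

subsection \<open>The embedded chain\<close>

text \<open>The action of the embedded chain on functions of the state. Being an integral against
  the fixed measure \<open>\<nu>\<close>, it keeps joint measurability in parameter and state under
  iteration.\<close>

definition transition_operator ::
    "('e \<times> real) measure \<Rightarrow> 'e kernel_density \<Rightarrow> ('e \<Rightarrow> ennreal) \<Rightarrow> 'e \<Rightarrow> ennreal" where
  "transition_operator \<nu> q f x = (\<integral>\<^sup>+z. ennreal (q x z) * f (fst z) \<partial>\<nu>)"

context semi_markov_model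
begin

abbreviation mark_space :: "('e \<times> real) measure" where
  "mark_space \<equiv> E \<Otimes>\<^sub>M half_line"

section \<open>Measurability and integration for the transition kernels\<close>

lemma space_nu: "space \<nu> = space E \<times> {0..}"
  using sets_eq_imp_space_eq[OF sets_nu] by (simp add: space_pair_measure space_restrict_space)

lemma space_mark: "space mark_space = space E \<times> {0..}"
  by (simp add: space_pair_measure space_restrict_space)

lemma measurable_nu [simp]: "measurable \<nu> N = measurable mark_space N"
  by (rule measurable_cong_sets) (simp_all add: sets_nu)

lemma sets_pair_nu: "sets (N \<Otimes>\<^sub>M \<nu>) = sets (N \<Otimes>\<^sub>M mark_space)"
  by (rule sets_pair_measure_cong) (simp_all add: sets_nu)

lemma measurable_pair_nu [simp]: "measurable (N \<Otimes>\<^sub>M \<nu>) L = measurable (N \<Otimes>\<^sub>M mark_space) L"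
  by (rule measurable_cong_sets) (simp_all add: sets_pair_nu)

lemma borel_measurable_nn_integral_nu:
  "(\<lambda>(x, z). f x z) \<in> borel_measurable (N \<Otimes>\<^sub>M mark_space) \<Longrightarrow>
    (\<lambda>x. \<integral>\<^sup>+z. f x z \<partial>\<nu>) \<in> borel_measurable N"
  by (rule sigma_finite_measure.borel_measurable_nn_integral[OF sigma_finite_nu]) simp

lemma measurable_parameter_density:
  assumes "a \<in> measurable N \<QQ>" "f \<in> measurable N E" "g \<in> measurable N mark_space"
  shows "(\<lambda>w. a w (f w) (g w)) \<in> borel_measurable N"
proof -
  have "(\<lambda>w. (a w, f w, g w)) \<in> measurable N (\<QQ> \<Otimes>\<^sub>M (E \<Otimes>\<^sub>M mark_space))"
    using assms by simp
  from measurable_compose[OF this jointly_measurable] show ?thesis by simp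
qed

lemma measurable_density:
  assumes "q \<in> space \<QQ>" "f \<in> measurable N E" "g \<in> measurable N mark_space"
  shows "(\<lambda>w. q (f w) (g w)) \<in> borel_measurable N"
  using measurable_parameter_density[of "\<lambda>_. q"] assms by simp

lemma measurable_density_section:
  "q \<in> space \<QQ> \<Longrightarrow> x \<in> space E \<Longrightarrow> q x \<in> borel_measurable mark_space"
  using measurable_density[of q "\<lambda>_. x" mark_space "\<lambda>z. z"] by simp

lemma density_nonneg:
  "q \<in> space \<QQ> \<Longrightarrow> x \<in> space E \<Longrightarrow> z \<in> space mark_space \<Longrightarrow> 0 \<le> q x z"
  using density by (auto simp: semi_markov_density_def)

lemma density_total: "q \<in> space \<QQ> \<Longrightarrow> x \<in> space E \<Longrightarrow> (\<integral>\<^sup>+z. ennreal (q x z) \<partial>\<nu>) = 1"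
  using density by (auto simp: semi_markov_density_def)

lemma sets_semi_markov_kernel: "sets (semi_markov_kernel \<nu> q x) = sets mark_space"
  by (simp add: semi_markov_kernel_def sets_nu)

lemma prob_space_semi_markov_kernel:
  assumes "q \<in> space \<QQ>" "x \<in> space E"
  shows "prob_space (semi_markov_kernel \<nu> q x)"
proof
  have "emeasure (semi_markov_kernel \<nu> q x) (space \<nu>) = (\<integral>\<^sup>+z. ennreal (q x z) * indicator (space \<nu>) z \<partial>\<nu>)"
    unfolding semi_markov_kernel_def using measurable_density_section[OF assms]
    by (intro emeasure_density) auto
  also have "\<dots> = (\<integral>\<^sup>+z. ennreal (q x z) \<partial>\<nu>)" by (intro nn_integral_cong) simp
  finally show "emeasure (semi_markov_kernel \<nu> q x) (space (semi_markov_kernel \<nu> q x)) = 1"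
    using density_total[OF assms] by (simp add: semi_markov_kernel_def)
qed

lemma nn_integral_semi_markov_kernel:
  assumes "q \<in> space \<QQ>" "x \<in> space E" "f \<in> borel_measurable mark_space"
  shows "(\<integral>\<^sup>+z. f z \<partial>semi_markov_kernel \<nu> q x) = (\<integral>\<^sup>+z. ennreal (q x z) * f z \<partial>\<nu>)"
  unfolding semi_markov_kernel_def using assms measurable_density_section[OF assms(1,2)]
  by (intro nn_integral_density) auto

lemma emeasure_semi_markov_kernel:
  assumes "q \<in> space \<QQ>" "x \<in> space E" "A \<in> sets mark_space"
  shows "emeasure (semi_markov_kernel \<nu> q x) A = (\<integral>\<^sup>+z. ennreal (q x z) * indicator A z \<partial>\<nu>)"
  unfolding semi_markov_kernel_def using assms measurable_density_section[OF assms(1,2)]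
  by (intro emeasure_density) (auto simp: sets_nu)

lemma measurable_semi_markov_kernel:
  assumes q: "q \<in> space \<QQ>"
  shows "semi_markov_kernel \<nu> q \<in> measurable E (subprob_algebra mark_space)"
proof (rule measurable_subprob_algebra)
  fix A assume A: "A \<in> sets mark_space"
  have "(\<lambda>x. \<integral>\<^sup>+z. ennreal (q x z) * indicator A z \<partial>\<nu>) \<in> borel_measurable E"
  proof (rule borel_measurable_nn_integral_nu)
    have [measurable]: "(\<lambda>w. q (fst w) (snd w)) \<in> borel_measurable (E \<Otimes>\<^sub>M mark_space)"
      by (rule measurable_density[OF q]) auto
    show "(\<lambda>(x, z). ennreal (q x z) * indicator A z) \<in> borel_measurable (E \<Otimes>\<^sub>M mark_space)"
      using A unfolding split_beta by measurable
  qed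
  then show "(\<lambda>x. emeasure (semi_markov_kernel \<nu> q x) A) \<in> borel_measurable E"
    by (rule measurable_cong[THEN iffD1, rotated]) (simp add: emeasure_semi_markov_kernel[OF q _ A])
qed (auto intro: prob_space_imp_subprob_space prob_space_semi_markov_kernel q simp: sets_semi_markov_kernel)

lemma fst_measurable_kernel: "fst \<in> measurable (semi_markov_kernel \<nu> q x) E"
  by (simp add: measurable_cong_sets[OF sets_semi_markov_kernel refl])

lemma measurable_chain_kernel:
  assumes "q \<in> space \<QQ>"
  shows "chain_kernel E \<nu> q \<in> measurable E (prob_algebra E)"
proof (rule measurable_prob_algebraI)
  show "prob_space (chain_kernel E \<nu> q x)" if "x \<in> space E" for x
    unfolding chain_kernel_def
    by (rule prob_space.prob_space_distr[OF prob_space_semi_markov_kernel[OF assms that] fst_measurable_kernel])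
  show "chain_kernel E \<nu> q \<in> measurable E (subprob_algebra E)"
    using measurable_compose[OF measurable_semi_markov_kernel[OF assms] measurable_distr[OF measurable_fst]]
    by (simp add: chain_kernel_def[abs_def])
qed

lemma measurable_kernel_pow:
  assumes "q \<in> space \<QQ>"
  shows "kernel_pow E (chain_kernel E \<nu> q) n \<in> measurable E (prob_algebra E)"
proof (induction n)
  case 0
  show ?case by (simp add: measurable_return_prob_space[unfolded])
next
  case (Suc n)
  show ?case using measurable_bind_prob_space[OF Suc measurable_chain_kernel[OF assms]] by simp
qed

lemma kernel_pow_space:
  assumes "q \<in> space \<QQ>" "x \<in> space E"
  shows "prob_space (kernel_pow E (chain_kernel E \<nu> q) n x)"
    and "sets (kernel_pow E (chain_kernel E \<nu> q) n x) = sets E"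
  using measurable_space[OF measurable_kernel_pow[OF assms(1)] assms(2), of n]
  by (auto simp: space_prob_algebra)

text \<open>The function \<open>f\<close> may itself depend on the parameter; the induction over
  powers of the operator needs this generality.\<close>

lemma measurable_transition_operator_param:
  assumes f: "(\<lambda>(q, x). f q x) \<in> borel_measurable (\<QQ> \<Otimes>\<^sub>M E)"
  shows "(\<lambda>(q, x). transition_operator \<nu> q (f q) x) \<in> borel_measurable (\<QQ> \<Otimes>\<^sub>M E)"
proof -
  have [measurable]: "(\<lambda>w. fst (fst w) (snd (fst w)) (snd w)) \<in> borel_measurable ((\<QQ> \<Otimes>\<^sub>M E) \<Otimes>\<^sub>M mark_space)"
    by (rule measurable_parameter_density) auto
  have "(\<lambda>w. (fst (fst w), fst (snd w))) \<in> measurable ((\<QQ> \<Otimes>\<^sub>M E) \<Otimes>\<^sub>M mark_space) (\<QQ> \<Otimes>\<^sub>M E)" by simp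
  from measurable_compose[OF this f]
  have [measurable]: "(\<lambda>w. f (fst (fst w)) (fst (snd w))) \<in> borel_measurable ((\<QQ> \<Otimes>\<^sub>M E) \<Otimes>\<^sub>M mark_space)"
    by simp
  show ?thesis
    unfolding transition_operator_def split_beta
    by (rule borel_measurable_nn_integral_nu) (unfold split_beta, measurable)
qed

lemma measurable_transition_operator:
  assumes q: "q \<in> space \<QQ>" and f: "f \<in> borel_measurable E"
  shows "transition_operator \<nu> q f \<in> borel_measurable E"
proof -
  have "(\<lambda>(q, x). transition_operator \<nu> q f x) \<in> borel_measurable (\<QQ> \<Otimes>\<^sub>M E)"
    by (rule measurable_transition_operator_param) (use f in \<open>simp add: split_beta\<close>)
  from measurable_compose[OF measurable_Pair1'[OF q] this] show ?thesis by simp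
qed

lemma measurable_transition_operator_funpow:
  assumes q: "q \<in> space \<QQ>" and f: "f \<in> borel_measurable E"
  shows "(transition_operator \<nu> q ^^ n) f \<in> borel_measurable E"
  by (induction n) (simp_all add: f measurable_transition_operator[OF q])

lemma measurable_transition_operator_funpow_param:
  assumes f: "f \<in> borel_measurable E"
  shows "(\<lambda>(q, x). (transition_operator \<nu> q ^^ n) f x) \<in> borel_measurable (\<QQ> \<Otimes>\<^sub>M E)"
proof (induction n)
  case 0
  show ?case using f by (simp add: split_beta)
next
  case (Suc n)
  show ?case using measurable_transition_operator_param[OF Suc] by simp
qed

lemma nn_integral_chain_kernel:
  assumes "q \<in> space \<QQ>" "x \<in> space E" "f \<in> borel_measurable E"
  shows "(\<integral>\<^sup>+y. f y \<partial>chain_kernel E \<nu> q x) = transition_operator \<nu> q f x"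
  unfolding chain_kernel_def transition_operator_def
  using assms by (simp add: nn_integral_distr fst_measurable_kernel nn_integral_semi_markov_kernel)

lemma nn_integral_kernel_pow:
  assumes q: "q \<in> space \<QQ>" and x: "x \<in> space E" and f: "f \<in> borel_measurable E"
  shows "(\<integral>\<^sup>+y. f y \<partial>kernel_pow E (chain_kernel E \<nu> q) n x) = (transition_operator \<nu> q ^^ n) f x"
  using f
proof (induction n arbitrary: f)
  case 0
  then show ?case using x by (simp add: nn_integral_return)
next
  case (Suc n)
  have sp: "space (kernel_pow E (chain_kernel E \<nu> q) n x) = space E"
    using sets_eq_imp_space_eq[OF kernel_pow_space(2)[OF q x]] .
  have "(\<integral>\<^sup>+y. f y \<partial>kernel_pow E (chain_kernel E \<nu> q) (Suc n) x)
      = (\<integral>\<^sup>+y. \<integral>\<^sup>+z. f z \<partial>chain_kernel E \<nu> q y \<partial>kernel_pow E (chain_kernel E \<nu> q) n x)"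
    using measurable_prob_algebraD[OF measurable_chain_kernel[OF q]] Suc.prems
    by (simp, intro nn_integral_bind[where B = E])
       (simp_all add: measurable_cong_sets[OF kernel_pow_space(2)[OF q x] refl])
  also have "\<dots> = (\<integral>\<^sup>+y. transition_operator \<nu> q f y \<partial>kernel_pow E (chain_kernel E \<nu> q) n x)"
    by (intro nn_integral_cong) (simp add: sp nn_integral_chain_kernel[OF q _ Suc.prems])
  also have "\<dots> = (transition_operator \<nu> q ^^ n) (transition_operator \<nu> q f) x"
    by (rule Suc.IH) (rule measurable_transition_operator[OF q Suc.prems])
  also have "\<dots> = (transition_operator \<nu> q ^^ Suc n) f x"
    by (simp add: funpow_swap1)
  finally show ?case .
qed

lemma emeasure_kernel_pow:
  assumes q: "q \<in> space \<QQ>" and x: "x \<in> space E" and A: "A \<in> sets E"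
  shows "emeasure (kernel_pow E (chain_kernel E \<nu> q) n x) A = (transition_operator \<nu> q ^^ n) (indicator A) x"
  using nn_integral_kernel_pow[OF q x, of "indicator A" n] A kernel_pow_space(2)[OF q x, of n] by simp

lemma emeasure_kernel_pow_add:
  assumes q: "q \<in> space \<QQ>" and x: "x \<in> space E" and A: "A \<in> sets E"
  shows "emeasure (kernel_pow E (chain_kernel E \<nu> q) (a + b) x) A
    = (\<integral>\<^sup>+y. emeasure (kernel_pow E (chain_kernel E \<nu> q) b y) A \<partial>kernel_pow E (chain_kernel E \<nu> q) a x)"
proof -
  have sp: "space (kernel_pow E (chain_kernel E \<nu> q) a x) = space E"
    using sets_eq_imp_space_eq[OF kernel_pow_space(2)[OF q x]] .
  have "emeasure (kernel_pow E (chain_kernel E \<nu> q) (a + b) x) A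
    = (transition_operator \<nu> q ^^ a) ((transition_operator \<nu> q ^^ b) (indicator A)) x"
    by (simp add: emeasure_kernel_pow[OF q x A] funpow_add)
  also have "\<dots> = (\<integral>\<^sup>+y. (transition_operator \<nu> q ^^ b) (indicator A) y \<partial>kernel_pow E (chain_kernel E \<nu> q) a x)"
    using A by (intro nn_integral_kernel_pow[OF q x, symmetric] measurable_transition_operator_funpow[OF q]) simp
  also have "\<dots> = (\<integral>\<^sup>+y. emeasure (kernel_pow E (chain_kernel E \<nu> q) b y) A \<partial>kernel_pow E (chain_kernel E \<nu> q) a x)"
    by (intro nn_integral_cong) (simp add: sp emeasure_kernel_pow[OF q _ A])
  finally show ?thesis .
qed

section \<open>The stationary law and the initial density\<close>

lemma rho_space:
  assumes "q \<in> space \<QQ>"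
  shows "prob_space (\<rho> q)" "sets (\<rho> q) = sets E" "space (\<rho> q) = space E"
  using ergodic[OF assms] sets_eq_imp_space_eq[of "\<rho> q" E] by (auto simp: ergodic_chain_def)

lemma space_E_nonempty: "q \<in> space \<QQ> \<Longrightarrow> space E \<noteq> {}"
  using prob_space.not_empty[OF rho_space(1)] rho_space(3) by metis

text \<open>Ergodicity exhibits \<open>\<rho> q\<close> as a limit of powers of the transition operator, which are
  jointly measurable in \<open>q\<close>.\<close>

lemma measurable_rho: "\<rho> \<in> measurable \<QQ> (subprob_algebra E)"
proof (cases "space \<QQ> = {}")
  case True
  then show ?thesis by (simp add: measurable_def)
next
  case False
  then obtain x where x: "x \<in> space E" using space_E_nonempty by blast
  show ?thesis
  proof (rule measurable_subprob_algebra)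
    fix A assume A: "A \<in> sets E"
    let ?P = "\<lambda>q n. kernel_pow E (chain_kernel E \<nu> q) n x"
    have "(\<lambda>q. emeasure (?P q n) A) \<in> borel_measurable \<QQ>" for n
    proof -
      have "(\<lambda>q. (q, x)) \<in> measurable \<QQ> (\<QQ> \<Otimes>\<^sub>M E)" using x by simp
      from measurable_compose[OF this measurable_transition_operator_funpow_param[of "indicator A" n]] A
      have "(\<lambda>q. (transition_operator \<nu> q ^^ n) (indicator A) x) \<in> borel_measurable \<QQ>" by simp
      then show ?thesis
        by (rule measurable_cong[THEN iffD1, rotated]) (simp add: emeasure_kernel_pow x A)
    qed
    then have meas: "(\<lambda>q. measure (?P q n) A) \<in> borel_measurable \<QQ>" for n
      unfolding measure_def by measurable
    have "(\<lambda>q. measure (\<rho> q) A) \<in> borel_measurable \<QQ>"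
    proof (rule borel_measurable_LIMSEQ_real[OF _ meas])
      fix q assume q: "q \<in> space \<QQ>"
      interpret r: prob_space "\<rho> q" by (rule rho_space[OF q])
      let ?g = "\<lambda>n. SUP B\<in>sets E. \<bar>measure (?P q n) B - measure (\<rho> q) B\<bar>"
      have lim: "?g \<longlonglongrightarrow> 0" using ergodic[OF q] x by (simp add: ergodic_chain_def)
      \<comment> \<open>A supremum of reals dominates its members only if the set is bounded, so the
        bound 1 is checked before the single set \<open>A\<close> is compared with the
        supremum.\<close>
      have le: "\<bar>measure (?P q n) A - measure (\<rho> q) A\<bar> \<le> ?g n" for n
      proof (rule cSUP_upper[OF A])
        interpret p: prob_space "?P q n" by (rule kernel_pow_space[OF q x])
        have "\<bar>measure (?P q n) B - measure (\<rho> q) B\<bar> \<le> 1" for B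
          using p.prob_le_1[of B] r.prob_le_1[of B] measure_nonneg[of "?P q n" B] measure_nonneg[of "\<rho> q" B]
          by linarith
        then show "bdd_above ((\<lambda>B. \<bar>measure (?P q n) B - measure (\<rho> q) B\<bar>) ` sets E)"
          by (auto intro!: bdd_aboveI)
      qed
      have "(\<lambda>n. measure (?P q n) A - measure (\<rho> q) A) \<longlonglongrightarrow> 0"
        by (rule tendsto_rabs_zero_cancel, rule tendsto_sandwich[OF _ _ tendsto_const lim]) (auto simp: le)
      then show "(\<lambda>n. measure (?P q n) A) \<longlonglongrightarrow> measure (\<rho> q) A" by (simp add: LIM_zero_iff)
    qed
    then have "(\<lambda>q. ennreal (measure (\<rho> q) A)) \<in> borel_measurable \<QQ>" by measurable
    then show "(\<lambda>q. emeasure (\<rho> q) A) \<in> borel_measurable \<QQ>"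
      by (rule measurable_cong[THEN iffD1, rotated])
        (simp add: finite_measure.emeasure_eq_measure prob_space.finite_measure rho_space)
  qed (auto simp: rho_space intro: prob_space_imp_subprob_space)
qed

lemma measurable_initial_density:
  assumes a: "a \<in> measurable N \<QQ>" and g: "g \<in> measurable N mark_space"
  shows "(\<lambda>w. initial_density \<rho> (a w) (g w)) \<in> borel_measurable N"
  unfolding initial_density_def
proof (rule nn_integral_measurable_subprob_algebra2[where N = E])
  have "(\<lambda>p. a (fst p) (snd p) (g (fst p))) \<in> borel_measurable (N \<Otimes>\<^sub>M E)"
    using a g by (intro measurable_parameter_density) (auto intro: measurable_compose[OF measurable_fst])
  then show "(\<lambda>(w, x). ennreal (a w x (g w))) \<in> borel_measurable (N \<Otimes>\<^sub>M E)"
    unfolding split_beta by measurable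
  show "(\<lambda>w. \<rho> (a w)) \<in> measurable N (subprob_algebra E)"
    by (rule measurable_compose[OF a measurable_rho])
qed

text \<open>Fubini turns the mixture of kernels over the stationary law into one density with
  respect to \<open>\<nu>\<close>; this justifies the first factor of the likelihood.\<close>

lemma bind_rho_eq_density:
  assumes q: "q \<in> space \<QQ>"
  shows "bind (\<rho> q) (semi_markov_kernel \<nu> q) = density \<nu> (initial_density \<rho> q)"
proof (rule measure_eqI)
  have K: "semi_markov_kernel \<nu> q \<in> measurable (\<rho> q) (subprob_algebra mark_space)"
    using measurable_semi_markov_kernel[OF q] by (simp add: measurable_cong_sets[OF rho_space(2)[OF q] refl])
  have ne: "space (\<rho> q) \<noteq> {}" using rho_space(1)[OF q] by (rule prob_space.not_empty)
  show s: "sets (bind (\<rho> q) (semi_markov_kernel \<nu> q)) = sets (density \<nu> (initial_density \<rho> q))"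
    using sets_bind_measurable[OF K ne] by (simp add: sets_nu)
  fix A assume "A \<in> sets (bind (\<rho> q) (semi_markov_kernel \<nu> q))"
  then have A[measurable]: "A \<in> sets mark_space" using s by (simp add: sets_nu)
  interpret r: prob_space "\<rho> q" by (rule rho_space[OF q])
  interpret nu: sigma_finite_measure \<nu> by (rule sigma_finite_nu)
  interpret pair_sigma_finite "\<rho> q" \<nu> ..
  have [measurable]: "(\<lambda>p. q (fst p) (snd p)) \<in> borel_measurable (\<rho> q \<Otimes>\<^sub>M mark_space)"
    by (rule measurable_density[OF q])
      (simp_all add: measurable_cong_sets[OF sets_pair_measure_cong[OF rho_space(2)[OF q] refl] refl])
  have "emeasure (bind (\<rho> q) (semi_markov_kernel \<nu> q)) A = (\<integral>\<^sup>+x. emeasure (semi_markov_kernel \<nu> q x) A \<partial>\<rho> q)"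
    by (rule emeasure_bind[OF ne K A])
  also have "\<dots> = (\<integral>\<^sup>+x. \<integral>\<^sup>+z. ennreal (q x z) * indicator A z \<partial>\<nu> \<partial>\<rho> q)"
    by (intro nn_integral_cong emeasure_semi_markov_kernel[OF q _ A]) (simp add: rho_space[OF q])
  also have "\<dots> = (\<integral>\<^sup>+z. \<integral>\<^sup>+x. ennreal (q x z) * indicator A z \<partial>\<rho> q \<partial>\<nu>)"
    by (rule Fubini'[symmetric]) (simp add: split_beta)
  also have "\<dots> = (\<integral>\<^sup>+z. initial_density \<rho> q z * indicator A z \<partial>\<nu>)"
  proof (rule nn_integral_cong)
    fix z assume z: "z \<in> space \<nu>"
    have "(\<lambda>x. q x z) \<in> borel_measurable (\<rho> q)"
      using z by (intro measurable_density[OF q])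
        (simp_all add: measurable_cong_sets[OF rho_space(2)[OF q] refl] space_nu space_mark)
    then show "(\<integral>\<^sup>+x. ennreal (q x z) * indicator A z \<partial>\<rho> q) = initial_density \<rho> q z * indicator A z"
      unfolding initial_density_def by (intro nn_integral_multc) simp
  qed
  also have "\<dots> = emeasure (density \<nu> (initial_density \<rho> q)) A"
    using measurable_initial_density[of "\<lambda>_. q" mark_space "\<lambda>z. z"] q
    by (intro emeasure_density[symmetric]) (simp_all add: sets_nu)
  finally show "emeasure (bind (\<rho> q) (semi_markov_kernel \<nu> q)) A = emeasure (density \<nu> (initial_density \<rho> q)) A" .
qed

end

subsection \<open>Uniqueness of measures on products\<close>

lemma emeasure_distr_density_indicator:
  assumes "A \<in> sets \<mu>" "f \<in> measurable \<mu> N" "T \<in> sets N"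
  shows "emeasure (distr (density \<mu> (indicator A)) N f) T = emeasure \<mu> (A \<inter> (f -` T \<inter> space \<mu>))"
proof -
  have T: "f -` T \<inter> space \<mu> \<in> sets \<mu>" using assms(2,3) by (rule measurable_sets)
  have "emeasure (distr (density \<mu> (indicator A)) N f) T = emeasure (density \<mu> (indicator A)) (f -` T \<inter> space \<mu>)"
    using assms by (simp add: emeasure_distr)
  also have "\<dots> = (\<integral>\<^sup>+x. indicator A x * indicator (f -` T \<inter> space \<mu>) x \<partial>\<mu>)"
    using assms T by (intro emeasure_density) auto
  also have "\<dots> = (\<integral>\<^sup>+x. indicator (A \<inter> (f -` T \<inter> space \<mu>)) x \<partial>\<mu>)"
    by (intro nn_integral_cong) (simp add: indicator_inter_arith)
  finally show ?thesis using assms T by simp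
qed

lemma pair_measure_eqI_rectangles:
  assumes fin: "emeasure \<mu> (space \<mu>) \<noteq> \<infinity>"
    and sets: "sets \<mu> = sets (A \<Otimes>\<^sub>M B)" "sets \<mu>' = sets (A \<Otimes>\<^sub>M B)"
    and eq: "\<And>a b. a \<in> sets A \<Longrightarrow> b \<in> sets B \<Longrightarrow> emeasure \<mu> (a \<times> b) = emeasure \<mu>' (a \<times> b)"
  shows "\<mu> = \<mu>'"
proof (rule measure_eqI_generator_eq[OF Int_stable_pair_measure_generator[of A B]])
  have sp: "space \<mu> = space A \<times> space B"
    using sets_eq_imp_space_eq[OF sets(1)] by (simp add: space_pair_measure)
  show "{a \<times> b |a b. a \<in> sets A \<and> b \<in> sets B} \<subseteq> Pow (space A \<times> space B)"
    by (rule pair_measure_closed)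
  show "sets \<mu> = sigma_sets (space A \<times> space B) {a \<times> b |a b. a \<in> sets A \<and> b \<in> sets B}"
    "sets \<mu>' = sigma_sets (space A \<times> space B) {a \<times> b |a b. a \<in> sets A \<and> b \<in> sets B}"
    by (simp_all add: sets sets_pair_measure)
  show "range (\<lambda>_::nat. space A \<times> space B) \<subseteq> {a \<times> b |a b. a \<in> sets A \<and> b \<in> sets B}"
    by auto
  show "emeasure \<mu> (space A \<times> space B) \<noteq> \<infinity>" using fin sp by simp
qed (auto simp: eq)

lemma half_line_measure_eqI:
  assumes fin: "emeasure \<mu> {0..} \<noteq> \<infinity>"
    and sets: "sets \<mu> = sets half_line" "sets \<mu>' = sets half_line"
    and eq: "\<And>t. 0 \<le> t \<Longrightarrow> emeasure \<mu> {0..t} = emeasure \<mu>' {0..t}"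
  shows "\<mu> = \<mu>'"
proof -
  \<comment> \<open>Traces of all half-lines, so that the standard generator of the Borel sets can
    be transported; a negative \<open>a\<close> contributes only the empty set.\<close>
  let ?G = "{(\<lambda>x. x) -` {..a} \<inter> {0..} | a :: real. True}"
  have G: "sets half_line = sigma_sets {0..} ?G"
  proof -
    have "sets half_line = sets (vimage_algebra {0..} (\<lambda>x. x) (borel :: real measure))"
      by (rule restrict_space_eq_vimage_algebra) simp
    also have "\<dots> = sets (sigma {0::real..} {(\<lambda>x. x) -` A \<inter> {0..} | A. A \<in> range atMost})"
      by (subst borel_eq_atMost, subst vimage_algebra_sigma) auto
    also have "{(\<lambda>x. x) -` A \<inter> {0..} | A. A \<in> range atMost} = ?G" by auto
    also have "sets (sigma {0::real..} ?G) = sigma_sets {0..} ?G" by (rule sets_measure_of) auto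
    finally show ?thesis .
  qed
  show ?thesis
  proof (rule measure_eqI_generator_eq[where E = ?G and \<Omega> = "{0..}"])
    show "Int_stable ?G"
    proof (rule Int_stableI)
      fix X Y assume "X \<in> ?G" "Y \<in> ?G"
      then obtain a b where "X = {..a} \<inter> {0..}" "Y = {..b} \<inter> {0..}" by auto
      then have "X \<inter> Y = (\<lambda>x. x) -` {..min a b} \<inter> {0..}" by auto
      then show "X \<inter> Y \<in> ?G" by blast
    qed
    show "emeasure \<mu> X = emeasure \<mu>' X" if "X \<in> ?G" for X
    proof -
      from that obtain a where X: "X = {..a} \<inter> {0..}" by auto
      show ?thesis
      proof (cases "0 \<le> a")
        case True
        then have "X = {0..a}" using X by auto
        then show ?thesis using eq True by simp
      next
        case False
        then have "X = {}" using X by auto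
        then show ?thesis by simp
      qed
    qed
    show "sets \<mu> = sigma_sets {0..} ?G" "sets \<mu>' = sigma_sets {0..} ?G" using G sets by auto
    show "range (\<lambda>i::nat. {..real i} \<inter> {0..}) \<subseteq> ?G" by auto
    show "(\<Union>i::nat. {..real i} \<inter> {0..}) = {0..}" using real_arch_simple by auto
    show "emeasure \<mu> ({..real i} \<inter> {0..}) \<noteq> \<infinity>" for i
    proof -
      have "emeasure \<mu> ({..real i} \<inter> {0..}) \<le> emeasure \<mu> {0..}"
        by (rule emeasure_mono) (auto simp: sets sets_restrict_space_iff)
      then show ?thesis using fin by (auto simp: top_unique)
    qed
  qed auto
qed

text \<open>Tailored to the renewal property, which prescribes probabilities only for sojourns in
  \<open>{0..t}\<close>. One coordinate is frozen at a time, so that a measure on the half-line is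
  compared first, then a measure on marks, then the given measures.\<close>

lemma marked_measure_eqI:
  assumes fin: "emeasure \<mu> (space \<mu>) \<noteq> \<infinity>"
    and sets: "sets \<mu> = sets (A \<Otimes>\<^sub>M (B \<Otimes>\<^sub>M half_line))" "sets \<mu>' = sets (A \<Otimes>\<^sub>M (B \<Otimes>\<^sub>M half_line))"
    and eq: "\<And>a b t. a \<in> sets A \<Longrightarrow> b \<in> sets B \<Longrightarrow> 0 \<le> t \<Longrightarrow>
      emeasure \<mu> (a \<times> (b \<times> {0..t})) = emeasure \<mu>' (a \<times> (b \<times> {0..t}))"
  shows "\<mu> = \<mu>'"
proof (rule pair_measure_eqI_rectangles[OF fin sets])
  fix a D assume a: "a \<in> sets A" and D: "D \<in> sets (B \<Otimes>\<^sub>M half_line)"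
  let ?Z = "B \<Otimes>\<^sub>M half_line"
  have space_half: "space half_line = {0..}" by (simp add: space_restrict_space)
  have sp: "space \<mu> = space A \<times> (space B \<times> {0..})" "space \<mu>' = space A \<times> (space B \<times> {0..})"
    using sets_eq_imp_space_eq[OF sets(1)] sets_eq_imp_space_eq[OF sets(2)]
    by (simp_all add: space_pair_measure space_half)
  have fin': "emeasure \<mu> X \<noteq> \<infinity>" for X
    using emeasure_space[of \<mu> X] fin by (auto simp: top_unique)
  \<comment> \<open>The measure \<open>X \<mapsto> m (a \<times> X)\<close>, realised as the image
    of a restriction of \<open>m\<close>; \<open>\<tau>\<close> below freezes the second coordinate
    in the same way.\<close>
  define \<kappa> where "\<kappa> m = distr (density m (indicator (a \<times> space ?Z))) ?Z snd"
    for m :: "('a \<times> 'b \<times> real) measure"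
  have \<kappa>: "emeasure (\<kappa> m) X = emeasure m (a \<times> X)"
    if m: "sets m = sets (A \<Otimes>\<^sub>M ?Z)" and X: "X \<in> sets ?Z" for m X
  proof -
    have "emeasure (\<kappa> m) X = emeasure m ((a \<times> space ?Z) \<inter> (snd -` X \<inter> space m))"
      unfolding \<kappa>_def using a X m
      by (intro emeasure_distr_density_indicator) (auto simp: measurable_cong_sets[OF m refl])
    also have "(a \<times> space ?Z) \<inter> (snd -` X \<inter> space m) = a \<times> X"
      using sets.sets_into_space[OF a] sets.sets_into_space[OF X] sets_eq_imp_space_eq[OF m]
      by (auto simp: space_pair_measure)
    finally show ?thesis .
  qed
  have "\<kappa> \<mu> = \<kappa> \<mu>'"
  proof (rule pair_measure_eqI_rectangles)
    show "emeasure (\<kappa> \<mu>) (space (\<kappa> \<mu>)) \<noteq> \<infinity>"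
      using \<kappa>[OF sets(1) sets.top] fin' by (simp add: \<kappa>_def)
    show "sets (\<kappa> \<mu>) = sets ?Z" "sets (\<kappa> \<mu>') = sets ?Z" by (simp_all add: \<kappa>_def)
    fix b T assume b: "b \<in> sets B" and T: "T \<in> sets half_line"
    define \<tau> where "\<tau> m = distr (density m (indicator (a \<times> (b \<times> {0..})))) half_line (\<lambda>w. snd (snd w))"
      for m :: "('a \<times> 'b \<times> real) measure"
    have half: "{0..} \<in> sets half_line" using sets.top[of half_line] by (simp add: space_half)
    have \<tau>: "emeasure (\<tau> m) X = emeasure m (a \<times> (b \<times> X))"
      if m: "sets m = sets (A \<Otimes>\<^sub>M ?Z)" and X: "X \<in> sets half_line" for m X
    proof -
      have "emeasure (\<tau> m) X = emeasure m ((a \<times> (b \<times> {0..})) \<inter> ((\<lambda>w. snd (snd w)) -` X \<inter> space m))"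
        unfolding \<tau>_def using a b X m half
        by (intro emeasure_distr_density_indicator) (auto simp: measurable_cong_sets[OF m refl])
      also have "(a \<times> (b \<times> {0..})) \<inter> ((\<lambda>w. snd (snd w)) -` X \<inter> space m) = a \<times> (b \<times> X)"
        using sets.sets_into_space[OF a] sets.sets_into_space[OF b] sets.sets_into_space[OF X]
          sets_eq_imp_space_eq[OF m]
        by (auto simp: space_pair_measure space_half)
      finally show ?thesis .
    qed
    have "\<tau> \<mu> = \<tau> \<mu>'"
    proof (rule half_line_measure_eqI)
      show "emeasure (\<tau> \<mu>) {0..} \<noteq> \<infinity>" using \<tau>[OF sets(1) half] fin' by simp
      show "sets (\<tau> \<mu>) = sets half_line" "sets (\<tau> \<mu>') = sets half_line" by (simp_all add: \<tau>_def)
      show "emeasure (\<tau> \<mu>) {0..t} = emeasure (\<tau> \<mu>') {0..t}" if "0 \<le> t" for t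
      proof -
        have "{0..t} \<in> sets half_line" by (simp add: sets_restrict_space_iff)
        then show ?thesis using \<tau> sets eq[OF a b that] by simp
      qed
    qed
    moreover have "b \<times> T \<in> sets ?Z" using b T by simp
    ultimately show "emeasure (\<kappa> \<mu>) (b \<times> T) = emeasure (\<kappa> \<mu>') (b \<times> T)"
      using \<kappa>[OF sets(1)] \<kappa>[OF sets(2)] \<tau>[OF sets(1) T] \<tau>[OF sets(2) T] by simp
  qed
  then show "emeasure \<mu> (a \<times> D) = emeasure \<mu>' (a \<times> D)"
    using \<kappa>[OF sets(1) D] \<kappa>[OF sets(2) D] by simp
qed

subsection \<open>Histories\<close>

text \<open>Marks carry sojourn times while histories carry jump times; hence the addition here and
  the difference in \<open>transition\<close>.\<close>

definition append_mark :: "nat \<Rightarrow> 'e history \<Rightarrow> 'e \<times> real \<Rightarrow> 'e history" where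
  "append_mark n h z = ((fst h)(Suc n := fst z), (snd h)(Suc n := snd h n + snd z))"

definition transition :: "nat \<Rightarrow> 'e history \<Rightarrow> 'e \<times> real" where
  "transition i h = (fst h (Suc i), snd h (Suc i) - snd h i)"

lemma history_Suc:
  "history J S (Suc n) \<omega> = append_mark n (history J S n \<omega>) (J (Suc n) \<omega>, S (Suc n) \<omega> - S n \<omega>)"
  by (auto simp: history_def append_mark_def restrict_def fun_eq_iff le_Suc_eq)

lemma transition_append_mark:
  "transition n (append_mark n h z) = z"
  "i < n \<Longrightarrow> transition i (append_mark n h z) = transition i h"
  by (simp_all add: transition_def append_mark_def)

lemma fst_append_mark: "i \<le> n \<Longrightarrow> fst (append_mark n h z) i = fst h i"
  by (simp add: append_mark_def)

context semi_markov_model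
begin

lemma history_space_state: "h \<in> space (history_space E n) \<Longrightarrow> i \<le> n \<Longrightarrow> fst h i \<in> space E"
  by (auto simp: history_space_def space_restrict_space space_pair_measure space_PiM dest: PiE_mem)

lemma history_space_mono: "h \<in> space (history_space E n) \<Longrightarrow> i < n \<Longrightarrow> snd h i \<le> snd h (Suc i)"
  by (auto simp: history_space_def space_restrict_space)

lemma measurable_history_state:
  "i \<le> n \<Longrightarrow> (\<lambda>h. fst h i) \<in> measurable (history_space E n) E"
  unfolding history_space_def by (rule measurable_restrict_space1) measurable

lemma measurable_history_time:
  assumes "i \<le> n"
  shows "(\<lambda>h. snd h i) \<in> measurable (history_space E n) half_line"
  unfolding history_space_def by (rule measurable_restrict_space1)
    (use assms in \<open>auto intro!: measurable_compose[OF measurable_snd measurable_component_singleton]\<close>)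

lemma borel_measurable_history_time:
  assumes "i \<le> n"
  shows "(\<lambda>h. snd h i) \<in> borel_measurable (history_space E n)"
  using measurable_history_time[OF assms] by (simp add: measurable_restrict_space2_iff)

lemma measurable_transition:
  assumes "i < n"
  shows "transition i \<in> measurable (history_space E n) mark_space"
proof -
  have "(\<lambda>h. snd h (Suc i) - snd h i) \<in> measurable (history_space E n) half_line"
  proof (rule measurable_restrict_space2)
    show "(\<lambda>h. snd h (Suc i) - snd h i) \<in> space (history_space E n) \<rightarrow> {0..}"
      using assms by (simp add: history_space_mono)
    show "(\<lambda>h. snd h (Suc i) - snd h i) \<in> borel_measurable (history_space E n)"
      using assms by (intro borel_measurable_diff borel_measurable_history_time) auto
  qed
  then show ?thesis
    unfolding transition_def[abs_def] using measurable_history_state[of "Suc i" n] assms by simp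
qed

lemma measurable_history_spaceI:
  assumes "f \<in> measurable N (Pi\<^sub>M {..n} (\<lambda>_. E))" "g \<in> measurable N (Pi\<^sub>M {..n} (\<lambda>_. half_line))"
    and "\<And>w i. w \<in> space N \<Longrightarrow> i < n \<Longrightarrow> g w i \<le> g w (Suc i)"
  shows "(\<lambda>w. (f w, g w)) \<in> measurable N (history_space E n)"
  unfolding history_space_def using assms by (intro measurable_restrict_space2) auto

lemma measurable_half_line_add:
  assumes "f \<in> measurable N half_line" "g \<in> measurable N half_line"
  shows "(\<lambda>w. f w + g w) \<in> measurable N half_line"
  using assms by (auto simp: measurable_restrict_space2_iff Pi_iff)

lemma measurable_append_mark:
  "(\<lambda>(h, z). append_mark n h z) \<in> measurable (history_space E n \<Otimes>\<^sub>M mark_space) (history_space E (Suc n))"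
  unfolding append_mark_def split_beta
proof (rule measurable_history_spaceI)
  let ?N = "history_space E n \<Otimes>\<^sub>M mark_space"
  have h: "fst \<in> measurable ?N (history_space E n)" by simp
  have "fst \<in> measurable (history_space E n) (Pi\<^sub>M {..n} (\<lambda>_. E))"
    "snd \<in> measurable (history_space E n) (Pi\<^sub>M {..n} (\<lambda>_. half_line))"
    unfolding history_space_def by (auto intro: measurable_restrict_space1)
  note fs = measurable_compose[OF h this(1)] measurable_compose[OF h this(2)]
  show "(\<lambda>x. (fst (fst x))(Suc n := fst (snd x))) \<in> measurable ?N (Pi\<^sub>M {..Suc n} (\<lambda>_. E))"
    by (rule measurable_fun_upd[where J = "{..n}"]) (use fs in auto)
  show "(\<lambda>x. (snd (fst x))(Suc n := snd (fst x) n + snd (snd x))) \<in> measurable ?N (Pi\<^sub>M {..Suc n} (\<lambda>_. half_line))"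
    by (rule measurable_fun_upd[where J = "{..n}"])
      (use fs measurable_compose[OF h measurable_history_time[of n n]] in \<open>auto intro!: measurable_half_line_add\<close>)
  show "((snd (fst w))(Suc n := snd (fst w) n + snd (snd w))) i
     \<le> ((snd (fst w))(Suc n := snd (fst w) n + snd (snd w))) (Suc i)" if "w \<in> space ?N" "i < Suc n" for w i
    using that history_space_mono[of "fst w" n i]
    by (auto simp: space_pair_measure space_restrict_space less_Suc_eq)
qed

section \<open>The observed process and its one-step conditional law\<close>

lemma process:
  assumes "q \<in> space \<QQ>"
  shows "prob_space (Pr q)" "J n \<in> measurable (Pr q) E" "S n \<in> borel_measurable (Pr q)"
    "\<omega> \<in> space (Pr q) \<Longrightarrow> 0 \<le> S 0 \<omega>" "\<omega> \<in> space (Pr q) \<Longrightarrow> S n \<omega> \<le> S (Suc n) \<omega>"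
  using renewal[OF assms] by (auto simp: markov_renewal_process_def)

lemma S_nonneg: "q \<in> space \<QQ> \<Longrightarrow> \<omega> \<in> space (Pr q) \<Longrightarrow> 0 \<le> S n \<omega>"
  by (induction n) (auto intro: process order_trans)

lemma measurable_S: "q \<in> space \<QQ> \<Longrightarrow> S n \<in> measurable (Pr q) half_line"
  by (rule measurable_restrict_space2) (auto simp: process S_nonneg)

lemma measurable_history:
  assumes "q \<in> space \<QQ>"
  shows "history J S n \<in> measurable (Pr q) (history_space E n)"
  unfolding history_def[abs_def] using assms
  by (intro measurable_history_spaceI measurable_restrict measurable_S process) (auto simp: process)

abbreviation mark :: "nat \<Rightarrow> 'w \<Rightarrow> 'e \<times> real" where
  "mark n \<omega> \<equiv> (J (Suc n) \<omega>, S (Suc n) \<omega> - S n \<omega>)"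

lemma measurable_mark:
  assumes "q \<in> space \<QQ>"
  shows "mark n \<in> measurable (Pr q) mark_space"
proof -
  have "(\<lambda>\<omega>. S (Suc n) \<omega> - S n \<omega>) \<in> measurable (Pr q) half_line"
    using assms by (intro measurable_restrict_space2 borel_measurable_diff process) (auto simp: process)
  then show ?thesis using process(2)[OF assms, of "Suc n"] by simp
qed

lemma prob_space_history_law:
  "q \<in> space \<QQ> \<Longrightarrow> prob_space (history_law E (Pr q) J S n)"
  unfolding history_law_def by (rule prob_space.prob_space_distr[OF process(1) measurable_history])

lemma sets_history_law: "sets (history_law E M J S n) = sets (history_space E n)"
  by (simp add: history_law_def)

lemma measurable_history_law [simp]:
  "measurable (history_law E M J S n) N = measurable (history_space E n) N"
  by (rule measurable_cong_sets) (simp_all add: sets_history_law)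

lemma sets_history_law_pair_nu:
  "sets (history_law E M J S n \<Otimes>\<^sub>M \<nu>) = sets (history_space E n \<Otimes>\<^sub>M mark_space)"
  by (rule sets_pair_measure_cong[OF sets_history_law sets_nu])

lemma measurable_history_law_pair [simp]:
  "measurable (history_law E M J S n \<Otimes>\<^sub>M mark_space) N = measurable (history_space E n \<Otimes>\<^sub>M mark_space) N"
  by (rule measurable_cong_sets[OF sets_pair_measure_cong[OF sets_history_law refl] refl])

text \<open>The almost sure identity for the conditional expectation is integrated over an event of
  the past. Afterwards the dynamics is used only in this form, free of conditional
  expectations.\<close>

lemma emeasure_renewal:
  assumes q: "q \<in> space \<QQ>" and C: "C \<in> sets (history_space E n)" and B: "B \<in> sets E" and t: "0 \<le> t"
  shows "emeasure (Pr q) {\<omega> \<in> space (Pr q). history J S n \<omega> \<in> C \<and> mark n \<omega> \<in> B \<times> {0..t}}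
    = (\<integral>\<^sup>+\<omega>. indicator C (history J S n \<omega>) * emeasure (semi_markov_kernel \<nu> q (J n \<omega>)) (B \<times> {0..t}) \<partial>Pr q)"
proof -
  interpret p: prob_space "Pr q" by (rule process[OF q])
  let ?F = "vimage_algebra (space (Pr q)) (history J S n) (history_space E n)"
  let ?A = "{\<omega>\<in>space (Pr q). J (Suc n) \<omega> \<in> B \<and> S (Suc n) \<omega> - S n \<omega> \<le> t}"
  let ?D = "history J S n -` C \<inter> space (Pr q)"
  let ?k = "\<lambda>\<omega>. measure (semi_markov_kernel \<nu> q (J n \<omega>)) (B \<times> {0..t})"
  note H = measurable_history[OF q, of n]
  have sub: "subalgebra (Pr q) ?F"
    unfolding subalgebra_def
    using sets_vimage_algebra2[of "history J S n" "space (Pr q)" "history_space E n"]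
      measurable_space[OF H] measurable_sets[OF H] by auto
  interpret f: finite_measure_subalgebra "Pr q" ?F by unfold_locales (rule sub)
  have [measurable]: "J (Suc n) \<in> measurable (Pr q) E" "S (Suc n) \<in> borel_measurable (Pr q)"
    "S n \<in> borel_measurable (Pr q)" "B \<in> sets E" using process[OF q] B by auto
  have A: "?A \<in> sets (Pr q)" by measurable
  have D: "?D \<in> sets ?F" by (rule in_vimage_algebra[OF C])
  then have D': "?D \<in> sets (Pr q)" using sub by (auto simp: subalgebra_def)
  have BT: "B \<times> {0..t} \<in> sets mark_space" using B t by (intro pair_measureI) (auto simp: sets_restrict_space_iff)
  have kE: "(\<lambda>x. measure (semi_markov_kernel \<nu> q x) (B \<times> {0..t})) \<in> borel_measurable E"
    using measurable_compose[OF measurable_semi_markov_kernel[OF q] measurable_emeasure_subprob_algebra[OF BT]]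
    unfolding measure_def by measurable
  have k[measurable]: "?k \<in> borel_measurable (Pr q)"
    using measurable_compose[OF process(2)[OF q] kE] .
  have k_eq: "emeasure (semi_markov_kernel \<nu> q (J n \<omega>)) (B \<times> {0..t}) = ennreal (?k \<omega>)"
    if "\<omega> \<in> space (Pr q)" for \<omega>
    using prob_space_semi_markov_kernel[OF q measurable_space[OF process(2)[OF q, of n] that]]
    by (simp add: finite_measure.emeasure_eq_measure prob_space.finite_measure)
  have k1: "?k \<omega> \<le> 1" if "\<omega> \<in> space (Pr q)" for \<omega>
    by (rule prob_space.prob_le_1[OF prob_space_semi_markov_kernel[OF q measurable_space[OF process(2)[OF q] that]]])
  have AE: "AE \<omega> in Pr q. real_cond_exp (Pr q) ?F (indicator ?A) \<omega> = ?k \<omega>"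
    using renewal[OF q] B t unfolding markov_renewal_process_def by blast
  have "measure (Pr q) (?D \<inter> ?A) = (\<integral>\<omega>. indicator ?D \<omega> * indicator ?A \<omega> \<partial>Pr q)"
    using A D' by (simp add: indicator_inter_arith[symmetric] sets.Int)
  also have "\<dots> = (\<integral>\<omega>. indicator ?D \<omega> * real_cond_exp (Pr q) ?F (indicator ?A) \<omega> \<partial>Pr q)"
    using A D D' by (intro f.real_cond_exp_intg(2)[symmetric])
      (auto simp: indicator_inter_arith[symmetric] p.emeasure_eq_measure)
  also have "\<dots> = (\<integral>\<omega>. indicator ?D \<omega> * ?k \<omega> \<partial>Pr q)"
    using AE D' by (intro integral_cong_AE) (auto intro: borel_measurable_indicator)
  finally have eq: "measure (Pr q) (?D \<inter> ?A) = (\<integral>\<omega>. indicator ?D \<omega> * ?k \<omega> \<partial>Pr q)" .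
  \<comment> \<open>Jump times are nondecreasing on the whole sample space, so the lower endpoint of
    \<open>{0..t}\<close> imposes nothing.\<close>
  have "{\<omega> \<in> space (Pr q). history J S n \<omega> \<in> C \<and> mark n \<omega> \<in> B \<times> {0..t}} = ?D \<inter> ?A"
    using process(5)[OF q] by auto
  then have "emeasure (Pr q) {\<omega> \<in> space (Pr q). history J S n \<omega> \<in> C \<and> mark n \<omega> \<in> B \<times> {0..t}}
      = ennreal (\<integral>\<omega>. indicator ?D \<omega> * ?k \<omega> \<partial>Pr q)"
    using eq by (simp add: p.emeasure_eq_measure)
  also have "\<dots> = (\<integral>\<^sup>+\<omega>. ennreal (indicator ?D \<omega> * ?k \<omega>) \<partial>Pr q)"
  proof (rule nn_integral_eq_integral[symmetric])
    show "integrable (Pr q) (\<lambda>\<omega>. indicator ?D \<omega> * ?k \<omega>)"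
    proof (rule p.integrable_const_bound[where B = 1])
      show "AE \<omega> in Pr q. norm (indicator ?D \<omega> * ?k \<omega>) \<le> 1" using k1 by (auto simp: indicator_def)
    qed (use D' in measurable)
  qed (auto simp: indicator_def)
  also have "\<dots> = (\<integral>\<^sup>+\<omega>. indicator C (history J S n \<omega>) * emeasure (semi_markov_kernel \<nu> q (J n \<omega>)) (B \<times> {0..t}) \<partial>Pr q)"
    by (intro nn_integral_cong) (auto simp: k_eq indicator_def)
  finally show ?thesis .
qed

definition joint_law :: "'e kernel_density \<Rightarrow> nat \<Rightarrow> ('e history \<times> 'e \<times> real) measure" where
  "joint_law q n = distr (Pr q) (history_space E n \<Otimes>\<^sub>M mark_space) (\<lambda>\<omega>. (history J S n \<omega>, mark n \<omega>))"

lemma measurable_history_mark: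
  "q \<in> space \<QQ> \<Longrightarrow> (\<lambda>\<omega>. (history J S n \<omega>, mark n \<omega>)) \<in> measurable (Pr q) (history_space E n \<Otimes>\<^sub>M mark_space)"
  by (rule measurable_Pair[OF measurable_history measurable_mark])

lemma measurable_density_history:
  assumes q: "q \<in> space \<QQ>"
  shows "(\<lambda>(h, z). ennreal (q (fst h n) z)) \<in> borel_measurable (history_space E n \<Otimes>\<^sub>M mark_space)"
  unfolding split_beta
  using measurable_density[OF q measurable_compose[OF measurable_fst measurable_history_state[of n n]] measurable_snd]
  by simp

text \<open>On boxes \<open>C \<times> (B \<times> {0..t})\<close> this is
  \<open>emeasure_renewal\<close> after Fubini, and such boxes determine the finite joint
  law.\<close>

lemma joint_law_eq_density:
  assumes q: "q \<in> space \<QQ>"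
  shows "joint_law q n
    = density (history_law E (Pr q) J S n \<Otimes>\<^sub>M \<nu>) (\<lambda>(h, z). ennreal (q (fst h n) z))"
    (is "_ = ?R")
proof (rule marked_measure_eqI[where A = "history_space E n" and B = E])
  let ?L = "history_law E (Pr q) J S n"
  note hm = measurable_history_mark[OF q, of n]
  show "emeasure (joint_law q n) (space (joint_law q n)) \<noteq> \<infinity>"
    using prob_space.emeasure_space_1[OF prob_space.prob_space_distr[OF process(1)[OF q] hm]]
    by (simp add: joint_law_def)
  show s: "sets (joint_law q n) = sets (history_space E n \<Otimes>\<^sub>M mark_space)" by (simp add: joint_law_def)
  show "sets ?R = sets (history_space E n \<Otimes>\<^sub>M mark_space)"
    by (simp add: sets_history_law_pair_nu)
  fix C B t assume C: "C \<in> sets (history_space E n)" and B: "B \<in> sets E" and t: "0 \<le> (t::real)"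
  interpret nu: sigma_finite_measure \<nu> by (rule sigma_finite_nu)
  have BT: "B \<times> {0..t} \<in> sets mark_space" using B t by (intro pair_measureI) (auto simp: sets_restrict_space_iff)
  have CBT: "C \<times> (B \<times> {0..t}) \<in> sets (history_space E n \<Otimes>\<^sub>M mark_space)" using C BT by simp
  have "emeasure ?R (C \<times> (B \<times> {0..t}))
      = (\<integral>\<^sup>+w. (case w of (h, z) \<Rightarrow> ennreal (q (fst h n) z)) * indicator (C \<times> (B \<times> {0..t})) w \<partial>(?L \<Otimes>\<^sub>M \<nu>))"
    using measurable_density_history[OF q, of n] CBT
    by (intro emeasure_density) (simp_all add: sets_history_law_pair_nu)
  also have "\<dots> = (\<integral>\<^sup>+h. \<integral>\<^sup>+z. ennreal (q (fst h n) z) * indicator (C \<times> (B \<times> {0..t})) (h, z) \<partial>\<nu> \<partial>?L)"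
    using measurable_density_history[OF q, of n] CBT
    by (subst nu.nn_integral_fst[symmetric]) (simp_all add: split_beta sets_history_law_pair_nu)
  also have "\<dots> = (\<integral>\<^sup>+h. indicator C h * emeasure (semi_markov_kernel \<nu> q (fst h n)) (B \<times> {0..t}) \<partial>?L)"
  proof (rule nn_integral_cong)
    fix h assume "h \<in> space ?L"
    then have "fst h n \<in> space E" by (simp add: history_law_def history_space_state)
    then have "emeasure (semi_markov_kernel \<nu> q (fst h n)) (B \<times> {0..t})
        = (\<integral>\<^sup>+z. ennreal (q (fst h n) z) * indicator (B \<times> {0..t}) z \<partial>\<nu>)"
      by (rule emeasure_semi_markov_kernel[OF q _ BT])
    moreover have "(\<integral>\<^sup>+z. ennreal (q (fst h n) z) * indicator (C \<times> (B \<times> {0..t})) (h, z) \<partial>\<nu>)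
       = indicator C h * (\<integral>\<^sup>+z. ennreal (q (fst h n) z) * indicator (B \<times> {0..t}) z \<partial>\<nu>)"
      by (cases "h \<in> C") (auto intro!: nn_integral_cong simp: indicator_def)
    ultimately show "(\<integral>\<^sup>+z. ennreal (q (fst h n) z) * indicator (C \<times> (B \<times> {0..t})) (h, z) \<partial>\<nu>)
       = indicator C h * emeasure (semi_markov_kernel \<nu> q (fst h n)) (B \<times> {0..t})" by simp
  qed
  also have "\<dots> = (\<integral>\<^sup>+\<omega>. indicator C (history J S n \<omega>) * emeasure (semi_markov_kernel \<nu> q (J n \<omega>)) (B \<times> {0..t}) \<partial>Pr q)"
  proof -
    have "(\<lambda>h. emeasure (semi_markov_kernel \<nu> q (fst h n)) (B \<times> {0..t})) \<in> borel_measurable (history_space E n)"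
      using measurable_compose[OF measurable_history_state[of n n]
          measurable_compose[OF measurable_semi_markov_kernel[OF q] measurable_emeasure_subprob_algebra[OF BT]]]
      by simp
    then have "(\<lambda>h. indicator C h * emeasure (semi_markov_kernel \<nu> q (fst h n)) (B \<times> {0..t})) \<in> borel_measurable (history_space E n)"
      using C by measurable
    then show ?thesis
      unfolding history_law_def by (subst nn_integral_distr[OF measurable_history[OF q]]) (auto simp: history_def)
  qed
  also have "\<dots> = emeasure (Pr q) {\<omega> \<in> space (Pr q). history J S n \<omega> \<in> C \<and> mark n \<omega> \<in> B \<times> {0..t}}"
    by (rule emeasure_renewal[OF q C B t, symmetric])
  also have "\<dots> = emeasure (joint_law q n) (C \<times> (B \<times> {0..t}))"
    unfolding joint_law_def using CBT
    by (subst emeasure_distr[OF hm]) (auto intro!: arg_cong[where f = "emeasure (Pr q)"])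
  finally show "emeasure (joint_law q n) (C \<times> (B \<times> {0..t})) = emeasure ?R (C \<times> (B \<times> {0..t}))" by simp
qed

text \<open>The one-step Markov property for arbitrary nonnegative integrands. Both the density of
  the history law and the expectations of the scores are computed by peeling off the last transition
  with it.\<close>

lemma nn_integral_history_mark:
  assumes q: "q \<in> space \<QQ>" and f: "f \<in> borel_measurable (history_space E n \<Otimes>\<^sub>M mark_space)"
  shows "(\<integral>\<^sup>+\<omega>. f (history J S n \<omega>, mark n \<omega>) \<partial>Pr q)
    = (\<integral>\<^sup>+\<omega>. (\<integral>\<^sup>+z. ennreal (q (J n \<omega>) z) * f (history J S n \<omega>, z) \<partial>\<nu>) \<partial>Pr q)"
proof -
  interpret nu: sigma_finite_measure \<nu> by (rule sigma_finite_nu)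
  let ?L = "history_law E (Pr q) J S n"
  have m: "(\<lambda>(h, z). ennreal (q (fst h n) z) * f (h, z)) \<in> borel_measurable (history_space E n \<Otimes>\<^sub>M mark_space)"
    using measurable_density_history[OF q, of n] f by (simp add: split_beta)
  have "(\<integral>\<^sup>+\<omega>. f (history J S n \<omega>, mark n \<omega>) \<partial>Pr q) = (\<integral>\<^sup>+w. f w \<partial>joint_law q n)"
    unfolding joint_law_def using f by (subst nn_integral_distr[OF measurable_history_mark[OF q]]) auto
  also have "\<dots> = (\<integral>\<^sup>+w. (case w of (h, z) \<Rightarrow> ennreal (q (fst h n) z)) * f w \<partial>(?L \<Otimes>\<^sub>M \<nu>))"
    unfolding joint_law_eq_density[OF q] using measurable_density_history[OF q, of n] f
    by (intro nn_integral_density) simp_all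
  also have "\<dots> = (\<integral>\<^sup>+h. \<integral>\<^sup>+z. ennreal (q (fst h n) z) * f (h, z) \<partial>\<nu> \<partial>?L)"
    using m[unfolded split_beta, simplified] by (subst nu.nn_integral_fst[symmetric]) (simp_all add: split_beta)
  also have "\<dots> = (\<integral>\<^sup>+\<omega>. (\<integral>\<^sup>+z. ennreal (q (J n \<omega>) z) * f (history J S n \<omega>, z) \<partial>\<nu>) \<partial>Pr q)"
    unfolding history_law_def using borel_measurable_nn_integral_nu[OF m]
    by (subst nn_integral_distr[OF measurable_history[OF q]]) (auto simp: history_def)
  finally show ?thesis .
qed

end

subsection \<open>The likelihood as a density\<close>

definition initial_history :: "'e \<times> real \<Rightarrow> 'e history" where
  "initial_history z = ((\<lambda>i\<in>{..0}. fst z), (\<lambda>i\<in>{..0}. snd z))"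

text \<open>The image of the (n+1)-fold product of \<open>\<nu>\<close> under accumulation of
  sojourns into jump times: one measure dominating the history laws of all parameters
  simultaneously.\<close>

primrec history_reference ::
    "'e measure \<Rightarrow> ('e \<times> real) measure \<Rightarrow> nat \<Rightarrow> 'e history measure" where
  "history_reference E \<nu> 0 = distr \<nu> (history_space E 0) initial_history"
| "history_reference E \<nu> (Suc n) =
     distr (history_reference E \<nu> n \<Otimes>\<^sub>M \<nu>) (history_space E (Suc n)) (\<lambda>(h, z). append_mark n h z)"

lemma likelihood_eq:
  "likelihood \<rho> n q h = initial_density \<rho> q (fst h 0, snd h 0) *
     (\<Prod>i<n. ennreal (q (fst h i) (transition i h)))"
proof -
  have "(\<Prod>l=1..n. ennreal (q (fst h (l - 1)) (fst h l, snd h l - snd h (l - 1))))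
      = (\<Prod>i<n. ennreal (q (fst h i) (transition i h)))"
    by (rule prod.reindex_bij_witness[of _ Suc "\<lambda>l. l - 1"]) (auto simp: transition_def)
  then show ?thesis by (simp add: likelihood_def split_beta)
qed

lemma likelihood_append_mark:
  "likelihood \<rho> (Suc n) q (append_mark n h z) = likelihood \<rho> n q h * ennreal (q (fst h n) z)"
proof -
  have "(\<Prod>i<n. ennreal (q (fst (append_mark n h z) i) (transition i (append_mark n h z))))
     = (\<Prod>i<n. ennreal (q (fst h i) (transition i h)))"
    by (intro prod.cong) (simp_all add: fst_append_mark transition_append_mark)
  then show ?thesis
    by (simp add: likelihood_eq fst_append_mark transition_append_mark mult.assoc)
       (simp add: append_mark_def)
qed

context semi_markov_model
begin

lemma measurable_likelihood_param:
  assumes a: "a \<in> measurable N \<QQ>" and b: "b \<in> measurable N (history_space E n)"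
  shows "(\<lambda>w. likelihood \<rho> n (a w) (b w)) \<in> borel_measurable N"
proof -
  have "(\<lambda>w. (fst (b w) 0, snd (b w) 0)) \<in> measurable N mark_space"
    using measurable_compose[OF b measurable_history_state[of 0 n]]
      measurable_compose[OF b measurable_history_time[of 0 n]] by simp
  then have [measurable]: "(\<lambda>w. initial_density \<rho> (a w) (fst (b w) 0, snd (b w) 0)) \<in> borel_measurable N"
    by (rule measurable_initial_density[OF a])
  have [measurable]: "(\<lambda>w. a w (fst (b w) i) (transition i (b w))) \<in> borel_measurable N" if "i < n" for i
    using that measurable_compose[OF b measurable_history_state[of i n]]
      measurable_compose[OF b measurable_transition[of i n]]
    by (intro measurable_parameter_density[OF a]) auto
  show ?thesis unfolding likelihood_eq by (intro borel_measurable_times_ennreal borel_measurable_prod_ennreal) auto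
qed

lemma measurable_likelihood:
  "q \<in> space \<QQ> \<Longrightarrow> likelihood \<rho> n q \<in> borel_measurable (history_space E n)"
  using measurable_likelihood_param[of "\<lambda>_. q" "history_space E n" "\<lambda>h. h" n] by simp

lemma sets_history_reference: "sets (history_reference E \<nu> n) = sets (history_space E n)"
  by (cases n) simp_all

lemma measurable_history_reference [simp]:
  "measurable (history_reference E \<nu> n) N = measurable (history_space E n) N"
  by (rule measurable_cong_sets) (simp_all add: sets_history_reference)

lemma measurable_history_reference_pair [simp]:
  "measurable (history_reference E \<nu> n \<Otimes>\<^sub>M mark_space) N = measurable (history_space E n \<Otimes>\<^sub>M mark_space) N"
  by (rule measurable_cong_sets[OF sets_pair_measure_cong[OF sets_history_reference refl] refl])

lemma measurable_initial_history: "initial_history \<in> measurable mark_space (history_space E 0)"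
  unfolding initial_history_def[abs_def]
  by (intro measurable_history_spaceI measurable_restrict) auto

text \<open>By induction on the length: a new mark multiplies the likelihood by the kernel density
  at the last state, which is precisely the conditional density of that mark given the past.\<close>

lemma history_law_eq_density:
  assumes q: "q \<in> space \<QQ>"
  shows "history_law E (Pr q) J S n = density (history_reference E \<nu> n) (likelihood \<rho> n q)"
proof (induction n)
  case 0
  have JS: "(\<lambda>\<omega>. (J 0 \<omega>, S 0 \<omega>)) \<in> measurable (Pr q) mark_space"
    using process(2)[OF q, of 0] measurable_S[OF q, of 0] by simp
  have "history_law E (Pr q) J S 0
      = distr (distr (Pr q) mark_space (\<lambda>\<omega>. (J 0 \<omega>, S 0 \<omega>))) (history_space E 0) initial_history"
    unfolding history_law_def distr_distr[OF measurable_initial_history JS]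
    by (rule distr_cong) (auto simp: history_def initial_history_def)
  also have "\<dots> = distr (density \<nu> (initial_density \<rho> q)) (history_space E 0) initial_history"
    by (simp add: initial_law[OF q] bind_rho_eq_density[OF q])
  also have "density \<nu> (initial_density \<rho> q) = density \<nu> (\<lambda>z. likelihood \<rho> 0 q (initial_history z))"
    by (simp add: likelihood_eq initial_history_def)
  also have "distr (density \<nu> (\<lambda>z. likelihood \<rho> 0 q (initial_history z))) (history_space E 0) initial_history
      = density (distr \<nu> (history_space E 0) initial_history) (likelihood \<rho> 0 q)"
    by (rule density_distr[symmetric]) (simp_all add: measurable_initial_history measurable_likelihood[OF q])
  finally show ?case by simp
next
  case (Suc n)
  interpret nu: sigma_finite_measure \<nu> by (rule sigma_finite_nu)
  let ?R = "history_reference E \<nu>" and ?a = "\<lambda>(h, z). append_mark n h z"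
  show ?case
  proof (rule measure_eqI)
    show "sets (history_law E (Pr q) J S (Suc n)) = sets (density (?R (Suc n)) (likelihood \<rho> (Suc n) q))"
      by (simp add: sets_history_law)
    fix A assume "A \<in> sets (history_law E (Pr q) J S (Suc n))"
    then have A: "A \<in> sets (history_space E (Suc n))" by (simp add: sets_history_law)
    have iA: "(\<lambda>w. indicator A (append_mark n (fst w) (snd w)) :: ennreal)
        \<in> borel_measurable (history_space E n \<Otimes>\<^sub>M mark_space)"
      using measurable_compose[OF measurable_append_mark[of n] borel_measurable_indicator[OF A]]
      by (simp add: split_beta)
    have qm: "(\<lambda>w. ennreal (q (fst (fst w) n) (snd w))) \<in> borel_measurable (history_space E n \<Otimes>\<^sub>M mark_space)"
      using measurable_density_history[OF q, of n] by (simp add: split_beta)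
    have Lm: "(\<lambda>w. likelihood \<rho> n q (fst w)) \<in> borel_measurable (history_space E n \<Otimes>\<^sub>M mark_space)"
      by (rule measurable_compose[OF measurable_fst measurable_likelihood[OF q]])
    have sec: "(\<lambda>z. ennreal (q (fst h n) z) * indicator A (append_mark n h z)) \<in> borel_measurable mark_space"
      if "h \<in> space (history_space E n)" for h
      using measurable_compose[OF measurable_Pair1'[OF that] borel_measurable_times_ennreal[OF qm iA]] by simp
    have im: "(\<lambda>h. \<integral>\<^sup>+z. ennreal (q (fst h n) z) * indicator A (append_mark n h z) \<partial>\<nu>)
        \<in> borel_measurable (history_space E n)"
      using qm iA by (intro borel_measurable_nn_integral_nu) (simp add: split_beta)
    have "emeasure (history_law E (Pr q) J S (Suc n)) A
        = (\<integral>\<^sup>+\<omega>. indicator A (history J S (Suc n) \<omega>) \<partial>Pr q)"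
      using A measurable_history[OF q, of "Suc n"]
      by (simp add: history_law_def nn_integral_indicator[symmetric] nn_integral_distr del: nn_integral_indicator)
    also have "\<dots> = (\<integral>\<^sup>+\<omega>. (\<integral>\<^sup>+z. ennreal (q (J n \<omega>) z) * indicator A (append_mark n (history J S n \<omega>) z) \<partial>\<nu>) \<partial>Pr q)"
      using nn_integral_history_mark[OF q iA] by (simp add: history_Suc)
    also have "\<dots> = (\<integral>\<^sup>+h. (\<integral>\<^sup>+z. ennreal (q (fst h n) z) * indicator A (append_mark n h z) \<partial>\<nu>)
        \<partial>history_law E (Pr q) J S n)"
      unfolding history_law_def using im
      by (subst nn_integral_distr[OF measurable_history[OF q]]) (simp_all add: history_def)
    also have "\<dots> = (\<integral>\<^sup>+h. likelihood \<rho> n q h * (\<integral>\<^sup>+z. ennreal (q (fst h n) z) * indicator A (append_mark n h z) \<partial>\<nu>)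
        \<partial>?R n)"
      unfolding Suc using im measurable_likelihood[OF q] by (intro nn_integral_density) simp_all
    also have "\<dots> = (\<integral>\<^sup>+h. \<integral>\<^sup>+z. likelihood \<rho> (Suc n) q (append_mark n h z) * indicator A (append_mark n h z) \<partial>\<nu> \<partial>?R n)"
    proof (rule nn_integral_cong)
      fix h assume "h \<in> space (?R n)"
      then have h: "h \<in> space (history_space E n)"
        using sets_eq_imp_space_eq[OF sets_history_reference] by simp
      show "likelihood \<rho> n q h * (\<integral>\<^sup>+z. ennreal (q (fst h n) z) * indicator A (append_mark n h z) \<partial>\<nu>)
        = (\<integral>\<^sup>+z. likelihood \<rho> (Suc n) q (append_mark n h z) * indicator A (append_mark n h z) \<partial>\<nu>)"
        using sec[OF h] by (simp add: likelihood_append_mark nn_integral_cmult[symmetric] mult.assoc)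
    qed
    also have "\<dots> = (\<integral>\<^sup>+w. likelihood \<rho> (Suc n) q (?a w) * indicator A (?a w) \<partial>(?R n \<Otimes>\<^sub>M \<nu>))"
      using borel_measurable_times_ennreal[OF borel_measurable_times_ennreal[OF Lm qm] iA]
      by (subst nu.nn_integral_fst[symmetric]) (simp_all add: split_beta likelihood_append_mark)
    also have "\<dots> = (\<integral>\<^sup>+h. likelihood \<rho> (Suc n) q h * indicator A h \<partial>?R (Suc n))"
      using A measurable_append_mark[of n] measurable_likelihood[OF q, of "Suc n"]
      by (simp add: nn_integral_distr)
    also have "\<dots> = emeasure (density (?R (Suc n)) (likelihood \<rho> (Suc n) q)) A"
      using A measurable_likelihood[OF q, of "Suc n"]
      by (intro emeasure_density[symmetric]) (simp_all only: measurable_history_reference sets_history_reference)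
    finally show "emeasure (history_law E (Pr q) J S (Suc n)) A
        = emeasure (density (?R (Suc n)) (likelihood \<rho> (Suc n) q)) A" .
  qed
qed

text \<open>A density is almost surely positive under the measure it defines, and finite because its
  integral is 1. This permits division by the likelihood at \<open>q0\<close>, in the posterior and
  in the log-likelihood ratio.\<close>

lemma AE_likelihood_pos_finite:
  assumes q: "q \<in> space \<QQ>"
  shows "AE h in history_law E (Pr q) J S n. 0 < likelihood \<rho> n q h \<and> likelihood \<rho> n q h < \<infinity>"
proof -
  let ?R = "history_reference E \<nu> n"
  have L: "likelihood \<rho> n q \<in> borel_measurable ?R" using measurable_likelihood[OF q] by simp
  interpret prob_space "density ?R (likelihood \<rho> n q)"
    using prob_space_history_law[OF q, of n] by (simp add: history_law_eq_density[OF q])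
  have "(\<integral>\<^sup>+h. likelihood \<rho> n q h \<partial>?R) = emeasure (density ?R (likelihood \<rho> n q)) (space ?R)"
    using L by (simp add: emeasure_density)
  then have "(\<integral>\<^sup>+h. likelihood \<rho> n q h \<partial>?R) \<noteq> \<infinity>"
    using emeasure_space_1 by simp
  from nn_integral_PInf_AE[OF L this] show ?thesis
    unfolding history_law_eq_density[OF q] AE_density[OF L] by eventually_elim (auto simp: top.not_eq_extremum)
qed

text \<open>Only an inequality, since mass of \<open>q\<close> on histories with zero likelihood at
  \<open>q0\<close> is lost. The values \<open>0 * x = 0\<close> and
  \<open>b / \<infinity> = 0\<close> make \<open>a * (b / a) \<le> b\<close> true without
  exception.\<close>

lemma likelihood_ratio_change_of_measure:
  assumes q0: "q0 \<in> space \<QQ>" and q: "q \<in> space \<QQ>" and f: "f \<in> borel_measurable (history_space E n)"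
  shows "(\<integral>\<^sup>+h. f h * (likelihood \<rho> n q h / likelihood \<rho> n q0 h) \<partial>history_law E (Pr q0) J S n)
    \<le> (\<integral>\<^sup>+h. f h \<partial>history_law E (Pr q) J S n)"
proof -
  let ?R = "history_reference E \<nu> n"
  note [measurable] = f measurable_likelihood[OF q0, of n] measurable_likelihood[OF q, of n]
  have "(\<integral>\<^sup>+h. f h * (likelihood \<rho> n q h / likelihood \<rho> n q0 h) \<partial>history_law E (Pr q0) J S n)
      = (\<integral>\<^sup>+h. likelihood \<rho> n q0 h * (f h * (likelihood \<rho> n q h / likelihood \<rho> n q0 h)) \<partial>?R)"
    unfolding history_law_eq_density[OF q0] by (intro nn_integral_density) simp_all
  also have "\<dots> \<le> (\<integral>\<^sup>+h. likelihood \<rho> n q h * f h \<partial>?R)"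
  proof (rule nn_integral_mono)
    have "a * (b / a) \<le> b" for a b :: ennreal
      by (cases "a = 0 \<or> a = \<infinity>") (auto simp: ennreal_times_divide mult.commute[of a b] mult_divide_eq_ennreal)
    then have "f h * (likelihood \<rho> n q0 h * (likelihood \<rho> n q h / likelihood \<rho> n q0 h)) \<le> f h * likelihood \<rho> n q h" for h
      by (rule mult_left_mono) simp
    then show "likelihood \<rho> n q0 h * (f h * (likelihood \<rho> n q h / likelihood \<rho> n q0 h)) \<le> likelihood \<rho> n q h * f h" for h
      by (simp add: mult.left_commute mult.commute)
  qed
  also have "\<dots> = (\<integral>\<^sup>+h. f h \<partial>history_law E (Pr q) J S n)"
    unfolding history_law_eq_density[OF q] by (intro nn_integral_density[symmetric]) simp_all
  finally show ?thesis .
qed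

end

subsection \<open>Tests built from blocks of transitions\<close>

definition transition_score :: "'e kernel_density \<Rightarrow> 'e kernel_density \<Rightarrow> nat \<Rightarrow> 'e history \<Rightarrow> real" where
  "transition_score qa qb i h =
     hellinger_weight (sqrt (qa (fst h i) (transition i h))) (sqrt (qb (fst h i) (transition i h)))"

text \<open>A block consists of \<open>k + l + 1\<close> transitions.  The first \<open>l\<close> let the majorization take effect;
  the average over the last \<open>k\<close> of them makes the minorization applicable.\<close>

definition block_score ::
    "nat \<Rightarrow> nat \<Rightarrow> 'e kernel_density \<Rightarrow> 'e kernel_density \<Rightarrow> nat \<Rightarrow> 'e history \<Rightarrow> real" where
  "block_score k l qa qb i h =
     (\<Sum>u=1..k. transition_score qa qb (i * (k + l + 1) + (l + u)) h) / real k"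

definition test_score ::
    "nat \<Rightarrow> nat \<Rightarrow> 'e kernel_density \<Rightarrow> 'e kernel_density \<Rightarrow> nat \<Rightarrow> 'e history \<Rightarrow> real" where
  "test_score k l qa qb N h = (\<Prod>i<N. block_score k l qa qb i h)"

text \<open>The largest offset scored in a block is \<open>l + k\<close>, one less than the block
  length; so \<open>N\<close> complete blocks score only transitions present in a history of length
  \<open>n\<close>.\<close>

lemma block_index_less:
  fixes i N u k l n :: nat
  assumes "i < N" "u \<le> k" "N * (k + l + 1) \<le> n"
  shows "i * (k + l + 1) + (l + u) < n"
proof -
  have "Suc i * (k + l + 1) \<le> N * (k + l + 1)" using assms(1) by (intro mult_right_mono) auto
  then show ?thesis using assms(2,3) by simp
qed

text \<open>Cauchy-Schwarz for the square roots, whose products are all 1.\<close>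

lemma arith_harm_mean:
  fixes f g :: "'a \<Rightarrow> real"
  assumes "finite I" "I \<noteq> {}" "\<And>i. i \<in> I \<Longrightarrow> 0 < f i" "\<And>i. i \<in> I \<Longrightarrow> f i * g i = 1"
  shows "1 \<le> ((\<Sum>i\<in>I. f i) / real (card I)) * ((\<Sum>i\<in>I. g i) / real (card I))"
proof -
  have g: "0 < g i" if "i \<in> I" for i using assms(3,4)[OF that] by (metis zero_less_mult_pos zero_less_one)
  have "(\<Sum>i\<in>I. sqrt (f i) * sqrt (g i)) = (\<Sum>i\<in>I. 1)"
    by (intro sum.cong) (simp_all add: real_sqrt_mult[symmetric] assms(4))
  then have "(real (card I))\<^sup>2 = (\<Sum>i\<in>I. sqrt (f i) * sqrt (g i))\<^sup>2" by simp
  also have "\<dots> \<le> (\<Sum>i\<in>I. (sqrt (f i))\<^sup>2) * (\<Sum>i\<in>I. (sqrt (g i))\<^sup>2)" by (rule Cauchy_Schwarz_ineq_sum)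
  also have "\<dots> = (\<Sum>i\<in>I. f i) * (\<Sum>i\<in>I. g i)"
    using assms(3) g by (intro arg_cong2[where f = "(*)"] sum.cong) (auto simp: less_imp_le)
  finally have "(real (card I))\<^sup>2 \<le> (\<Sum>i\<in>I. f i) * (\<Sum>i\<in>I. g i)" .
  moreover have "0 < real (card I)" using assms(1,2) by (simp add: card_gt_0_iff)
  ultimately show ?thesis by (simp add: field_simps power2_eq_square)
qed

lemma ennreal_mult_mult:
  "0 \<le> a \<Longrightarrow> 0 \<le> b \<Longrightarrow> 0 \<le> c \<Longrightarrow> ennreal (a * (b * c)) = ennreal a * (ennreal b * ennreal c)"
  by (simp add: ennreal_mult)

lemma hellinger_sq_eq:
  "hellinger_sq \<nu> q1 q2 x = (\<integral>\<^sup>+z. ennreal ((sqrt (q1 x z) - sqrt (q2 x z))\<^sup>2) \<partial>\<nu>) * ennreal (1/2)"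
  by (simp add: hellinger_sq_def divide_ennreal_def inverse_ennreal[symmetric] ennreal_numeral[symmetric] del: ennreal_numeral)

lemma hellinger_sq_commute: "hellinger_sq \<nu> q1 q2 = hellinger_sq \<nu> q2 q1"
  by (simp add: hellinger_sq_def power2_commute fun_eq_iff)

lemma hellinger_sq_self: "hellinger_sq \<nu> q q x = 0"
  by (simp add: hellinger_sq_def)

context semi_markov_model
begin

section \<open>Positivity, reciprocity and measurability of the scores\<close>

lemma measurable_hellinger_sq_param:
  assumes a: "a \<in> measurable N \<QQ>" and b: "b \<in> measurable N \<QQ>" and c: "c \<in> measurable N E"
  shows "(\<lambda>w. hellinger_sq \<nu> (a w) (b w) (c w)) \<in> borel_measurable N"
  unfolding hellinger_sq_eq
proof (intro borel_measurable_times_ennreal borel_measurable_const borel_measurable_nn_integral_nu)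
  have [measurable]: "(\<lambda>p. a (fst p) (c (fst p)) (snd p)) \<in> borel_measurable (N \<Otimes>\<^sub>M mark_space)"
    "(\<lambda>p. b (fst p) (c (fst p)) (snd p)) \<in> borel_measurable (N \<Otimes>\<^sub>M mark_space)"
    using a b c by (auto intro!: measurable_parameter_density intro: measurable_compose[OF measurable_fst])
  show "(\<lambda>(w, z). ennreal ((sqrt (a w (c w) z) - sqrt (b w (c w) z))\<^sup>2)) \<in> borel_measurable (N \<Otimes>\<^sub>M mark_space)"
    unfolding split_beta by measurable
qed

lemma measurable_hellinger_sq:
  "qa \<in> space \<QQ> \<Longrightarrow> qb \<in> space \<QQ> \<Longrightarrow> hellinger_sq \<nu> qa qb \<in> borel_measurable E"
  using measurable_hellinger_sq_param[of "\<lambda>_. qa" E "\<lambda>_. qb" "\<lambda>x. x"] by simp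

lemma history_space_mark:
  assumes "h \<in> space (history_space E n)" "i < n"
  shows "fst h i \<in> space E" "transition i h \<in> space mark_space"
  using history_space_state[OF assms(1)] assms(2) measurable_space[OF measurable_transition[OF assms(2)] assms(1)]
  by auto

lemma transition_score_pos:
  assumes "qa \<in> space \<QQ>" "qb \<in> space \<QQ>" "h \<in> space (history_space E n)" "i < n"
  shows "0 < transition_score qa qb i h"
  unfolding transition_score_def using history_space_mark[OF assms(3,4)] assms(1,2)
  by (intro hellinger_weight_pos) (auto intro: density_nonneg)

lemma transition_score_inverse:
  assumes "qa \<in> space \<QQ>" "qb \<in> space \<QQ>" "h \<in> space (history_space E n)" "i < n"
  shows "transition_score qa qb i h * transition_score qb qa i h = 1"
  unfolding transition_score_def using history_space_mark[OF assms(3,4)] assms(1,2)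
  by (intro hellinger_weight_inverse) (auto intro: density_nonneg)

lemma measurable_transition_score:
  assumes "qa \<in> space \<QQ>" "qb \<in> space \<QQ>" "i < n"
  shows "transition_score qa qb i \<in> borel_measurable (history_space E n)"
proof -
  have [measurable]: "(\<lambda>h. q (fst h i) (transition i h)) \<in> borel_measurable (history_space E n)"
    if "q \<in> space \<QQ>" for q
    using assms(3) by (intro measurable_density[OF that] measurable_history_state measurable_transition) auto
  show ?thesis unfolding transition_score_def using assms(1,2) by measurable
qed

lemma block_score_pos:
  assumes "qa \<in> space \<QQ>" "qb \<in> space \<QQ>" "h \<in> space (history_space E n)"
    "1 \<le> k" "i < N" "N * (k + l + 1) \<le> n"
  shows "0 < block_score k l qa qb i h"
  unfolding block_score_def using assms block_index_less[of i N _ k l n]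
  by (intro divide_pos_pos sum_pos transition_score_pos[OF assms(1,2,3)]) auto

lemma test_score_pos:
  assumes "qa \<in> space \<QQ>" "qb \<in> space \<QQ>" "h \<in> space (history_space E n)"
    "1 \<le> k" "N * (k + l + 1) \<le> n"
  shows "0 < test_score k l qa qb N h"
  unfolding test_score_def using assms by (intro prod_pos block_score_pos[where N = N]) auto

text \<open>Whenever one product of block averages falls below 1 the exchanged one exceeds 1. An
  acceptance event is thereby contained in an event to which Markov's inequality for the exchanged
  score applies.\<close>

lemma test_score_mult_ge_1:
  assumes "qa \<in> space \<QQ>" "qb \<in> space \<QQ>" "h \<in> space (history_space E n)"
    "1 \<le> k" "N * (k + l + 1) \<le> n"
  shows "1 \<le> test_score k l qa qb N h * test_score k l qb qa N h"
proof -
  have "1 \<le> block_score k l qa qb i h * block_score k l qb qa i h" if "i < N" for i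
    using arith_harm_mean[of "{1..k}" "\<lambda>u. transition_score qa qb (i * (k + l + 1) + (l + u)) h"
        "\<lambda>u. transition_score qb qa (i * (k + l + 1) + (l + u)) h"]
      transition_score_pos[OF assms(1-3)] transition_score_inverse[OF assms(1-3)]
      block_index_less[OF that _ assms(5)] assms(4)
    by (simp add: block_score_def)
  then show ?thesis
    unfolding test_score_def prod.distrib[symmetric] by (intro prod_ge_1) auto
qed

lemma measurable_test_score:
  assumes "qa \<in> space \<QQ>" "qb \<in> space \<QQ>" "N * (k + l + 1) \<le> n"
  shows "test_score k l qa qb N \<in> borel_measurable (history_space E n)"
  unfolding test_score_def[abs_def] block_score_def
  using block_index_less[OF _ _ assms(3)]
  by (intro borel_measurable_prod borel_measurable_divide borel_measurable_sum measurable_transition_score assms(1,2))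
    auto

section \<open>Expected scores along the process\<close>

lemma fst_history: "i \<le> n \<Longrightarrow> fst (history J S n \<omega>) i = J i \<omega>"
  by (simp add: history_def)

lemma transition_history: "i < n \<Longrightarrow> transition i (history J S n \<omega>) = mark i \<omega>"
  by (simp add: history_def transition_def)

lemma transition_score_history:
  "i < n \<Longrightarrow> transition_score qa qb i (history J S n \<omega>)
    = hellinger_weight (sqrt (qa (J i \<omega>) (mark i \<omega>))) (sqrt (qb (J i \<omega>) (mark i \<omega>)))"
  by (simp add: transition_score_def fst_history transition_history)

lemma test_score_history:
  assumes "N * (k + l + 1) \<le> n"
  shows "test_score k l qa qb N (history J S n \<omega>) = test_score k l qa qb N (history J S (N * (k + l + 1)) \<omega>)"
  unfolding test_score_def block_score_def
proof (intro prod.cong refl arg_cong2[where f = "(/)"] sum.cong)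
  fix i u assume "i \<in> {..<N}" "u \<in> {1..k}"
  then have "i * (k + l + 1) + (l + u) < N * (k + l + 1)" by (intro block_index_less) auto
  then show "transition_score qa qb (i * (k + l + 1) + (l + u)) (history J S n \<omega>)
    = transition_score qa qb (i * (k + l + 1) + (l + u)) (history J S (N * (k + l + 1)) \<omega>)"
    using assms by (simp add: transition_score_history)
qed

text \<open>Here \<open>F\<close> accepts histories of every length but reads only the part up to
  time \<open>a\<close>: \<open>F_eq\<close> expresses this, and measurability is required for each
  length because the spaces differ. The last step is integrated out repeatedly until time
  \<open>a\<close> is reached.\<close>

lemma nn_integral_multi_step:
  assumes q: "q \<in> space \<QQ>"
    and F: "\<And>n. a \<le> n \<Longrightarrow> F \<in> borel_measurable (history_space E n)"
    and F_eq: "\<And>n \<omega>. a \<le> n \<Longrightarrow> F (history J S n \<omega>) = F (history J S a \<omega>)"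
    and f: "f \<in> borel_measurable E"
  shows "(\<integral>\<^sup>+\<omega>. F (history J S a \<omega>) * f (J (a + s) \<omega>) \<partial>Pr q)
    = (\<integral>\<^sup>+\<omega>. F (history J S a \<omega>) * (transition_operator \<nu> q ^^ s) f (J a \<omega>) \<partial>Pr q)"
  using f
proof (induction s arbitrary: f)
  case (Suc s)
  let ?n = "a + s"
  have m: "(\<lambda>w. F (fst w) * f (fst (snd w))) \<in> borel_measurable (history_space E ?n \<Otimes>\<^sub>M mark_space)"
    using F[of ?n] Suc.prems by (intro borel_measurable_times_ennreal) (auto intro: measurable_compose)
  have "(\<integral>\<^sup>+\<omega>. F (history J S a \<omega>) * f (J (a + Suc s) \<omega>) \<partial>Pr q)
     = (\<integral>\<^sup>+\<omega>. (\<integral>\<^sup>+z. ennreal (q (J ?n \<omega>) z) * (F (history J S ?n \<omega>) * f (fst z)) \<partial>\<nu>) \<partial>Pr q)"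
    using nn_integral_history_mark[OF q m] by (simp add: F_eq[of ?n])
  also have "\<dots> = (\<integral>\<^sup>+\<omega>. F (history J S a \<omega>) * transition_operator \<nu> q f (J (a + s) \<omega>) \<partial>Pr q)"
  proof (rule nn_integral_cong)
    fix \<omega> assume "\<omega> \<in> space (Pr q)"
    then have "J ?n \<omega> \<in> space E" using measurable_space[OF process(2)[OF q]] by blast
    then have "(\<lambda>z. ennreal (q (J ?n \<omega>) z) * f (fst z)) \<in> borel_measurable \<nu>"
      using measurable_density_section[OF q] Suc.prems
      by (auto intro!: borel_measurable_times_ennreal intro: measurable_compose[OF measurable_fst])
    from nn_integral_cmult[OF this, of "F (history J S ?n \<omega>)"]
    show "(\<integral>\<^sup>+z. ennreal (q (J ?n \<omega>) z) * (F (history J S ?n \<omega>) * f (fst z)) \<partial>\<nu>)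
      = F (history J S a \<omega>) * transition_operator \<nu> q f (J (a + s) \<omega>)"
      by (simp add: transition_operator_def F_eq[of ?n] mult.left_commute)
  qed
  also have "\<dots> = (\<integral>\<^sup>+\<omega>. F (history J S a \<omega>) * (transition_operator \<nu> q ^^ s) (transition_operator \<nu> q f) (J a \<omega>) \<partial>Pr q)"
    by (rule Suc.IH[OF measurable_transition_operator[OF q Suc.prems]])
  finally show ?case by (simp add: funpow_swap1)
qed simp

definition score_mean :: "'e kernel_density \<Rightarrow> 'e kernel_density \<Rightarrow> 'e kernel_density \<Rightarrow> 'e \<Rightarrow> ennreal" where
  "score_mean q qa qb x =
     (\<integral>\<^sup>+z. ennreal (q x z) * ennreal (hellinger_weight (sqrt (qa x z)) (sqrt (qb x z))) \<partial>\<nu>)"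

lemma measurable_score:
  assumes "qa \<in> space \<QQ>" "qb \<in> space \<QQ>" "f \<in> measurable N E" "g \<in> measurable N mark_space"
  shows "(\<lambda>w. hellinger_weight (sqrt (qa (f w) (g w))) (sqrt (qb (f w) (g w)))) \<in> borel_measurable N"
  using measurable_density[OF assms(1,3,4)] measurable_density[OF assms(2,3,4)] by measurable

lemma measurable_score_mean:
  assumes q: "q \<in> space \<QQ>" "qa \<in> space \<QQ>" "qb \<in> space \<QQ>"
  shows "score_mean q qa qb \<in> borel_measurable E"
  unfolding score_mean_def[abs_def]
proof (rule borel_measurable_nn_integral_nu)
  show "(\<lambda>(x, z). ennreal (q x z) * ennreal (hellinger_weight (sqrt (qa x z)) (sqrt (qb x z))))
      \<in> borel_measurable (E \<Otimes>\<^sub>M mark_space)"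
    unfolding split_beta
    using measurable_density[OF q(1) measurable_fst measurable_snd]
      measurable_score[OF q(2,3) measurable_fst measurable_snd] by measurable
qed

text \<open>The second density plays the part of the truth: the mean falls below 1 by the separation
  of \<open>qa\<close> and \<open>qb\<close>, up to an error for \<open>q\<close> differing from
  \<open>qb\<close>. With \<open>q = qb\<close> the error vanishes.\<close>

lemma score_mean_le:
  assumes q: "q \<in> space \<QQ>" "qa \<in> space \<QQ>" "qb \<in> space \<QQ>" and x: "x \<in> space E"
  shows "score_mean q qa qb x + hellinger_sq \<nu> qa qb x * ennreal (1/6)
    \<le> 1 + ennreal 8 * hellinger_sq \<nu> q qb x"
proof -
  \<comment> \<open>The factor 1/2 in \<open>hellinger_sq\<close> doubles the constants 1/12 and 4
    of the integrated inequality.\<close>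
  have e: "ennreal (1/2) * ennreal (1/6) = ennreal (1/12)" "ennreal 8 * ennreal (1/2) = ennreal 4"
    by (subst ennreal_mult[symmetric]; simp)+
  have "hellinger_sq \<nu> qa qb x * ennreal (1/6)
      = (\<integral>\<^sup>+z. ennreal ((sqrt (qa x z) - sqrt (qb x z))\<^sup>2) \<partial>\<nu>) * ennreal (1/12)"
    by (simp only: hellinger_sq_eq mult.assoc e)
  moreover have "ennreal 8 * hellinger_sq \<nu> q qb x
      = ennreal 4 * (\<integral>\<^sup>+z. ennreal ((sqrt (q x z) - sqrt (qb x z))\<^sup>2) \<partial>\<nu>)"
    by (simp only: hellinger_sq_eq mult.left_commute[of "ennreal 8"] e) (rule mult.commute)
  ultimately show ?thesis
    unfolding score_mean_def
    using hellinger_weight_nn_integral_le[of "q x" \<nu> "qa x" "qb x"] q x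
    by (simp add: measurable_density_section density_nonneg density_total space_nu space_mark)
qed

lemma nn_integral_score:
  assumes q: "q \<in> space \<QQ>" "qa \<in> space \<QQ>" "qb \<in> space \<QQ>"
    and F: "F \<in> borel_measurable (history_space E n)"
  shows "(\<integral>\<^sup>+\<omega>. F (history J S n \<omega>) * ennreal (transition_score qa qb n (history J S (Suc n) \<omega>)) \<partial>Pr q)
    = (\<integral>\<^sup>+\<omega>. F (history J S n \<omega>) * score_mean q qa qb (J n \<omega>) \<partial>Pr q)"
proof -
  let ?w = "\<lambda>x z. ennreal (hellinger_weight (sqrt (qa x z)) (sqrt (qb x z)))"
  have "(\<lambda>w. ?w (fst (fst w) n) (snd w)) \<in> borel_measurable (history_space E n \<Otimes>\<^sub>M mark_space)"
    using measurable_score[OF q(2,3) measurable_compose[OF measurable_fst measurable_history_state[of n n]] measurable_snd]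
    by measurable
  then have m: "(\<lambda>w. F (fst w) * ?w (fst (fst w) n) (snd w)) \<in> borel_measurable (history_space E n \<Otimes>\<^sub>M mark_space)"
    using F by (intro borel_measurable_times_ennreal) (auto intro: measurable_compose)
  have "(\<integral>\<^sup>+\<omega>. F (history J S n \<omega>) * ennreal (transition_score qa qb n (history J S (Suc n) \<omega>)) \<partial>Pr q)
      = (\<integral>\<^sup>+\<omega>. (\<integral>\<^sup>+z. ennreal (q (J n \<omega>) z) * (F (history J S n \<omega>) * ?w (J n \<omega>) z) \<partial>\<nu>) \<partial>Pr q)"
    using nn_integral_history_mark[OF q(1) m] by (simp add: transition_score_history fst_history)
  also have "\<dots> = (\<integral>\<^sup>+\<omega>. F (history J S n \<omega>) * score_mean q qa qb (J n \<omega>) \<partial>Pr q)"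
  proof (rule nn_integral_cong)
    fix \<omega> assume "\<omega> \<in> space (Pr q)"
    then have x: "J n \<omega> \<in> space E" using measurable_space[OF process(2)[OF q(1)]] by blast
    have "(\<lambda>z. ennreal (q (J n \<omega>) z) * ?w (J n \<omega>) z) \<in> borel_measurable \<nu>"
      using measurable_density_section[OF q(1) x] measurable_score[OF q(2,3), of "\<lambda>_. J n \<omega>" mark_space "\<lambda>z. z"] x
      by simp
    from nn_integral_cmult[OF this, of "F (history J S n \<omega>)"]
    show "(\<integral>\<^sup>+z. ennreal (q (J n \<omega>) z) * (F (history J S n \<omega>) * ?w (J n \<omega>) z) \<partial>\<nu>)
      = F (history J S n \<omega>) * score_mean q qa qb (J n \<omega>)"
      by (simp add: score_mean_def mult.left_commute)
  qed
  finally show ?thesis .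
qed

text \<open>Given the history at the start of a block, the mean of the block average is at most
  \<alpha> whatever the current state, so every block contributes one factor. Since the block score
  is linear in the single scores, these are integrated separately and their dependence is
  harmless.\<close>

lemma nn_integral_test_score_le:
  assumes q: "q \<in> space \<QQ>" "qa \<in> space \<QQ>" "qb \<in> space \<QQ>" and k: "1 \<le> k"
    and \<alpha>: "\<And>x. x \<in> space E \<Longrightarrow>
      ennreal (1 / real k) * (\<Sum>u=1..k. (transition_operator \<nu> q ^^ (l + u)) (score_mean q qa qb) x) \<le> \<alpha>"
  shows "(\<integral>\<^sup>+\<omega>. ennreal (test_score k l qa qb N (history J S (N * (k + l + 1)) \<omega>)) \<partial>Pr q) \<le> \<alpha> ^ N"
proof (induction N)
  case 0
  show ?case using prob_space.emeasure_space_1[OF process(1)[OF q(1)]] by (simp add: test_score_def)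
next
  case (Suc N)
  let ?m = "k + l + 1" and ?c = "ennreal (1 / real k)"
  define a where "a = N * ?m"
  have a: "N * ?m \<le> n \<longleftrightarrow> a \<le> n" "Suc N * ?m = a + ?m" for n by (simp_all add: a_def)
  let ?F = "\<lambda>h. ennreal (test_score k l qa qb N h)"
  let ?T = "\<lambda>u. (transition_operator \<nu> q ^^ (l + u)) (score_mean q qa qb)"
  have F[measurable]: "?F \<in> borel_measurable (history_space E n)" if "a \<le> n" for n
    using measurable_test_score[OF q(2,3) a(1)[THEN iffD2, OF that]] by measurable
  have F_eq: "?F (history J S n \<omega>) = ?F (history J S a \<omega>)" if "a \<le> n" for n \<omega>
    using test_score_history[OF a(1)[THEN iffD2, OF that]] by (simp only: a_def)
  note Fa = measurable_compose[OF measurable_history[OF q(1)] F[OF order_refl]]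
  have W: "(\<lambda>\<omega>. ennreal (transition_score qa qb (a + (l + u)) (history J S (Suc (a + (l + u))) \<omega>)))
      \<in> borel_measurable (Pr q)" for u
    using measurable_compose[OF measurable_history[OF q(1)] measurable_transition_score[OF q(2,3) lessI]] by measurable
  have T: "(\<lambda>\<omega>. ?T u (J a \<omega>)) \<in> borel_measurable (Pr q)" for u
    by (rule measurable_compose[OF process(2)[OF q(1)]
          measurable_transition_operator_funpow[OF q(1) measurable_score_mean[OF q]]])
  have "(\<integral>\<^sup>+\<omega>. ennreal (test_score k l qa qb (Suc N) (history J S (Suc N * ?m) \<omega>)) \<partial>Pr q)
      = (\<integral>\<^sup>+\<omega>. ?c * (\<Sum>u=1..k. ?F (history J S a \<omega>)
          * ennreal (transition_score qa qb (a + (l + u)) (history J S (Suc (a + (l + u))) \<omega>))) \<partial>Pr q)"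
  proof (rule nn_integral_cong)
    fix \<omega> assume \<omega>: "\<omega> \<in> space (Pr q)"
    let ?s = "\<lambda>u. transition_score qa qb (a + (l + u)) (history J S (Suc (a + (l + u))) \<omega>)"
    have h: "history J S n \<omega> \<in> space (history_space E n)" for n
      using measurable_space[OF measurable_history[OF q(1)] \<omega>] .
    have s: "transition_score qa qb (a + (l + u)) (history J S (Suc N * ?m) \<omega>) = ?s u" if "u \<in> {1..k}" for u
      unfolding a(2) using that by (simp add: transition_score_history)
    have pos: "0 \<le> ?s u" for u using transition_score_pos[OF q(2,3) h lessI] by (simp add: less_imp_le)
    have "test_score k l qa qb (Suc N) (history J S (Suc N * ?m) \<omega>)
        = test_score k l qa qb N (history J S (Suc N * ?m) \<omega>) * ((\<Sum>u=1..k. ?s u) / real k)"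
      unfolding test_score_def block_score_def prod.lessThan_Suc a_def[symmetric] by (simp only: s cong: sum.cong)
    also have "test_score k l qa qb N (history J S (Suc N * ?m) \<omega>) = test_score k l qa qb N (history J S a \<omega>)"
      using test_score_history[of N k l "Suc N * ?m"] by (simp add: a_def)
    also have "test_score k l qa qb N (history J S a \<omega>) * ((\<Sum>u=1..k. ?s u) / real k)
        = 1 / real k * (test_score k l qa qb N (history J S a \<omega>) * (\<Sum>u=1..k. ?s u))" by simp
    finally have eq: "test_score k l qa qb (Suc N) (history J S (Suc N * ?m) \<omega>)
        = 1 / real k * (test_score k l qa qb N (history J S a \<omega>) * (\<Sum>u=1..k. ?s u))" .
    have "ennreal (test_score k l qa qb (Suc N) (history J S (Suc N * ?m) \<omega>))
        = ?c * (?F (history J S a \<omega>) * (\<Sum>u=1..k. ennreal (?s u)))"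
      using test_score_pos[OF q(2,3) h[of a] k a(1)[THEN iffD2, OF order_refl]] pos
      unfolding eq by (subst ennreal_mult_mult) (simp_all add: sum_nonneg less_imp_le sum_ennreal)
    then show "ennreal (test_score k l qa qb (Suc N) (history J S (Suc N * ?m) \<omega>))
      = ?c * (\<Sum>u=1..k. ?F (history J S a \<omega>) * ennreal (?s u))"
      by (simp only: sum_distrib_left)
  qed
  also have "\<dots> = ?c * (\<Sum>u=1..k. \<integral>\<^sup>+\<omega>. ?F (history J S a \<omega>)
          * ennreal (transition_score qa qb (a + (l + u)) (history J S (Suc (a + (l + u))) \<omega>)) \<partial>Pr q)"
    using Fa W
    by (subst nn_integral_cmult, (intro borel_measurable_sum borel_measurable_times_ennreal; simp),
        subst nn_integral_sum) (auto intro: borel_measurable_times_ennreal)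
  also have "(\<Sum>u=1..k. \<integral>\<^sup>+\<omega>. ?F (history J S a \<omega>)
          * ennreal (transition_score qa qb (a + (l + u)) (history J S (Suc (a + (l + u))) \<omega>)) \<partial>Pr q)
      = (\<Sum>u=1..k. \<integral>\<^sup>+\<omega>. ?F (history J S a \<omega>) * ?T u (J a \<omega>) \<partial>Pr q)"
  proof (rule sum.cong)
    \<comment> \<open>First the scored transition is integrated out, leaving
      \<open>score_mean\<close> at the state before it; then the \<open>l + u\<close> steps since
      the start of the block are.\<close>
    fix u
    have "(\<integral>\<^sup>+\<omega>. ?F (history J S (a + (l + u)) \<omega>)
          * ennreal (transition_score qa qb (a + (l + u)) (history J S (Suc (a + (l + u))) \<omega>)) \<partial>Pr q)
       = (\<integral>\<^sup>+\<omega>. ?F (history J S (a + (l + u)) \<omega>) * score_mean q qa qb (J (a + (l + u)) \<omega>) \<partial>Pr q)"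
      by (rule nn_integral_score[OF q F]) simp
    also have "\<dots> = (\<integral>\<^sup>+\<omega>. ?F (history J S a \<omega>) * score_mean q qa qb (J (a + (l + u)) \<omega>) \<partial>Pr q)"
      by (intro nn_integral_cong arg_cong2[where f = "(*)"] refl F_eq) simp
    also have "\<dots> = (\<integral>\<^sup>+\<omega>. ?F (history J S a \<omega>) * ?T u (J a \<omega>) \<partial>Pr q)"
      by (rule nn_integral_multi_step[OF q(1) F F_eq measurable_score_mean[OF q]])
    finally show "(\<integral>\<^sup>+\<omega>. ?F (history J S a \<omega>)
          * ennreal (transition_score qa qb (a + (l + u)) (history J S (Suc (a + (l + u))) \<omega>)) \<partial>Pr q)
       = (\<integral>\<^sup>+\<omega>. ?F (history J S a \<omega>) * ?T u (J a \<omega>) \<partial>Pr q)"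
      by (simp only: F_eq[of "a + (l + u)"] le_add1)
  qed simp
  also have "?c * (\<Sum>u=1..k. \<integral>\<^sup>+\<omega>. ?F (history J S a \<omega>) * ?T u (J a \<omega>) \<partial>Pr q)
      = (\<integral>\<^sup>+\<omega>. ?F (history J S a \<omega>) * (?c * (\<Sum>u=1..k. ?T u (J a \<omega>))) \<partial>Pr q)"
  proof -
    have "?c * (\<Sum>u=1..k. \<integral>\<^sup>+\<omega>. ?F (history J S a \<omega>) * ?T u (J a \<omega>) \<partial>Pr q)
        = ?c * (\<integral>\<^sup>+\<omega>. (\<Sum>u=1..k. ?F (history J S a \<omega>) * ?T u (J a \<omega>)) \<partial>Pr q)"
      by (subst nn_integral_sum) (intro borel_measurable_times_ennreal Fa T refl)+
    also have "\<dots> = (\<integral>\<^sup>+\<omega>. ?c * (\<Sum>u=1..k. ?F (history J S a \<omega>) * ?T u (J a \<omega>)) \<partial>Pr q)"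
      by (subst nn_integral_cmult) (intro borel_measurable_sum borel_measurable_times_ennreal Fa T refl)+
    also have "\<dots> = (\<integral>\<^sup>+\<omega>. ?F (history J S a \<omega>) * (?c * (\<Sum>u=1..k. ?T u (J a \<omega>))) \<partial>Pr q)"
      by (intro nn_integral_cong) (simp only: sum_distrib_left mult.left_commute)
    finally show ?thesis .
  qed
  also have "\<dots> \<le> (\<integral>\<^sup>+\<omega>. ?F (history J S a \<omega>) * \<alpha> \<partial>Pr q)"
    by (intro nn_integral_mono mult_left_mono \<alpha> measurable_space[OF process(2)[OF q(1)]]) auto
  also have "\<dots> = (\<integral>\<^sup>+\<omega>. ?F (history J S a \<omega>) \<partial>Pr q) * \<alpha>"
    using Fa by (rule nn_integral_multc)
  also have "\<dots> \<le> \<alpha> ^ N * \<alpha>" by (rule mult_right_mono[OF Suc[folded a_def]]) simp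
  finally show ?case by (simp only: power_Suc2)
qed

end

section \<open>Squared semi-distances\<close>

definition semi_dist_sq ::
    "('e \<times> real) measure \<Rightarrow> 'e measure \<Rightarrow> 'e kernel_density \<Rightarrow> 'e kernel_density \<Rightarrow> ennreal" where
  "semi_dist_sq \<nu> \<mu> q1 q2 = (\<integral>\<^sup>+x. hellinger_sq \<nu> q1 q2 x \<partial>\<mu>)"

lemma semi_dist_le_iff:
  "0 \<le> r \<Longrightarrow> semi_dist \<nu> \<mu> q1 q2 \<le> ennreal r \<longleftrightarrow> semi_dist_sq \<nu> \<mu> q1 q2 \<le> ennreal (r\<^sup>2)"
  by (simp add: semi_dist_def semi_dist_sq_def sqrt_ennreal_le_iff)

lemma semi_dist_sq_commute: "semi_dist_sq \<nu> \<mu> q1 q2 = semi_dist_sq \<nu> \<mu> q2 q1"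
  by (simp add: semi_dist_sq_def hellinger_sq_commute)

lemma semi_dist_sq_self: "semi_dist_sq \<nu> \<mu> q q = 0"
  by (simp add: semi_dist_sq_def hellinger_sq_self)

lemma divide_of_nat_ennreal: "1 \<le> k \<Longrightarrow> a / of_nat k = ennreal (1 / real k) * a"
  by (simp add: divide_ennreal_def ennreal_of_nat_eq_real_of_nat inverse_ennreal inverse_eq_divide mult.commute)

lemma (in semi_markov_model) hellinger_sq_le_1:
  assumes q: "q1 \<in> space \<QQ>" "q2 \<in> space \<QQ>" and x: "x \<in> space E"
  shows "hellinger_sq \<nu> q1 q2 x \<le> 1"
proof -
  have "(\<integral>\<^sup>+z. ennreal ((sqrt (q1 x z) - sqrt (q2 x z))\<^sup>2) \<partial>\<nu>) \<le> (\<integral>\<^sup>+z. ennreal (q1 x z) + ennreal (q2 x z) \<partial>\<nu>)"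
  proof (rule nn_integral_mono)
    fix z assume "z \<in> space \<nu>"
    then have "0 \<le> q1 x z" "0 \<le> q2 x z" using q x by (auto intro!: density_nonneg simp: space_nu space_mark)
    moreover from this have "(sqrt (q1 x z) - sqrt (q2 x z))\<^sup>2 \<le> q1 x z + q2 x z"
      by (simp add: power2_diff)
    ultimately show "ennreal ((sqrt (q1 x z) - sqrt (q2 x z))\<^sup>2) \<le> ennreal (q1 x z) + ennreal (q2 x z)"
      by (simp add: ennreal_plus[symmetric] ennreal_leI del: ennreal_plus)
  qed
  also have "\<dots> = ennreal 2"
    using measurable_density_section[OF q(1) x] measurable_density_section[OF q(2) x]
    by (simp add: nn_integral_add density_total q x one_add_one)
  finally have "hellinger_sq \<nu> q1 q2 x \<le> ennreal 2 * ennreal (1/2)"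
    unfolding hellinger_sq_eq by (rule mult_right_mono) simp
  also have "\<dots> = 1" by (subst ennreal_mult[symmetric]) auto
  finally show ?thesis .
qed

text \<open>Staying with squares avoids roots of possibly infinite quantities at the price of a
  factor 2, which affects only the constants in the separation of \<open>q0\<close> from the
  centres.\<close>

lemma (in semi_markov_model) hellinger_sq_triangle:
  assumes q: "q1 \<in> space \<QQ>" "q2 \<in> space \<QQ>" "q3 \<in> space \<QQ>" and x: "x \<in> space E"
  shows "hellinger_sq \<nu> q1 q3 x \<le> ennreal 2 * hellinger_sq \<nu> q1 q2 x + ennreal 2 * hellinger_sq \<nu> q2 q3 x"
proof -
  let ?d = "\<lambda>a b z. ennreal ((sqrt (a x z) - sqrt (b x z))\<^sup>2)"
  have [measurable]: "q1 x \<in> borel_measurable mark_space" "q2 x \<in> borel_measurable mark_space"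
    "q3 x \<in> borel_measurable mark_space" using measurable_density_section q x by auto
  have "(\<integral>\<^sup>+z. ?d q1 q3 z \<partial>\<nu>) \<le> (\<integral>\<^sup>+z. ennreal 2 * ?d q1 q2 z + ennreal 2 * ?d q2 q3 z \<partial>\<nu>)"
  proof (rule nn_integral_mono)
    have "(a - c)\<^sup>2 \<le> 2 * (a - b)\<^sup>2 + 2 * (b - c)\<^sup>2" for a b c :: real
    proof -
      have "2 * (a - b)\<^sup>2 + 2 * (b - c)\<^sup>2 - (a - c)\<^sup>2 = (a - 2 * b + c)\<^sup>2"
        by (simp add: power2_eq_square algebra_simps)
      then show ?thesis using zero_le_power2[of "a - 2 * b + c"] by linarith
    qed
    then show "?d q1 q3 z \<le> ennreal 2 * ?d q1 q2 z + ennreal 2 * ?d q2 q3 z" for z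
      by (simp add: ennreal_mult[symmetric] ennreal_plus[symmetric] ennreal_leI del: ennreal_plus ennreal_numeral)
  qed
  also have "\<dots> = ennreal 2 * (\<integral>\<^sup>+z. ?d q1 q2 z \<partial>\<nu>) + ennreal 2 * (\<integral>\<^sup>+z. ?d q2 q3 z \<partial>\<nu>)"
    by (subst nn_integral_add) (simp_all add: nn_integral_cmult)
  finally have "(\<integral>\<^sup>+z. ?d q1 q3 z \<partial>\<nu>) * ennreal (1/2)
      \<le> (ennreal 2 * (\<integral>\<^sup>+z. ?d q1 q2 z \<partial>\<nu>) + ennreal 2 * (\<integral>\<^sup>+z. ?d q2 q3 z \<partial>\<nu>)) * ennreal (1/2)"
    by (rule mult_right_mono) simp
  then show ?thesis by (simp only: hellinger_sq_eq distrib_right mult.assoc)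
qed

lemma (in semi_markov_model) semi_dist_sq_triangle:
  assumes q: "q1 \<in> space \<QQ>" "q2 \<in> space \<QQ>" "q3 \<in> space \<QQ>" and \<mu>: "sets \<mu> = sets E"
  shows "semi_dist_sq \<nu> \<mu> q1 q3 \<le> ennreal 2 * semi_dist_sq \<nu> \<mu> q1 q2 + ennreal 2 * semi_dist_sq \<nu> \<mu> q2 q3"
proof -
  have m: "hellinger_sq \<nu> q1 q2 \<in> borel_measurable \<mu>" "hellinger_sq \<nu> q2 q3 \<in> borel_measurable \<mu>"
    using measurable_hellinger_sq q by (auto simp: measurable_cong_sets[OF \<mu> refl])
  have "semi_dist_sq \<nu> \<mu> q1 q3 \<le> (\<integral>\<^sup>+x. ennreal 2 * hellinger_sq \<nu> q1 q2 x + ennreal 2 * hellinger_sq \<nu> q2 q3 x \<partial>\<mu>)"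
    unfolding semi_dist_sq_def using sets_eq_imp_space_eq[OF \<mu>]
    by (intro nn_integral_mono hellinger_sq_triangle q) auto
  also have "\<dots> = ennreal 2 * semi_dist_sq \<nu> \<mu> q1 q2 + ennreal 2 * semi_dist_sq \<nu> \<mu> q2 q3"
    unfolding semi_dist_sq_def using m by (subst nn_integral_add) (simp_all add: nn_integral_cmult)
  finally show ?thesis .
qed

section \<open>Consequences of the minorization and the majorization\<close>

locale sandwiched_semi_markov_model = semi_markov_model E \<nu> \<QQ> \<rho> Pr J S
  for E :: "'e measure" and \<nu> \<QQ> \<rho> and Pr :: "'e kernel_density \<Rightarrow> 'w measure" and J S +
  fixes \<nu>s \<eta>s :: "'e measure" and k l :: nat
  assumes sets_minorant: "sets \<nu>s = sets E"
    and sets_majorant: "sets \<eta>s = sets E"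
    and k_ge_1: "1 \<le> k"
    and minorization: "\<And>q x A. q \<in> space \<QQ> \<Longrightarrow> x \<in> space E \<Longrightarrow> A \<in> sets E \<Longrightarrow>
      emeasure \<nu>s A \<le> (\<Sum>u=1..k. emeasure (kernel_pow E (chain_kernel E \<nu> q) u x) A) / of_nat k"
    and majorization: "\<And>q x A. q \<in> space \<QQ> \<Longrightarrow> x \<in> space E \<Longrightarrow> A \<in> sets E \<Longrightarrow>
      emeasure (kernel_pow E (chain_kernel E \<nu> q) l x) A \<le> emeasure \<eta>s A"
begin

abbreviation step_law :: "'e kernel_density \<Rightarrow> nat \<Rightarrow> 'e \<Rightarrow> 'e measure" where
  "step_law q n x \<equiv> kernel_pow E (chain_kernel E \<nu> q) n x"

text \<open>The minorization holds from every state, so it survives averaging over the state reached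
  after the first \<open>l\<close> steps.\<close>

lemma minorant_le_shifted:
  assumes q: "q \<in> space \<QQ>" and x: "x \<in> space E" and A: "A \<in> sets E"
  shows "emeasure \<nu>s A \<le> ennreal (1 / real k) * (\<Sum>u=1..k. emeasure (step_law q (l + u) x) A)"
proof -
  have sp: "space (step_law q l x) = space E" using sets_eq_imp_space_eq[OF kernel_pow_space(2)[OF q x]] .
  have m: "(\<lambda>y. emeasure (step_law q u y) A) \<in> borel_measurable (step_law q l x)" for u
    using measurable_compose[OF measurable_prob_algebraD[OF measurable_kernel_pow[OF q]]
        measurable_emeasure_subprob_algebra[OF A]]
    by (simp add: measurable_cong_sets[OF kernel_pow_space(2)[OF q x] refl])
  have "emeasure \<nu>s A = (\<integral>\<^sup>+y. emeasure \<nu>s A \<partial>step_law q l x)"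
    using prob_space.emeasure_space_1[OF kernel_pow_space(1)[OF q x]] by simp
  also have "\<dots> \<le> (\<integral>\<^sup>+y. ennreal (1 / real k) * (\<Sum>u=1..k. emeasure (step_law q u y) A) \<partial>step_law q l x)"
    using minorization[OF q _ A] k_ge_1 by (intro nn_integral_mono) (simp add: divide_of_nat_ennreal sp)
  also have "\<dots> = ennreal (1 / real k) * (\<Sum>u=1..k. \<integral>\<^sup>+y. emeasure (step_law q u y) A \<partial>step_law q l x)"
    using m by (simp add: nn_integral_cmult nn_integral_sum)
  finally show ?thesis by (simp only: emeasure_kernel_pow_add[OF q x A])
qed

text \<open>Here the \<open>u\<close> extra steps are put first: wherever they lead, the final
  \<open>l\<close> steps obey the majorization.\<close>

lemma shifted_le_majorant:
  assumes q: "q \<in> space \<QQ>" and x: "x \<in> space E" and A: "A \<in> sets E"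
  shows "emeasure (step_law q (l + u) x) A \<le> emeasure \<eta>s A"
proof -
  have sp: "space (step_law q u x) = space E" using sets_eq_imp_space_eq[OF kernel_pow_space(2)[OF q x]] .
  have "emeasure (step_law q (l + u) x) A = (\<integral>\<^sup>+y. emeasure (step_law q l y) A \<partial>step_law q u x)"
    by (simp only: add.commute[of l u] emeasure_kernel_pow_add[OF q x A])
  also have "\<dots> \<le> (\<integral>\<^sup>+y. emeasure \<eta>s A \<partial>step_law q u x)"
    using majorization[OF q _ A] by (intro nn_integral_mono) (simp add: sp)
  finally show ?thesis
    using prob_space.emeasure_space_1[OF kernel_pow_space(1)[OF q x]] by simp
qed

lemma nn_integral_minorant_le:
  assumes q: "q \<in> space \<QQ>" and x: "x \<in> space E" and f: "f \<in> borel_measurable E"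
  shows "(\<integral>\<^sup>+y. f y \<partial>\<nu>s) \<le> ennreal (1 / real k) * (\<Sum>u=1..k. \<integral>\<^sup>+y. f y \<partial>step_law q (l + u) x)"
  by (rule nn_integral_le_of_emeasure_le_sum)
    (use minorant_le_shifted[OF q x] kernel_pow_space(2)[OF q x] f in
      \<open>simp_all add: sets_minorant measurable_cong_sets[OF sets_minorant refl]\<close>)

lemma nn_integral_le_majorant:
  assumes q: "q \<in> space \<QQ>" and x: "x \<in> space E" and f: "f \<in> borel_measurable E"
  shows "(\<integral>\<^sup>+y. f y \<partial>step_law q (l + u) x) \<le> (\<integral>\<^sup>+y. f y \<partial>\<eta>s)"
  using nn_integral_le_of_emeasure_le_sum[of f "step_law q (l + u) x" "{()}" "\<lambda>_. \<eta>s" 1]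
    shifted_le_majorant[OF q x] kernel_pow_space(2)[OF q x] f
  by (simp add: sets_majorant measurable_cong_sets[OF kernel_pow_space(2)[OF q x] refl])

lemma inverse_k_times: "ennreal (1 / real k) * (\<Sum>u=1..k. c) = c"
  using k_ge_1 divide_of_nat_ennreal[of k "\<Sum>u=1..k. c"]
  by (simp add: mult.commute[of "of_nat k"] mult_divide_eq_ennreal)

text \<open>Both bounds concern the same laws after \<open>l + u\<close> steps, which places the
  minorant below the majorant. Hence closeness for \<open>\<eta>s\<close>, as provided by the
  covers, implies closeness for \<open>\<nu>s\<close>.\<close>

lemma nn_integral_minorant_le_majorant:
  assumes q: "q \<in> space \<QQ>" and f: "f \<in> borel_measurable E"
  shows "(\<integral>\<^sup>+y. f y \<partial>\<nu>s) \<le> (\<integral>\<^sup>+y. f y \<partial>\<eta>s)"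
proof -
  obtain x where x: "x \<in> space E" using space_E_nonempty[OF q] by blast
  have "(\<integral>\<^sup>+y. f y \<partial>\<nu>s) \<le> ennreal (1 / real k) * (\<Sum>u=1..k. \<integral>\<^sup>+y. f y \<partial>\<eta>s)"
    using nn_integral_minorant_le[OF q x f]
    by (rule order_trans) (intro mult_left_mono sum_mono nn_integral_le_majorant[OF q x f], simp)
  then show ?thesis by (simp only: inverse_k_times)
qed

text \<open>Finiteness of the minorant is used twice: semi-distances for \<open>\<nu>s\<close> are
  finite, so each parameter lies in some shell, and Fubini-type measurability in the parameter
  becomes available.\<close>

lemma emeasure_minorant_le_1:
  assumes q: "q \<in> space \<QQ>"
  shows "emeasure \<nu>s (space \<nu>s) \<le> 1"
proof -
  obtain x where x: "x \<in> space E" using space_E_nonempty[OF q] by blast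
  have "emeasure \<nu>s (space E) \<le> ennreal (1 / real k) * (\<Sum>u=1..k. emeasure (step_law q (l + u) x) (space E))"
    by (rule minorant_le_shifted[OF q x sets.top])
  also have "\<dots> \<le> ennreal (1 / real k) * (\<Sum>u=1..k. 1)"
    using kernel_pow_space(1)[OF q x]
    by (intro mult_left_mono sum_mono subprob_space.subprob_emeasure_le_1 prob_space_imp_subprob_space) simp_all
  finally show ?thesis using sets_eq_imp_space_eq[OF sets_minorant] by (simp only: inverse_k_times)
qed

lemma semi_dist_sq_minorant_le_1:
  assumes q: "q1 \<in> space \<QQ>" "q2 \<in> space \<QQ>"
  shows "semi_dist_sq \<nu> \<nu>s q1 q2 \<le> 1"
proof -
  have "semi_dist_sq \<nu> \<nu>s q1 q2 \<le> (\<integral>\<^sup>+x. 1 \<partial>\<nu>s)"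
    unfolding semi_dist_sq_def using sets_eq_imp_space_eq[OF sets_minorant]
    by (intro nn_integral_mono hellinger_sq_le_1 q) auto
  then show ?thesis using emeasure_minorant_le_1[OF q(1)] by simp
qed

lemma semi_dist_sq_minorant_le_majorant:
  "q1 \<in> space \<QQ> \<Longrightarrow> q2 \<in> space \<QQ> \<Longrightarrow> semi_dist_sq \<nu> \<nu>s q1 q2 \<le> semi_dist_sq \<nu> \<eta>s q1 q2"
  unfolding semi_dist_sq_def by (intro nn_integral_minorant_le_majorant measurable_hellinger_sq)

lemma measurable_semi_dist_sq:
  assumes q0: "q0 \<in> space \<QQ>"
  shows "(\<lambda>q. semi_dist_sq \<nu> \<nu>s q0 q) \<in> borel_measurable \<QQ>"
  unfolding semi_dist_sq_def
proof (rule sigma_finite_measure.borel_measurable_nn_integral)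
  have "emeasure \<nu>s (space \<nu>s) \<noteq> \<infinity>" using emeasure_minorant_le_1[OF q0] by (auto simp: top_unique)
  then show "sigma_finite_measure \<nu>s" by (intro finite_measure.axioms(1) finite_measureI)
  show "(\<lambda>(q, x). hellinger_sq \<nu> q0 q x) \<in> borel_measurable (\<QQ> \<Otimes>\<^sub>M \<nu>s)"
    unfolding split_beta using q0
    by (intro measurable_hellinger_sq_param)
      (simp_all add: measurable_cong_sets[OF sets_pair_measure_cong[OF refl sets_minorant] refl])
qed

text \<open>The separation term is bounded below by the minorization, which needs the average over
  \<open>u\<close>; the error term is bounded above by the majorization, for each \<open>u\<close>
  separately. The exponential comes from \<open>1 + x \<le> exp x\<close> and makes products over
  blocks additive in the exponent.\<close>

lemma block_mean_le:
  assumes q: "q \<in> space \<QQ>" "qa \<in> space \<QQ>" "qb \<in> space \<QQ>" and x: "x \<in> space E"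
    and d: "0 \<le> d" "ennreal d \<le> semi_dist_sq \<nu> \<nu>s qa qb"
    and \<delta>: "0 \<le> \<delta>" "semi_dist_sq \<nu> \<eta>s q qb \<le> ennreal \<delta>"
  shows "ennreal (1 / real k) * (\<Sum>u=1..k. (transition_operator \<nu> q ^^ (l + u)) (score_mean q qa qb) x)
    \<le> ennreal (exp (8 * \<delta> - d / 6))"
proof -
  let ?c = "ennreal (1 / real k)" and ?P = "\<lambda>u. step_law q (l + u) x"
  let ?G = "score_mean q qa qb" and ?h = "hellinger_sq \<nu> qa qb" and ?h' = "hellinger_sq \<nu> q qb"
  have sp: "space (?P u) = space E" for u using sets_eq_imp_space_eq[OF kernel_pow_space(2)[OF q(1) x]] .
  have m: "?G \<in> borel_measurable E" "?h \<in> borel_measurable E" "?h' \<in> borel_measurable E"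
    using measurable_score_mean measurable_hellinger_sq q by auto
  have m': "?G \<in> borel_measurable (?P u)" "?h \<in> borel_measurable (?P u)" "?h' \<in> borel_measurable (?P u)" for u
    using m by (simp_all add: measurable_cong_sets[OF kernel_pow_space(2)[OF q(1) x] refl])
  have "(\<integral>\<^sup>+y. ?G y \<partial>?P u) + (\<integral>\<^sup>+y. ?h y \<partial>?P u) * ennreal (1/6) \<le> ennreal (1 + 8 * \<delta>)" for u
  proof -
    have "(\<integral>\<^sup>+y. ?G y \<partial>?P u) + (\<integral>\<^sup>+y. ?h y \<partial>?P u) * ennreal (1/6)
        = (\<integral>\<^sup>+y. ?G y + ?h y * ennreal (1/6) \<partial>?P u)"
      using m' by (subst nn_integral_add) (simp_all add: nn_integral_multc)
    also have "\<dots> \<le> (\<integral>\<^sup>+y. 1 + ennreal 8 * ?h' y \<partial>?P u)"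
      by (intro nn_integral_mono score_mean_le q) (simp add: sp)
    also have "\<dots> = 1 + ennreal 8 * (\<integral>\<^sup>+y. ?h' y \<partial>?P u)"
      using m' prob_space.emeasure_space_1[OF kernel_pow_space(1)[OF q(1) x]]
      by (subst nn_integral_add) (simp_all add: nn_integral_cmult)
    also have "\<dots> \<le> 1 + ennreal 8 * ennreal \<delta>"
      using nn_integral_le_majorant[OF q(1) x m(3), of u] \<delta>(2)
      by (intro add_left_mono mult_left_mono) (auto simp: semi_dist_sq_def)
    also have "\<dots> = ennreal (1 + 8 * \<delta>)"
      using \<delta>(1) by (simp add: ennreal_mult[symmetric] ennreal_plus[symmetric] ennreal_1[symmetric]
        del: ennreal_plus ennreal_numeral ennreal_1)
    finally show ?thesis .
  qed
  then have "?c * (\<Sum>u=1..k. (\<integral>\<^sup>+y. ?G y \<partial>?P u) + (\<integral>\<^sup>+y. ?h y \<partial>?P u) * ennreal (1/6))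
      \<le> ?c * (\<Sum>u=1..k. ennreal (1 + 8 * \<delta>))"
    by (intro mult_left_mono sum_mono) auto
  then have le: "?c * (\<Sum>u=1..k. \<integral>\<^sup>+y. ?G y \<partial>?P u) + ?c * (\<Sum>u=1..k. \<integral>\<^sup>+y. ?h y \<partial>?P u) * ennreal (1/6)
      \<le> ennreal (1 + 8 * \<delta>)"
    by (simp only: inverse_k_times sum.distrib distrib_left sum_distrib_right[symmetric] mult.assoc)
  have "ennreal (d / 6) = ennreal d * ennreal (1/6)" using d(1) by (simp add: ennreal_mult[symmetric])
  also have "\<dots> \<le> ?c * (\<Sum>u=1..k. \<integral>\<^sup>+y. ?h y \<partial>?P u) * ennreal (1/6)"
    using d(2) nn_integral_minorant_le[OF q(1) x m(2)]
    by (intro mult_right_mono) (auto simp: semi_dist_sq_def)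
  finally have *: "?c * (\<Sum>u=1..k. \<integral>\<^sup>+y. ?G y \<partial>?P u) + ennreal (d / 6) \<le> ennreal (1 + 8 * \<delta>)"
    using le by (meson add_left_mono order_trans)
  \<comment> \<open>The inequality itself forces \<open>A\<close> to be finite; only then can
    \<open>d / 6\<close> be moved to the other side.\<close>
  have "A \<le> ennreal (exp (8 * \<delta> - d / 6))" if "A + ennreal (d / 6) \<le> ennreal (1 + 8 * \<delta>)" for A
  proof (cases A)
    case (real r)
    then have "r + d / 6 \<le> 1 + 8 * \<delta>"
      using that d(1) \<delta>(1) by (simp add: ennreal_plus[symmetric] del: ennreal_plus)
    moreover have "1 + (8 * \<delta> - d / 6) \<le> exp (8 * \<delta> - d / 6)" by (rule exp_ge_add_one_self)
    ultimately have "r \<le> exp (8 * \<delta> - d / 6)" by linarith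
    then show ?thesis using real by (simp add: ennreal_leI)
  next
    case top
    then show ?thesis using that by (simp add: top_unique)
  qed
  from this[OF *] show ?thesis by (simp only: nn_integral_kernel_pow[OF q(1) x m(1)])
qed

abbreviation block_length :: nat where
  "block_length \<equiv> k + l + 1"

lemma nn_integral_test_score_history_law_le:
  assumes q: "q \<in> space \<QQ>" "qa \<in> space \<QQ>" "qb \<in> space \<QQ>" and n: "N * block_length \<le> n"
    and d: "0 \<le> d" "ennreal d \<le> semi_dist_sq \<nu> \<nu>s qa qb"
    and \<delta>: "0 \<le> \<delta>" "semi_dist_sq \<nu> \<eta>s q qb \<le> ennreal \<delta>"
  shows "(\<integral>\<^sup>+h. ennreal (test_score k l qa qb N h) \<partial>history_law E (Pr q) J S n)
    \<le> ennreal (exp (- real N * (d / 6 - 8 * \<delta>)))"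
proof -
  have m: "(\<lambda>h. ennreal (test_score k l qa qb N h)) \<in> borel_measurable (history_space E n)"
    using measurable_test_score[OF q(2,3) n] by measurable
  have "(\<integral>\<^sup>+h. ennreal (test_score k l qa qb N h) \<partial>history_law E (Pr q) J S n)
     = (\<integral>\<^sup>+\<omega>. ennreal (test_score k l qa qb N (history J S n \<omega>)) \<partial>Pr q)"
    unfolding history_law_def using m by (subst nn_integral_distr[OF measurable_history[OF q(1)]]) simp_all
  also have "\<dots> = (\<integral>\<^sup>+\<omega>. ennreal (test_score k l qa qb N (history J S (N * block_length) \<omega>)) \<partial>Pr q)"
    by (simp only: test_score_history[OF n])
  also have "\<dots> \<le> ennreal (exp (8 * \<delta> - d / 6)) ^ N"
    by (rule nn_integral_test_score_le[OF q k_ge_1 block_mean_le[OF q _ d \<delta>]])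
  also have "\<dots> = ennreal (exp (- real N * (d / 6 - 8 * \<delta>)))"
    by (simp add: ennreal_power exp_of_nat_mult[symmetric] algebra_simps)
  finally show ?thesis .
qed

section \<open>The tests and their error probabilities\<close>

definition rejection_region :: "nat \<Rightarrow> 'e kernel_density \<Rightarrow> 'e kernel_density \<Rightarrow> 'e history set" where
  "rejection_region n q0 q1 =
     {h \<in> space (history_space E n). 1 \<le> test_score k l q1 q0 (n div block_length) h}"

lemma sets_rejection_region:
  assumes "q0 \<in> space \<QQ>" "q1 \<in> space \<QQ>"
  shows "rejection_region n q0 q1 \<in> sets (history_space E n)"
proof -
  have [measurable]: "test_score k l q1 q0 (n div block_length) \<in> borel_measurable (history_space E n)"
    using assms by (intro measurable_test_score) (simp_all add: div_times_less_eq_dividend del: mult_Suc_right)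
  show ?thesis unfolding rejection_region_def by measurable
qed

text \<open>Markov's inequality for the score whose second argument is the true density
  \<open>q0\<close> itself, so the approximation error \<delta> is 0.\<close>

lemma type_I_error:
  assumes q: "q0 \<in> space \<QQ>" "q1 \<in> space \<QQ>"
    and d: "0 \<le> d" "ennreal d \<le> semi_dist_sq \<nu> \<nu>s q0 q1"
  shows "emeasure (history_law E (Pr q0) J S n) (rejection_region n q0 q1)
    \<le> ennreal (exp (- real (n div block_length) * (d / 6)))"
proof -
  let ?L = "history_law E (Pr q0) J S n" and ?N = "n div block_length"
  have "emeasure ?L (rejection_region n q0 q1) = (\<integral>\<^sup>+h. indicator (rejection_region n q0 q1) h \<partial>?L)"
    using sets_rejection_region[OF q] by (simp add: sets_history_law)
  also have "\<dots> \<le> (\<integral>\<^sup>+h. ennreal (test_score k l q1 q0 ?N h) \<partial>?L)"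
    by (intro nn_integral_mono) (auto simp: indicator_def rejection_region_def)
  also have "\<dots> \<le> ennreal (exp (- real ?N * (d / 6 - 8 * 0)))"
    using d by (intro nn_integral_test_score_history_law_le q)
      (simp_all add: semi_dist_sq_self semi_dist_sq_commute div_times_less_eq_dividend del: mult_Suc_right)
  finally show ?thesis by simp
qed

text \<open>Acceptance means that the score of \<open>q1\<close> against \<open>q0\<close> is below
  1, hence the exchanged score is at least 1. The latter has the centre \<open>q1\<close> as its
  second argument, and \<open>q\<close> is within the \<delta>-bound of it.\<close>

lemma type_II_error:
  assumes q: "q0 \<in> space \<QQ>" "q1 \<in> space \<QQ>" "q \<in> space \<QQ>"
    and d: "0 \<le> d" "ennreal d \<le> semi_dist_sq \<nu> \<nu>s q0 q1"
    and \<delta>: "0 \<le> \<delta>" "semi_dist_sq \<nu> \<eta>s q q1 \<le> ennreal \<delta>"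
  shows "emeasure (history_law E (Pr q) J S n) (space (history_space E n) - rejection_region n q0 q1)
    \<le> ennreal (exp (- real (n div block_length) * (d / 6 - 8 * \<delta>)))"
proof -
  let ?L = "history_law E (Pr q) J S n" and ?N = "n div block_length"
  let ?A = "space (history_space E n) - rejection_region n q0 q1"
  have N: "?N * block_length \<le> n" by (rule div_times_less_eq_dividend)
  have "emeasure ?L ?A = (\<integral>\<^sup>+h. indicator ?A h \<partial>?L)"
    using sets_rejection_region[OF q(1,2), of n] by (subst nn_integral_indicator) (auto simp: sets_history_law)
  also have "\<dots> \<le> (\<integral>\<^sup>+h. ennreal (test_score k l q0 q1 ?N h) \<partial>?L)"
  proof (rule nn_integral_mono)
    fix h
    show "indicator ?A h \<le> ennreal (test_score k l q0 q1 ?N h)"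
    proof (cases "h \<in> ?A")
      case True
      then have h: "h \<in> space (history_space E n)" and lt: "test_score k l q1 q0 ?N h < 1"
        by (auto simp: rejection_region_def)
      have "1 \<le> test_score k l q0 q1 ?N h * test_score k l q1 q0 ?N h"
        by (rule test_score_mult_ge_1[OF q(1,2) h k_ge_1 N])
      also have "\<dots> \<le> test_score k l q0 q1 ?N h * 1"
        using test_score_pos[OF q(1,2) h k_ge_1 N] lt by (intro mult_left_mono) auto
      finally show ?thesis using True by simp
    qed simp
  qed
  also have "\<dots> \<le> ennreal (exp (- real ?N * (d / 6 - 8 * \<delta>)))"
    by (rule nn_integral_test_score_history_law_le[OF q(3,1,2) N d \<delta>])
  finally show ?thesis .
qed

end

subsection \<open>The posterior\<close>

text \<open>An excess of \<open>x\<close> over the upper bound \<open>a\<close> for the mean is at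
  most its excess over the mean itself; a mean of minus infinity or an infinite \<open>x\<close>
  makes the difference infinite.\<close>

lemma ereal_square_diff_ge:
  fixes x \<mu> :: ereal
  assumes "\<mu> \<le> ereal a" "ereal (2 * a) < x" "0 \<le> a"
  shows "ennreal (a\<^sup>2) \<le> e2ennreal ((x - \<mu>)\<^sup>2)"
proof -
  have le: "ereal a \<le> x - \<mu>" using assms by (cases x; cases \<mu>) auto
  have "ereal a * ereal a \<le> (x - \<mu>) * (x - \<mu>)"
    using assms(3) le by (intro ereal_mult_mono') auto
  then have "ereal (a\<^sup>2) \<le> (x - \<mu>)\<^sup>2" by (simp add: power2_eq_square)
  then have "e2ennreal (ereal (a\<^sup>2)) \<le> e2ennreal ((x - \<mu>)\<^sup>2)" by (rule e2ennreal_mono)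
  then show ?thesis by simp
qed

lemma ennreal_half_le:
  assumes eq: "ennreal b = x + y" and x: "x < ennreal (b / 2)"
  shows "ennreal (b / 2) \<le> y"
proof (cases y)
  case (real s)
  obtain r where r: "x = ennreal r" "0 \<le> r" using x by (cases x) auto
  then have "r < b / 2" using x by (simp add: ennreal_less_iff)
  moreover from this have "b = r + s"
    using eq r real by (simp add: ennreal_plus[symmetric] del: ennreal_plus)
  ultimately show ?thesis using real by (simp add: ennreal_leI)
qed simp

text \<open>Applied with \<open>D\<close> the evidence and \<open>y\<close> the likelihood at
  \<open>q0\<close>. An infinite \<open>D\<close> is harmless, as its inverse is 0.\<close>

lemma divide_le_of_mult_le:
  fixes A D y :: ennreal
  assumes y: "0 < y" "y < \<infinity>" and \<kappa>: "0 < \<kappa>" and le: "ennreal \<kappa> * y \<le> D"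
  shows "A / D \<le> ennreal (1 / \<kappa>) * (A / y)"
proof -
  have "inverse D \<le> ennreal (1 / \<kappa>) * inverse y"
  proof (cases D)
    case (real d)
    obtain r where r: "y = ennreal r" "0 < r" using y by (cases y) auto
    have d: "\<kappa> * r \<le> d" using le real r \<kappa> by (simp add: ennreal_mult[symmetric])
    then have "0 < d" using \<kappa> r by (metis less_le_trans mult_pos_pos)
    have "inverse d \<le> inverse (\<kappa> * r)" using d \<kappa> r by (intro le_imp_inverse_le) auto
    then show ?thesis
      using real r \<kappa> \<open>0 < d\<close> by (simp add: inverse_ennreal ennreal_mult[symmetric] inverse_eq_divide)
  qed simp
  then have "A * inverse D \<le> A * (ennreal (1 / \<kappa>) * inverse y)" by (rule mult_left_mono) simp
  then show ?thesis by (simp add: divide_ennreal_def mult.left_commute)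
qed

context semi_markov_model
begin

section \<open>Lower bound on the evidence\<close>

definition low_likelihood :: "nat \<Rightarrow> real \<Rightarrow> 'e kernel_density \<Rightarrow> 'e kernel_density \<Rightarrow> 'e history set" where
  "low_likelihood n a q0 q =
     {h \<in> space (history_space E n). \<not> likelihood \<rho> n q0 h \<le> ennreal (exp (2 * a)) * likelihood \<rho> n q h}"

lemma sets_low_likelihood:
  assumes "q0 \<in> space \<QQ>" "q \<in> space \<QQ>"
  shows "low_likelihood n a q0 q \<in> sets (history_space E n)"
proof -
  note [measurable] = measurable_likelihood[OF assms(1), of n] measurable_likelihood[OF assms(2), of n]
  show ?thesis unfolding low_likelihood_def by measurable
qed

text \<open>Chebyshev: of the threshold \<open>2 * a\<close> one \<open>a\<close> is the bound on
  the mean and the other is the deviation, so a variance of at most \<open>a\<close> divided by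
  \<open>a\<^sup>2\<close> gives \<open>1 / a\<close>.\<close>

lemma emeasure_low_likelihood_le:
  assumes q0: "q0 \<in> space \<QQ>" and a: "0 < a"
    and q: "q \<in> KL_neighbourhood (space \<QQ>) \<rho> n (history_law E (Pr q0) J S n) q0 r"
    and a_eq: "a = real n * r\<^sup>2"
  shows "emeasure (history_law E (Pr q0) J S n) (low_likelihood n a q0 q) \<le> ennreal (1 / a)"
proof -
  let ?P = "history_law E (Pr q0) J S n" and ?B = "low_likelihood n a q0 q"
  let ?f = "log_likelihood_ratio \<rho> n q0 q"
  let ?g = "\<lambda>h. e2ennreal ((?f h - ext_expectation ?P ?f)\<^sup>2)"
  have qQ: "q \<in> space \<QQ>" and K: "ext_expectation ?P ?f \<le> ereal a" and V: "ext_variance ?P ?f \<le> ereal a"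
    using q by (auto simp: KL_neighbourhood_def a_eq)
  have B: "?B \<in> sets ?P" using sets_low_likelihood[OF q0 qQ] by (simp add: sets_history_law)
  have "enn2ereal (\<integral>\<^sup>+h. ?g h \<partial>?P) \<le> enn2ereal (ennreal a)"
    using V a by (simp add: ext_variance_def)
  then have V': "(\<integral>\<^sup>+h. ?g h \<partial>?P) \<le> ennreal a" by (simp add: less_eq_ennreal.rep_eq)
  have "ennreal (a\<^sup>2) * emeasure ?P ?B = (\<integral>\<^sup>+h. ennreal (a\<^sup>2) * indicator ?B h \<partial>?P)"
    using B by (simp add: nn_integral_cmult_indicator)
  also have "\<dots> \<le> (\<integral>\<^sup>+h. ?g h \<partial>?P)"
  proof (rule nn_integral_mono_AE)
    show "AE h in ?P. ennreal (a\<^sup>2) * indicator ?B h \<le> ?g h"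
      using AE_likelihood_pos_finite[OF q0, of n]
    proof eventually_elim
      case (elim h)
      show ?case
      proof (cases "h \<in> ?B")
        case True
        let ?x = "likelihood \<rho> n q0 h" and ?y = "likelihood \<rho> n q h"
        have lt: "ennreal (exp (2 * a)) * ?y < ?x" using True by (simp add: low_likelihood_def not_le)
        have "\<not> ?x / ?y \<le> ennreal (exp (2 * a))"
        proof
          assume le: "?x / ?y \<le> ennreal (exp (2 * a))"
          have "?y < \<infinity>"
            using lt elim by (cases ?y) (auto simp: ennreal_mult_top)
          moreover have "?x \<noteq> 0" using elim by auto
          then have "?y \<noteq> 0" using le by (auto simp: top_unique)
          ultimately have "?y / ?y = 1" by (intro ennreal_divide_self) (auto simp: less_top)
          then have "?x = ?x / ?y * ?y" by (simp add: ennreal_divide_times)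
          also have "\<dots> \<le> ennreal (exp (2 * a)) * ?y" using le by (rule mult_right_mono) simp
          finally show False using lt by simp
        qed
        then have "ereal (2 * a) < ?f h"
          using ln_ennreal_le_iff[of "?x / ?y" "2 * a"] by (simp add: log_likelihood_ratio_def)
        then show ?thesis using ereal_square_diff_ge[OF K] a True by simp
      qed simp
    qed
  qed
  also have "\<dots> \<le> ennreal a" by (rule V')
  finally have "ennreal (1 / a\<^sup>2) * (ennreal (a\<^sup>2) * emeasure ?P ?B) \<le> ennreal (1 / a\<^sup>2) * ennreal a"
    by (rule mult_left_mono) simp
  moreover have "ennreal (1 / a\<^sup>2) * ennreal (a\<^sup>2) = 1" "ennreal (1 / a\<^sup>2) * ennreal a = ennreal (1 / a)"
    using a by (simp_all add: ennreal_mult[symmetric] power2_eq_square)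
  ultimately show ?thesis by (simp add: mult.assoc[symmetric])
qed

text \<open>Markov's inequality is applied to the prior mass of those parameters of the neighbourhood whose
  likelihood is too low: outside of a small event they make up at most half of it.\<close>

lemma evidence_lower_bound:
  assumes q0: "q0 \<in> space \<QQ>" and \<pi>: "prob_space \<pi>" "sets \<pi> = sets \<QQ>"
    and U: "U \<in> sets \<QQ>" and b: "emeasure \<pi> U = ennreal b" "0 < b" and a: "0 < a"
    and low: "\<And>q. q \<in> U \<Longrightarrow>
      emeasure (history_law E (Pr q0) J S n) (low_likelihood n a q0 q) \<le> ennreal (1 / a)"
  obtains B where "B \<in> sets (history_space E n)"
    and "emeasure (history_law E (Pr q0) J S n) B \<le> ennreal (2 / a)"
    and "\<And>h. h \<in> space (history_space E n) - B \<Longrightarrow>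
      ennreal (exp (- 2 * a) * b / 2) * likelihood \<rho> n q0 h \<le> (\<integral>\<^sup>+q. likelihood \<rho> n q h \<partial>\<pi>)"
proof -
  let ?P = "history_law E (Pr q0) J S n" and ?H = "history_space E n"
  interpret p: prob_space \<pi> by (rule \<pi>)
  interpret P: prob_space ?P by (rule prob_space_history_law[OF q0])
  interpret pair_sigma_finite ?P \<pi> ..
  have UQ: "U \<subseteq> space \<QQ>" using U by (rule sets.sets_into_space)
  have U': "U \<in> sets \<pi>" using U \<pi>(2) by simp
  have mP: "measurable (?P \<Otimes>\<^sub>M \<pi>) N = measurable (?H \<Otimes>\<^sub>M \<QQ>) N" for N
    by (rule measurable_cong_sets[OF sets_pair_measure_cong[OF sets_history_law \<pi>(2)] refl])
  have mPi: "measurable \<pi> N = measurable \<QQ> N" for N by (rule measurable_cong_sets[OF \<pi>(2) refl])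
  let ?low = "\<lambda>h q. indicator U q * indicator (low_likelihood n a q0 q) h :: ennreal"
  let ?\<phi> = "\<lambda>h. \<integral>\<^sup>+q. ?low h q \<partial>\<pi>"
  \<comment> \<open>Fubini needs the exceptional sets to be measurable jointly in history and
    parameter. Through the initial density this rests on measurability of the stationary law in the
    parameter.\<close>
  have joint: "(\<lambda>(h, q). ?low h q) \<in> borel_measurable (?H \<Otimes>\<^sub>M \<QQ>)"
  proof -
    have [measurable]: "(\<lambda>w. likelihood \<rho> n q0 (fst w)) \<in> borel_measurable (?H \<Otimes>\<^sub>M \<QQ>)"
      "(\<lambda>w. likelihood \<rho> n (snd w) (fst w)) \<in> borel_measurable (?H \<Otimes>\<^sub>M \<QQ>)"
      using q0 by (auto intro!: measurable_likelihood_param)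
    have [measurable]: "U \<in> sets \<QQ>" by (rule U)
    let ?X = "{w \<in> space (?H \<Otimes>\<^sub>M \<QQ>).
      \<not> likelihood \<rho> n q0 (fst w) \<le> ennreal (exp (2 * a)) * likelihood \<rho> n (snd w) (fst w)}"
    have X: "?X \<in> sets (?H \<Otimes>\<^sub>M \<QQ>)" by measurable
    have "(\<lambda>w. indicator U (snd w) * indicator ?X w :: ennreal) \<in> borel_measurable (?H \<Otimes>\<^sub>M \<QQ>)"
      using X by (intro borel_measurable_times_ennreal borel_measurable_indicator) (measurable)
    then show ?thesis
      by (rule measurable_cong[THEN iffD1, rotated])
        (auto simp: low_likelihood_def indicator_def space_pair_measure)
  qed
  have sec: "(\<lambda>q. ?low h q) \<in> borel_measurable \<QQ>" if "h \<in> space ?H" for h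
    using measurable_compose[OF measurable_Pair1'[OF that] joint] by simp
  have \<phi>: "?\<phi> \<in> borel_measurable ?H"
    using joint by (intro p.borel_measurable_nn_integral)
      (simp add: measurable_cong_sets[OF sets_pair_measure_cong[OF refl \<pi>(2)] refl])
  have "(\<integral>\<^sup>+h. ?\<phi> h \<partial>?P) = (\<integral>\<^sup>+q. \<integral>\<^sup>+h. ?low h q \<partial>?P \<partial>\<pi>)"
    by (rule Fubini'[symmetric]) (simp add: mP joint)
  also have "\<dots> \<le> (\<integral>\<^sup>+q. ennreal (1 / a) * indicator U q \<partial>\<pi>)"
  proof (rule nn_integral_mono)
    fix q
    show "(\<integral>\<^sup>+h. ?low h q \<partial>?P) \<le> ennreal (1 / a) * indicator U q"
    proof (cases "q \<in> U")
      case True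
      then show ?thesis
        using low[OF True] sets_low_likelihood[OF q0, of q n a] UQ by (auto simp: sets_history_law)
    qed simp
  qed
  also have "\<dots> = ennreal (1 / a) * ennreal b" using U' b by (simp add: nn_integral_cmult_indicator)
  finally have int: "(\<integral>\<^sup>+h. ?\<phi> h \<partial>?P) \<le> ennreal (1 / a) * ennreal b" .
  define B where "B = {h \<in> space ?H. ennreal (b / 2) \<le> ?\<phi> h}"
  have B: "B \<in> sets ?H" unfolding B_def using \<phi> by measurable
  have "ennreal (b / 2) * emeasure ?P B = (\<integral>\<^sup>+h. ennreal (b / 2) * indicator B h \<partial>?P)"
    using B by (simp add: nn_integral_cmult_indicator sets_history_law)
  also have "\<dots> \<le> (\<integral>\<^sup>+h. ?\<phi> h \<partial>?P)" by (intro nn_integral_mono) (auto simp: B_def indicator_def)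
  also note int
  finally have "ennreal (2 / b) * (ennreal (b / 2) * emeasure ?P B) \<le> ennreal (2 / b) * (ennreal (1 / a) * ennreal b)"
    by (rule mult_left_mono) simp
  moreover have "ennreal (2 / b) * ennreal (b / 2) = 1" "ennreal (2 / b) * (ennreal (1 / a) * ennreal b) = ennreal (2 / a)"
    using a b(2) by (simp_all add: ennreal_mult[symmetric])
  ultimately have PB: "emeasure ?P B \<le> ennreal (2 / a)" by (simp add: mult.assoc[symmetric])
  show ?thesis
  proof (rule that[OF B PB])
    fix h assume "h \<in> space ?H - B"
    then have h: "h \<in> space ?H" and lt: "?\<phi> h < ennreal (b / 2)" by (auto simp: B_def)
    let ?good = "\<lambda>q. indicator U q * (1 - indicator (low_likelihood n a q0 q) h) :: ennreal"
    have good: "?good q = indicator U q - ?low h q" for q by (auto simp: indicator_def)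
    have gm: "?good \<in> borel_measurable \<pi>"
      unfolding good mPi using sec[OF h] U by (intro borel_measurable_minus_ennreal) auto
    have "ennreal b = (\<integral>\<^sup>+q. indicator U q \<partial>\<pi>)" using U' b by simp
    also have "\<dots> = (\<integral>\<^sup>+q. ?low h q + ?good q \<partial>\<pi>)"
      by (intro nn_integral_cong) (simp split: split_indicator)
    also have "\<dots> = ?\<phi> h + (\<integral>\<^sup>+q. ?good q \<partial>\<pi>)"
      using gm sec[OF h] by (intro nn_integral_add) (simp_all add: mPi)
    finally have eq: "ennreal b = ?\<phi> h + (\<integral>\<^sup>+q. ?good q \<partial>\<pi>)" .
    have half: "ennreal (b / 2) \<le> (\<integral>\<^sup>+q. ?good q \<partial>\<pi>)"
      by (rule ennreal_half_le[OF eq lt])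
    have "ennreal (exp (- 2 * a) * b / 2) * likelihood \<rho> n q0 h
        = ennreal (exp (- 2 * a)) * likelihood \<rho> n q0 h * ennreal (b / 2)"
      using b(2) ennreal_mult[of "exp (- 2 * a)" "b / 2"] by (simp add: mult_ac)
    also have "\<dots> \<le> ennreal (exp (- 2 * a)) * likelihood \<rho> n q0 h * (\<integral>\<^sup>+q. ?good q \<partial>\<pi>)"
      using half by (rule mult_left_mono) simp
    also have "\<dots> = (\<integral>\<^sup>+q. ennreal (exp (- 2 * a)) * likelihood \<rho> n q0 h * ?good q \<partial>\<pi>)"
      using gm by (rule nn_integral_cmult[symmetric])
    also have "\<dots> \<le> (\<integral>\<^sup>+q. likelihood \<rho> n q h \<partial>\<pi>)"
    proof (rule nn_integral_mono)
      fix q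
      show "ennreal (exp (- 2 * a)) * likelihood \<rho> n q0 h * ?good q \<le> likelihood \<rho> n q h"
      proof (cases "q \<in> U \<and> h \<notin> low_likelihood n a q0 q")
        case True
        then have "likelihood \<rho> n q0 h \<le> ennreal (exp (2 * a)) * likelihood \<rho> n q h"
          using h by (simp add: low_likelihood_def)
        then have "ennreal (exp (- 2 * a)) * likelihood \<rho> n q0 h
            \<le> ennreal (exp (- 2 * a)) * (ennreal (exp (2 * a)) * likelihood \<rho> n q h)"
          by (rule mult_left_mono) simp
        also have "\<dots> = likelihood \<rho> n q h"
          unfolding mult.assoc[symmetric] by (simp add: ennreal_mult[symmetric] exp_add[symmetric])
        finally show ?thesis using True by simp
      qed (auto simp: indicator_def)
    qed
    finally show "ennreal (exp (- 2 * a) * b / 2) * likelihood \<rho> n q0 h \<le> (\<integral>\<^sup>+q. likelihood \<rho> n q h \<partial>\<pi>)" .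
  qed
qed

section \<open>Expected posterior mass of a set\<close>

lemma posterior_le_1: "posterior \<rho> n \<pi> h A \<le> 1"
proof -
  let ?D = "\<integral>\<^sup>+q. likelihood \<rho> n q h \<partial>\<pi>"
  have "(\<integral>\<^sup>+q\<in>A. likelihood \<rho> n q h \<partial>\<pi>) / ?D \<le> ?D / ?D"
    by (intro divide_right_mono_ennreal nn_integral_mono) (simp split: split_indicator)
  also have "\<dots> \<le> 1"
  \<comment> \<open>In both degenerate cases \<open>?D / ?D\<close> evaluates to 0, so the bound
    holds even when the evidence is 0 or infinite.\<close>
  proof (cases "?D = 0 \<or> ?D = \<infinity>")
    case False
    then have "?D / ?D = 1" by (intro ennreal_divide_self) (auto simp: less_top)
    then show ?thesis by simp
  qed (elim disjE; simp)
  finally show ?thesis by (simp add: posterior_def)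
qed

text \<open>On \<open>R\<close> and \<open>B\<close> the posterior is bounded by 1. Elsewhere the
  evidence is replaced by \<kappa> times the likelihood at \<open>q0\<close>; the numerator becomes
  an integral of likelihood ratios, and Fubini with the change of measure turns it into errors under
  \<open>q\<close>. Parameters outside \<open>Q'\<close>, where no power is guaranteed, are charged
  with their prior mass.\<close>

lemma nn_integral_posterior_le:
  assumes q0: "q0 \<in> space \<QQ>" and \<pi>: "prob_space \<pi>" "sets \<pi> = sets \<QQ>"
    and A: "A \<in> sets \<QQ>" and Q': "Q' \<in> sets \<QQ>"
    and R: "R \<in> sets (history_space E n)" and B: "B \<in> sets (history_space E n)" and \<kappa>: "0 < \<kappa>"
    and evidence: "\<And>h. h \<in> space (history_space E n) - B \<Longrightarrow>
      ennreal \<kappa> * likelihood \<rho> n q0 h \<le> (\<integral>\<^sup>+q. likelihood \<rho> n q h \<partial>\<pi>)"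
    and power: "\<And>q. q \<in> A \<inter> Q' \<Longrightarrow>
      emeasure (history_law E (Pr q) J S n) (space (history_space E n) - R) \<le> \<beta>"
  shows "(\<integral>\<^sup>+h. posterior \<rho> n \<pi> h A \<partial>history_law E (Pr q0) J S n)
    \<le> emeasure (history_law E (Pr q0) J S n) R + emeasure (history_law E (Pr q0) J S n) B
      + ennreal (1 / \<kappa>) * (\<beta> + emeasure \<pi> (space \<QQ> - Q'))"
proof -
  let ?P = "history_law E (Pr q0) J S n" and ?H = "history_space E n"
  let ?R' = "space ?H - R"
  interpret p: prob_space \<pi> by (rule \<pi>)
  interpret P: prob_space ?P by (rule prob_space_history_law[OF q0])
  interpret pair_sigma_finite ?P \<pi> ..
  have mPi: "measurable \<pi> N = measurable \<QQ> N" for N by (rule measurable_cong_sets[OF \<pi>(2) refl])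
  have mP: "measurable (?P \<Otimes>\<^sub>M \<pi>) N = measurable (?H \<Otimes>\<^sub>M \<QQ>) N" for N
    by (rule measurable_cong_sets[OF sets_pair_measure_cong[OF sets_history_law \<pi>(2)] refl])
  have R': "?R' \<in> sets ?H" using R by auto
  let ?f = "\<lambda>h q. indicator ?R' h * (likelihood \<rho> n q h / likelihood \<rho> n q0 h) * indicator A q"
  have [measurable]: "(\<lambda>w. likelihood \<rho> n q0 (fst w)) \<in> borel_measurable (?H \<Otimes>\<^sub>M \<QQ>)"
      "(\<lambda>w. likelihood \<rho> n (snd w) (fst w)) \<in> borel_measurable (?H \<Otimes>\<^sub>M \<QQ>)"
    using q0 by (auto intro!: measurable_likelihood_param)
  have [measurable]: "A \<in> sets \<QQ>" "?R' \<in> sets ?H" by (rule A, rule R')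
  have fm: "(\<lambda>(h, q). ?f h q) \<in> borel_measurable (?H \<Otimes>\<^sub>M \<QQ>)" unfolding split_beta by measurable
  have fi: "(\<lambda>h. \<integral>\<^sup>+q. ?f h q \<partial>\<pi>) \<in> borel_measurable ?H"
    using fm by (intro p.borel_measurable_nn_integral)
      (simp add: measurable_cong_sets[OF sets_pair_measure_cong[OF refl \<pi>(2)] refl])
  have "(\<integral>\<^sup>+h. posterior \<rho> n \<pi> h A \<partial>?P)
      \<le> (\<integral>\<^sup>+h. indicator R h + indicator B h + ennreal (1 / \<kappa>) * (\<integral>\<^sup>+q. ?f h q \<partial>\<pi>) \<partial>?P)"
  proof (rule nn_integral_mono_AE)
    show "AE h in ?P. posterior \<rho> n \<pi> h A
        \<le> indicator R h + indicator B h + ennreal (1 / \<kappa>) * (\<integral>\<^sup>+q. ?f h q \<partial>\<pi>)"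
      using AE_likelihood_pos_finite[OF q0, of n] AE_space
    proof eventually_elim
      case (elim h)
      then have h: "h \<in> space ?H" using sets_eq_imp_space_eq[OF sets_history_law] by blast
      show ?case
      proof (cases "h \<in> R \<or> h \<in> B")
        case True
        then have "1 \<le> (indicator R h + indicator B h :: ennreal)" by (auto simp: indicator_def)
        then show ?thesis using posterior_le_1 by (meson add_increasing2 order_trans zero_le)
      next
        case False
        let ?N = "\<integral>\<^sup>+q\<in>A. likelihood \<rho> n q h \<partial>\<pi>"
        have lm: "(\<lambda>q. likelihood \<rho> n q h * indicator A q) \<in> borel_measurable \<pi>"
          using measurable_likelihood_param[of "\<lambda>q. q" \<QQ> "\<lambda>_. h" n] h unfolding mPi by simp
        have "posterior \<rho> n \<pi> h A \<le> ennreal (1 / \<kappa>) * (?N / likelihood \<rho> n q0 h)"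
          unfolding posterior_def using elim False h
          by (intro divide_le_of_mult_le \<kappa> evidence) auto
        also have "?N / likelihood \<rho> n q0 h = (\<integral>\<^sup>+q. likelihood \<rho> n q h * indicator A q / likelihood \<rho> n q0 h \<partial>\<pi>)"
          using lm by (rule nn_integral_divide[symmetric])
        also have "\<dots> = (\<integral>\<^sup>+q. ?f h q \<partial>\<pi>)"
          using False h by (intro nn_integral_cong) (auto simp: indicator_def)
        finally show ?thesis using False by simp
      qed
    qed
  qed
  also have "\<dots> = emeasure ?P R + emeasure ?P B + ennreal (1 / \<kappa>) * (\<integral>\<^sup>+h. \<integral>\<^sup>+q. ?f h q \<partial>\<pi> \<partial>?P)"
    using R B fi by (simp add: nn_integral_add nn_integral_cmult sets_history_law)
  also have "(\<integral>\<^sup>+h. \<integral>\<^sup>+q. ?f h q \<partial>\<pi> \<partial>?P) = (\<integral>\<^sup>+q. \<integral>\<^sup>+h. ?f h q \<partial>?P \<partial>\<pi>)"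
    by (rule Fubini'[symmetric]) (simp add: mP fm)
  also have "\<dots> \<le> (\<integral>\<^sup>+q. \<beta> + indicator (space \<QQ> - Q') q \<partial>\<pi>)"
  proof (rule nn_integral_mono)
    fix q assume "q \<in> space \<pi>"
    then have q: "q \<in> space \<QQ>" using sets_eq_imp_space_eq[OF \<pi>(2)] by simp
    show "(\<integral>\<^sup>+h. ?f h q \<partial>?P) \<le> \<beta> + indicator (space \<QQ> - Q') q"
    proof (cases "q \<in> A")
      case True
      then have "(\<integral>\<^sup>+h. ?f h q \<partial>?P) = (\<integral>\<^sup>+h. indicator ?R' h * (likelihood \<rho> n q h / likelihood \<rho> n q0 h) \<partial>?P)"
        by simp
      also have "\<dots> \<le> (\<integral>\<^sup>+h. indicator ?R' h \<partial>history_law E (Pr q) J S n)"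
        using R' by (intro likelihood_ratio_change_of_measure[OF q0 q]) simp
      also have "\<dots> = emeasure (history_law E (Pr q) J S n) ?R'"
        using R' by (simp add: sets_history_law)
      finally have le: "(\<integral>\<^sup>+h. ?f h q \<partial>?P) \<le> emeasure (history_law E (Pr q) J S n) ?R'" .
      show ?thesis
      proof (cases "q \<in> Q'")
        case True
        with \<open>q \<in> A\<close> show ?thesis using order_trans[OF le power[of q]] by simp
      next
        case False
        have "emeasure (history_law E (Pr q) J S n) ?R' \<le> 1"
          by (rule prob_space.emeasure_le_1[OF prob_space_history_law[OF q]])
        with le have "(\<integral>\<^sup>+h. ?f h q \<partial>?P) \<le> 1" by (rule order_trans)
        then show ?thesis using False q by (simp add: add_increasing)
      qed
    qed simp
  qed
  also have "\<dots> = \<beta> + emeasure \<pi> (space \<QQ> - Q')"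
    using Q' \<pi>(2) sets.compl_sets[OF Q'] by (subst nn_integral_add) (simp_all add: p.emeasure_space_1)
  finally show ?thesis by (simp add: mult_left_mono add_left_mono)
qed

end

subsection \<open>Entropy and the rate of contraction\<close>

text \<open>Without any finite cover the infimum is \<infinity>, whose logarithm exceeds every real
  bound; otherwise the infimum of cardinalities is attained.\<close>

lemma finite_cover_of_covering_number_le:
  assumes "ln_ennreal (ennreal_of_enat (covering_number X r A d)) \<le> ereal a"
  obtains C where "finite C" "C \<subseteq> X" "A \<subseteq> (\<Union>c\<in>C. closed_ball X d c r)" "real (card C) \<le> exp a"
proof -
  let ?S = "{enat (card C) | C. finite C \<and> C \<subseteq> X \<and> A \<subseteq> (\<Union>c\<in>C. closed_ball X d c r)}"
  have le: "ennreal_of_enat (covering_number X r A d) \<le> ennreal (exp a)"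
    using assms by (simp add: ln_ennreal_le_iff)
  have "?S \<noteq> {}"
  proof
    assume "?S = {}"
    then have "covering_number X r A d = \<infinity>" unfolding covering_number_def Inf_enat_def by (simp only: refl if_True)
    then show False using le by (simp add: top_unique)
  qed
  then have "covering_number X r A d \<in> ?S"
    unfolding covering_number_def Inf_enat_def by (auto intro: LeastI)
  then obtain C where C: "covering_number X r A d = enat (card C)" "finite C" "C \<subseteq> X"
    "A \<subseteq> (\<Union>c\<in>C. closed_ball X d c r)" by auto
  then have "ennreal (real (card C)) \<le> ennreal (exp a)"
    using le by (simp add: ennreal_of_nat_eq_real_of_nat)
  then show ?thesis using that C by simp
qed

text \<open>Numbering starts at 2 in the outer radius because \<open>t\<close> lies beyond
  \<open>s\<close>; then the inner radius is at least half of the outer one. Taking the ceiling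
  includes the outer endpoint, in accordance with closed balls.\<close>

lemma obtain_shell:
  fixes s t :: real
  assumes "0 < s" "s < t"
  obtains j :: nat where "(real j + 1) * s < t" "t \<le> (real j + 2) * s"
proof -
  define m where "m = nat \<lceil>t / s\<rceil>"
  have "1 < t / s" using assms by simp
  then have m: "real m = of_int \<lceil>t / s\<rceil>" "2 \<le> m" by (simp_all add: m_def) linarith
  then have "real (m - 2) + 1 < t / s" "t / s \<le> real (m - 2) + 2"
    using le_of_int_ceiling[of "t / s"] of_int_ceiling_diff_one_le[of "t / s"] ceiling_correct[of "t / s"]
    by (simp_all add: of_nat_diff)
  then show ?thesis using that[of "m - 2"] assms(1) by (simp add: field_simps)
qed

text \<open>Discarding an incomplete block costs at most a factor 2; with the 100 in the error
  bounds it yields the 200 in the condition on \<open>M\<close>.\<close>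

lemma div_ge_half:
  fixes n m :: nat
  assumes "0 < m" "m \<le> n"
  shows "real n / (2 * real m) \<le> real (n div m)"
proof -
  have "1 \<le> n div m" using assms by (metis One_nat_def Suc_leI div_greater_zero_iff)
  then have "m \<le> (n div m) * m" by simp
  moreover have "n = (n div m) * m + n mod m" by simp
  moreover have "n mod m < m" using assms(1) by simp
  ultimately have "n \<le> 2 * ((n div m) * m)" by linarith
  then have "real n \<le> real (2 * ((n div m) * m))" by (simp only: of_nat_le_iff)
  then show ?thesis using assms(1) by (simp add: field_simps)
qed

text \<open>With \<open>r\<close> the outer radius of a shell, \<open>D\<close> is the squared
  distance from \<open>q0\<close> to a point of the shell and \<open>y\<close> that from the point
  to its centre, at most (r/40)^2. The doubled triangle inequality leaves r^2/8 - r^2/1600 for the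
  centre.\<close>

lemma ennreal_separation:
  assumes "ennreal (r\<^sup>2 / 4) \<le> D" "D \<le> ennreal 2 * x + ennreal 2 * y" "y \<le> ennreal (r\<^sup>2 / 1600)"
  shows "ennreal (199 / 1600 * r\<^sup>2) \<le> x"
proof (cases x)
  case (real u)
  have "ennreal (r\<^sup>2 / 4) \<le> ennreal 2 * ennreal u + ennreal 2 * ennreal (r\<^sup>2 / 1600)"
    using assms real by (meson add_left_mono mult_left_mono order_trans zero_le)
  then have "r\<^sup>2 / 4 \<le> 2 * u + 2 * (r\<^sup>2 / 1600)"
    using real by (simp add: ennreal_mult[symmetric] ennreal_plus[symmetric] del: ennreal_plus ennreal_numeral)
  then have "199 / 1600 * r\<^sup>2 \<le> u" by linarith
  then show ?thesis using real by (simp add: ennreal_leI)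
qed simp

context sandwiched_semi_markov_model
begin

text \<open>A point \<open>q\<close> of the shell transfers its separation to the centre
  \<open>q1\<close>. The exponents per block are 199/9600 and 199/9600 - 8/1600 = 151/9600 times
  \<open>r\<^sup>2\<close>; both are rounded down to 1/100.\<close>

lemma separated_rejection_region:
  assumes q: "q0 \<in> space \<QQ>" "q1 \<in> space \<QQ>" "q \<in> space \<QQ>"
    and far: "ennreal (r\<^sup>2 / 4) \<le> semi_dist_sq \<nu> \<nu>s q0 q"
    and near: "semi_dist_sq \<nu> \<eta>s q1 q \<le> ennreal (r\<^sup>2 / 1600)"
  shows "emeasure (history_law E (Pr q0) J S n) (rejection_region n q0 q1)
      \<le> ennreal (exp (- real (n div block_length) * (r\<^sup>2 / 100)))"
    and "emeasure (history_law E (Pr q) J S n) (space (history_space E n) - rejection_region n q0 q1)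
      \<le> ennreal (exp (- real (n div block_length) * (r\<^sup>2 / 100)))"
proof -
  have "semi_dist_sq \<nu> \<nu>s q1 q \<le> ennreal (r\<^sup>2 / 1600)"
    using semi_dist_sq_minorant_le_majorant[OF q(2,3)] near by (rule order_trans)
  then have d: "ennreal (199 / 1600 * r\<^sup>2) \<le> semi_dist_sq \<nu> \<nu>s q0 q1"
    by (rule ennreal_separation[OF far semi_dist_sq_triangle[OF q sets_minorant]])
  have N: "0 \<le> real (n div block_length)" and r: "0 \<le> r\<^sup>2" by simp_all
  have "emeasure (history_law E (Pr q0) J S n) (rejection_region n q0 q1)
      \<le> ennreal (exp (- real (n div block_length) * (199 / 1600 * r\<^sup>2 / 6)))"
    using d by (intro type_I_error q) simp_all
  also have "\<dots> \<le> ennreal (exp (- real (n div block_length) * (r\<^sup>2 / 100)))"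
    using mult_left_mono[of "r\<^sup>2 / 100" "199 / 1600 * r\<^sup>2 / 6", OF _ N] r by (intro ennreal_leI) simp
  finally show "emeasure (history_law E (Pr q0) J S n) (rejection_region n q0 q1)
      \<le> ennreal (exp (- real (n div block_length) * (r\<^sup>2 / 100)))" .
  have "emeasure (history_law E (Pr q) J S n) (space (history_space E n) - rejection_region n q0 q1)
      \<le> ennreal (exp (- real (n div block_length) * (199 / 1600 * r\<^sup>2 / 6 - 8 * (r\<^sup>2 / 1600))))"
    using d near by (intro type_II_error q) (simp_all add: semi_dist_sq_commute)
  also have "\<dots> \<le> ennreal (exp (- real (n div block_length) * (r\<^sup>2 / 100)))"
    using mult_left_mono[of "r\<^sup>2 / 100" "199 / 1600 * r\<^sup>2 / 6 - 8 * (r\<^sup>2 / 1600)", OF _ N] r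
    by (intro ennreal_leI) simp
  finally show "emeasure (history_law E (Pr q) J S n) (space (history_space E n) - rejection_region n q0 q1)
      \<le> ennreal (exp (- real (n div block_length) * (r\<^sup>2 / 100)))" .
qed

text \<open>The squared factor \<open>j + 2\<close> is weakened to a linear one, which suffices for
  a geometric series over the shells.\<close>

lemma shell_exponent_le:
  assumes n: "block_length \<le> n" and r: "r = (real j + 2) * (M * e)"
  shows "exp (- real (n div block_length) * (r\<^sup>2 / 100))
    \<le> exp (- (real j + 2) * (M\<^sup>2 / (200 * real block_length)) * (real n * e\<^sup>2))"
proof -
  have "(real j + 2) * (M\<^sup>2 / (200 * real block_length)) * (real n * e\<^sup>2)
      = real n / (2 * real block_length) * ((real j + 2) * (M * e)\<^sup>2 / 100)"
    by (simp add: power_mult_distrib)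
  also have "\<dots> \<le> real (n div block_length) * ((real j + 2) * (M * e)\<^sup>2 / 100)"
    by (rule mult_right_mono[OF div_ge_half[OF _ n]]) simp_all
  also have "\<dots> \<le> real (n div block_length) * (r\<^sup>2 / 100)"
  proof -
    have "(real j + 2) * 1 \<le> (real j + 2) * (real j + 2)" by (intro mult_left_mono) auto
    then have "(real j + 2) * (M * e)\<^sup>2 \<le> (real j + 2)\<^sup>2 * (M * e)\<^sup>2"
      by (intro mult_right_mono) (auto simp: power2_eq_square)
    then show ?thesis unfolding r power_mult_distrib[of "real j + 2" "M * e"]
      by (intro mult_left_mono divide_right_mono) auto
  qed
  finally show ?thesis by (simp only: exp_le_cancel_iff mult_minus_left neg_le_iff_le)
qed

lemma contraction_tests:
  assumes q0: "q0 \<in> space \<QQ>" and Qn: "Q' \<subseteq> space \<QQ>" and n: "block_length \<le> n" and e: "0 < e"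
    and entropy: "(SUP r\<in>{e<..}. ln_ennreal (ennreal_of_enat
        (covering_number (space \<QQ>) (r * (1/40)) (closed_ball Q' (semi_dist \<nu> \<nu>s) q0 r) (semi_dist \<nu> \<eta>s))))
        \<le> ereal (real n * e\<^sup>2)"
    and M: "1 \<le> M" and \<beta>: "1 \<le> M\<^sup>2 / (200 * real block_length)"
  obtains R where "R \<in> sets (history_space E n)"
    and "emeasure (history_law E (Pr q0) J S n) R
      \<le> ennreal (exp (- (real n * e\<^sup>2)) / (1 - exp (- (real n * e\<^sup>2))))"
    and "\<And>q. q \<in> Q' \<Longrightarrow> ennreal ((e * M)\<^sup>2) < semi_dist_sq \<nu> \<nu>s q0 q \<Longrightarrow>
      emeasure (history_law E (Pr q) J S n) (space (history_space E n) - R)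
      \<le> ennreal (exp (- (M\<^sup>2 / (200 * real block_length)) * (real n * e\<^sup>2)))"
proof -
  let ?P = "history_law E (Pr q0) J S n"
  define a where "a = real n * e\<^sup>2"
  define b where "b = M\<^sup>2 / (200 * real block_length)"
  define r where "r j = (real j + 2) * (M * e)" for j :: nat
  have n0: "0 < n" using n by simp
  have a0: "0 < a" using n0 e by (simp add: a_def)
  have s0: "0 < M * e" using M e by simp
  have r0: "0 < r j" for j using s0 by (simp add: r_def)
  \<comment> \<open>The entropy condition covers only radii strictly above \<open>e\<close>; the
    factor \<open>j + 2\<close> together with \<open>1 \<le> M\<close> guarantees this.\<close>
  have re: "e < r j" for j
  proof -
    have "e \<le> M * e" using M e by simp
    also have "\<dots> = 1 * (M * e)" by simp
    also have "\<dots> < (real j + 2) * (M * e)" using s0 by (intro mult_strict_right_mono) auto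
    finally show ?thesis by (simp add: r_def)
  qed
  have "\<exists>C. finite C \<and> C \<subseteq> space \<QQ> \<and> closed_ball Q' (semi_dist \<nu> \<nu>s) q0 (r j)
      \<subseteq> (\<Union>c\<in>C. closed_ball (space \<QQ>) (semi_dist \<nu> \<eta>s) c (r j * (1/40))) \<and> real (card C) \<le> exp a" for j
  proof -
    have "ln_ennreal (ennreal_of_enat (covering_number (space \<QQ>) (r j * (1/40))
        (closed_ball Q' (semi_dist \<nu> \<nu>s) q0 (r j)) (semi_dist \<nu> \<eta>s))) \<le> ereal a"
      using entropy re[of j] unfolding a_def SUP_le_iff by auto
    from finite_cover_of_covering_number_le[OF this] show ?thesis by metis
  qed
  then obtain C where C: "\<And>j. finite (C j)" "\<And>j. C j \<subseteq> space \<QQ>"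
    "\<And>j. closed_ball Q' (semi_dist \<nu> \<nu>s) q0 (r j)
      \<subseteq> (\<Union>c\<in>C j. closed_ball (space \<QQ>) (semi_dist \<nu> \<eta>s) c (r j * (1/40)))"
    "\<And>j. real (card (C j)) \<le> exp a" by metis
  \<comment> \<open>Centres range over the entire parameter space and may be close to
    \<open>q0\<close>. Only those near some parameter far from \<open>q0\<close> are kept, since
    from it they inherit the separation required for a small error under \<open>q0\<close>.\<close>
  define C' where "C' j = {c \<in> C j. \<exists>q\<in>space \<QQ>. ennreal ((r j)\<^sup>2 / 4) \<le> semi_dist_sq \<nu> \<nu>s q0 q \<and>
      semi_dist_sq \<nu> \<eta>s c q \<le> ennreal ((r j)\<^sup>2 / 1600)}" for j
  have C'_C: "C' j \<subseteq> C j" for j by (auto simp: C'_def)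
  have C'_Q: "c \<in> space \<QQ>" if "c \<in> C' j" for c j using that C'_C C(2) by blast
  have C'_fin: "finite (C' j)" for j using C'_C C(1) by (rule finite_subset)
  define R where "R = (\<Union>j. \<Union>c\<in>C' j. rejection_region n q0 c)"
  have Rj: "(\<Union>c\<in>C' j. rejection_region n q0 c) \<in> sets (history_space E n)" for j
    using C'_fin C'_Q sets_rejection_region[OF q0] by (intro sets.finite_UN) auto
  have "R \<in> sets (history_space E n)" unfolding R_def using Rj by (intro sets.countable_UN) auto
  moreover have "emeasure ?P R \<le> ennreal (exp (- a) / (1 - exp (- a)))"
  proof -
    have "emeasure ?P R \<le> (\<Sum>j. emeasure ?P (\<Union>c\<in>C' j. rejection_region n q0 c))"
      unfolding R_def using Rj by (intro emeasure_subadditive_countably) (auto simp: sets_history_law)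
    also have "\<dots> \<le> (\<Sum>j. ennreal (exp (- a) ^ Suc j))"
    proof (intro suminf_le allI)
      fix j
      have "emeasure ?P (\<Union>c\<in>C' j. rejection_region n q0 c) \<le> (\<Sum>c\<in>C' j. emeasure ?P (rejection_region n q0 c))"
        using C'_fin C'_Q sets_rejection_region[OF q0]
        by (intro emeasure_subadditive_finite) (auto simp: sets_history_law)
      also have "\<dots> \<le> (\<Sum>c\<in>C' j. ennreal (exp (- (real j + 2) * b * a)))"
      proof (rule sum_mono)
        fix c assume c: "c \<in> C' j"
        then obtain q where "q \<in> space \<QQ>" "ennreal ((r j)\<^sup>2 / 4) \<le> semi_dist_sq \<nu> \<nu>s q0 q"
          "semi_dist_sq \<nu> \<eta>s c q \<le> ennreal ((r j)\<^sup>2 / 1600)" by (auto simp: C'_def)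
        from separated_rejection_region(1)[OF q0 C'_Q[OF c] this]
        have "emeasure ?P (rejection_region n q0 c)
          \<le> ennreal (exp (- real (n div block_length) * ((r j)\<^sup>2 / 100)))" .
        also have "\<dots> \<le> ennreal (exp (- (real j + 2) * b * a))"
          unfolding a_def b_def by (rule ennreal_leI[OF shell_exponent_le[OF n r_def]])
        finally show "emeasure ?P (rejection_region n q0 c) \<le> ennreal (exp (- (real j + 2) * b * a))" .
      qed
      also have "\<dots> = ennreal (real (card (C' j)) * exp (- (real j + 2) * b * a))"
        by (simp add: ennreal_of_nat_eq_real_of_nat ennreal_mult)
      also have "\<dots> \<le> ennreal (exp a * exp (- (real j + 2) * b * a))"
      proof (intro ennreal_leI mult_right_mono)
        have "real (card (C' j)) \<le> real (card (C j))" using card_mono[OF C(1) C'_C] by simp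
        then show "real (card (C' j)) \<le> exp a" using C(4) by (rule order_trans)
      qed simp
      \<comment> \<open>The cover of a shell costs \<open>exp a\<close>, and each of its tests has
        error at most \<open>exp (- (j + 2) * a)\<close> because \<open>b\<close> is at least 1;
        what remains is the term of a geometric series.\<close>
      also have "\<dots> \<le> ennreal (exp (- a) ^ Suc j)"
      proof -
        have "(real j + 2) * 1 * a \<le> (real j + 2) * b * a"
          using \<beta> a0 by (intro mult_right_mono mult_left_mono) (auto simp: b_def)
        then have "a + - (real j + 2) * b * a \<le> real (Suc j) * (- a)" by (simp add: algebra_simps)
        then have "exp (a + - (real j + 2) * b * a) \<le> exp (real (Suc j) * (- a))" by simp
        then show ?thesis by (intro ennreal_leI) (simp only: exp_add exp_of_nat_mult)
      qed
      finally show "emeasure ?P (\<Union>c\<in>C' j. rejection_region n q0 c) \<le> ennreal (exp (- a) ^ Suc j)" .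
    qed simp_all
    also have "\<dots> = ennreal (\<Sum>j. exp (- a) ^ Suc j)"
      using a0 by (intro suminf_ennreal2) (simp_all add: summable_geometric summable_mult)
    also have "(\<Sum>j. exp (- a) ^ Suc j) = exp (- a) / (1 - exp (- a))"
      using a0 suminf_mult[OF summable_geometric[of "exp (- a)"], of "exp (- a)"]
      by (simp add: suminf_geometric)
    finally show ?thesis .
  qed
  moreover have "emeasure (history_law E (Pr q) J S n) (space (history_space E n) - R)
      \<le> ennreal (exp (- b * a))"
    if q: "q \<in> Q'" and far: "ennreal ((e * M)\<^sup>2) < semi_dist_sq \<nu> \<nu>s q0 q" for q
  proof -
    have qQ: "q \<in> space \<QQ>" using q Qn by blast
    obtain x where x: "semi_dist_sq \<nu> \<nu>s q0 q = ennreal x" "0 \<le> x"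
      using semi_dist_sq_minorant_le_1[OF q0 qQ] by (cases "semi_dist_sq \<nu> \<nu>s q0 q") (auto simp: top_unique)
    have "(M * e)\<^sup>2 < x" using far x by (simp add: ennreal_less_iff mult.commute)
    then have "M * e < sqrt x" using s0 by (intro real_less_rsqrt) auto
    then obtain j where j: "(real j + 1) * (M * e) < sqrt x" "sqrt x \<le> r j"
      using obtain_shell[OF s0] unfolding r_def by metis
    have upper: "x \<le> (r j)\<^sup>2" using j(2) by (rule sqrt_le_D)
    have lower: "(r j)\<^sup>2 / 4 \<le> x"
    proof -
      have "r j / 2 \<le> (real j + 1) * (M * e)" 
        using mult_right_mono[of "(real j + 2) / 2" "real j + 1" "M * e"] s0 by (simp add: r_def)
      then have "r j / 2 \<le> sqrt x" using j(1) by linarith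
      then have "(r j / 2)\<^sup>2 \<le> (sqrt x)\<^sup>2" using r0[of j] by (intro power_mono) auto
      then show ?thesis using x(2) by (simp add: power_divide)
    qed
    have "q \<in> closed_ball Q' (semi_dist \<nu> \<nu>s) q0 (r j)"
      using q x upper r0[of j] by (simp add: closed_ball_def semi_dist_le_iff less_imp_le ennreal_leI)
    then obtain c where c: "c \<in> C j" "semi_dist \<nu> \<eta>s c q \<le> ennreal (r j * (1/40))"
      using C(3)[of j] by (auto simp: closed_ball_def)
    then have near: "semi_dist_sq \<nu> \<eta>s c q \<le> ennreal ((r j)\<^sup>2 / 1600)"
      using r0[of j] by (subst (asm) semi_dist_le_iff) (simp_all add: power_mult_distrib power_divide)
    have far': "ennreal ((r j)\<^sup>2 / 4) \<le> semi_dist_sq \<nu> \<nu>s q0 q" using x lower by (simp add: ennreal_leI)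
    have c': "c \<in> C' j" using c near far' qQ by (auto simp: C'_def)
    have "emeasure (history_law E (Pr q) J S n) (space (history_space E n) - R)
        \<le> emeasure (history_law E (Pr q) J S n) (space (history_space E n) - rejection_region n q0 c)"
      using c' sets_rejection_region[OF q0 C'_Q[OF c'], of n]
      by (intro emeasure_mono) (auto simp: R_def sets_history_law)
    also have "\<dots> \<le> ennreal (exp (- real (n div block_length) * ((r j)\<^sup>2 / 100)))"
      by (rule separated_rejection_region(2)[OF q0 C'_Q[OF c'] qQ far' near])
    also have "\<dots> \<le> ennreal (exp (- (real j + 2) * b * a))"
      unfolding a_def b_def by (rule ennreal_leI[OF shell_exponent_le[OF n r_def]])
    also have "\<dots> \<le> ennreal (exp (- b * a))"
    proof -
      have "1 * (b * a) \<le> (real j + 2) * (b * a)" using \<beta> a0 by (intro mult_right_mono) (auto simp: b_def)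
      then show ?thesis by (intro ennreal_leI) (simp only: exp_le_cancel_iff mult_minus_left mult.assoc neg_le_iff_le mult_1)
    qed
    finally show ?thesis .
  qed
  ultimately show ?thesis using that[of R] by (simp add: a_def b_def)
qed

lemma posterior_expectation_le:
  assumes q0: "q0 \<in> space \<QQ>" and Qn: "Q' \<in> sets \<QQ>" and \<pi>: "prob_space \<pi>" "sets \<pi> = sets \<QQ>"
    and n: "block_length \<le> n" and e: "0 < e" and c: "0 < c"
    and entropy: "(SUP r\<in>{e<..}. ln_ennreal (ennreal_of_enat
        (covering_number (space \<QQ>) (r * (1/40)) (closed_ball Q' (semi_dist \<nu> \<nu>s) q0 r) (semi_dist \<nu> \<eta>s))))
        \<le> ereal (real n * e\<^sup>2)"
    and KL: "exp (- c * real n * e\<^sup>2)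
      < measure \<pi> (KL_neighbourhood (space \<QQ>) \<rho> n (history_law E (Pr q0) J S n) q0 e)"
    and sieve: "measure \<pi> (space \<QQ> - Q') \<le> exp (- 2 * real n * (c + 1) * e\<^sup>2)"
    and M: "1 \<le> M" and \<beta>: "c + 3 \<le> M\<^sup>2 / (200 * real block_length)"
  defines "a \<equiv> real n * e\<^sup>2"
  shows "(\<integral>\<^sup>+h. posterior \<rho> n \<pi> h {q \<in> space \<QQ>. semi_dist \<nu> \<nu>s q0 q > ennreal (e * M)}
      \<partial>history_law E (Pr q0) J S n)
    \<le> ennreal (exp (- a) / (1 - exp (- a)) + 2 / a + 2 * exp (- a) + 2 * exp (- c * a))"
proof -
  let ?P = "history_law E (Pr q0) J S n"
  let ?U = "KL_neighbourhood (space \<QQ>) \<rho> n ?P q0 e"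
  let ?A = "{q \<in> space \<QQ>. semi_dist \<nu> \<nu>s q0 q > ennreal (e * M)}"
  interpret p: prob_space \<pi> by (rule \<pi>)
  have n0: "0 < n" using n by simp
  have a0: "0 < a" using n0 e by (simp add: a_def)
  have A_eq: "?A = {q \<in> space \<QQ>. ennreal ((e * M)\<^sup>2) < semi_dist_sq \<nu> \<nu>s q0 q}"
    using e M by (auto simp: not_le[symmetric] semi_dist_le_iff)
  have A: "?A \<in> sets \<QQ>"
    unfolding A_eq using measurable_semi_dist_sq[OF q0] by measurable
  have \<beta>1: "1 \<le> M\<^sup>2 / (200 * real block_length)" using \<beta> c by linarith
  obtain R where R: "R \<in> sets (history_space E n)"
    "emeasure ?P R \<le> ennreal (exp (- a) / (1 - exp (- a)))"
    "\<And>q. q \<in> Q' \<Longrightarrow> ennreal ((e * M)\<^sup>2) < semi_dist_sq \<nu> \<nu>s q0 q \<Longrightarrow>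
      emeasure (history_law E (Pr q) J S n) (space (history_space E n) - R)
      \<le> ennreal (exp (- (M\<^sup>2 / (200 * real block_length)) * a))"
    using contraction_tests[OF q0 sets.sets_into_space[OF Qn] n e entropy M \<beta>1] unfolding a_def by metis
  have pos: "0 < measure \<pi> ?U" using KL exp_gt_zero less_trans by blast
  \<comment> \<open>Measurability is extracted from the positive prior mass: \<open>measure\<close>
    assigns 0 to a set that is not measurable.\<close>
  then have U: "?U \<in> sets \<QQ>" using measure_notin_sets[of ?U \<pi>] \<pi>(2) by fastforce
  have low: "emeasure ?P (low_likelihood n a q0 q) \<le> ennreal (1 / a)" if "q \<in> ?U" for q
    by (rule emeasure_low_likelihood_le[OF q0 a0 that]) (simp add: a_def)
  obtain B where B: "B \<in> sets (history_space E n)" "emeasure ?P B \<le> ennreal (2 / a)"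
    "\<And>h. h \<in> space (history_space E n) - B \<Longrightarrow>
      ennreal (exp (- 2 * a) * measure \<pi> ?U / 2) * likelihood \<rho> n q0 h \<le> (\<integral>\<^sup>+q. likelihood \<rho> n q h \<partial>\<pi>)"
    using evidence_lower_bound[OF q0 \<pi> U p.emeasure_eq_measure pos a0 low] by metis
  \<comment> \<open>The factors are \<open>exp (- 2 * a)\<close> from the likelihood ratio,
    \<open>exp (- c * a)\<close> from the prior mass, and 1/2 for the discarded part of the
    neighbourhood. Dividing by \<kappa> leaves the exponents (c + 3) - (c + 2) = 1 for the tests and
    2 (c + 1) - (c + 2) = c for the sieve; this dictates the \<open>c + 3\<close> in the condition
    on \<open>M\<close>.\<close>
  define \<kappa> where "\<kappa> = exp (- (c + 2) * a) / 2"
  have \<kappa>: "0 < \<kappa>" by (simp add: \<kappa>_def)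
  have \<kappa>_le: "\<kappa> \<le> exp (- 2 * a) * measure \<pi> ?U / 2"
  proof -
    have "exp (- (c + 2) * a) = exp (- 2 * a) * exp (- c * real n * e\<^sup>2)"
      by (simp add: exp_add[symmetric] a_def algebra_simps)
    also have "\<dots> \<le> exp (- 2 * a) * measure \<pi> ?U" using KL by (intro mult_left_mono) auto
    finally show ?thesis by (simp add: \<kappa>_def)
  qed
  have ev: "ennreal \<kappa> * likelihood \<rho> n q0 h \<le> (\<integral>\<^sup>+q. likelihood \<rho> n q h \<partial>\<pi>)"
    if "h \<in> space (history_space E n) - B" for h
    by (rule order_trans[OF mult_right_mono[OF ennreal_leI[OF \<kappa>_le]] B(3)[OF that]]) simp
  have "(\<integral>\<^sup>+h. posterior \<rho> n \<pi> h ?A \<partial>?P) \<le> emeasure ?P R + emeasure ?P B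
      + ennreal (1 / \<kappa>) * (ennreal (exp (- (c + 3) * a)) + emeasure \<pi> (space \<QQ> - Q'))"
  proof (rule nn_integral_posterior_le[OF q0 \<pi> A Qn R(1) B(1) \<kappa> ev])
    fix q assume "q \<in> ?A \<inter> Q'"
    then have "emeasure (history_law E (Pr q) J S n) (space (history_space E n) - R)
        \<le> ennreal (exp (- (M\<^sup>2 / (200 * real block_length)) * a))"
      unfolding A_eq by (intro R(3)) auto
    also have "\<dots> \<le> ennreal (exp (- (c + 3) * a))"
      using mult_right_mono[OF \<beta> less_imp_le[OF a0]]
      by (intro ennreal_leI) (simp only: exp_le_cancel_iff mult_minus_left neg_le_iff_le)
    finally show "emeasure (history_law E (Pr q) J S n) (space (history_space E n) - R)
        \<le> ennreal (exp (- (c + 3) * a))" .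
  qed
  also have "\<dots> \<le> ennreal (exp (- a) / (1 - exp (- a))) + ennreal (2 / a)
      + ennreal (1 / \<kappa>) * (ennreal (exp (- (c + 3) * a)) + ennreal (exp (- 2 * (c + 1) * a)))"
  proof (intro add_mono mult_left_mono R(2) B(2) order_refl)
    have "- 2 * real n * (c + 1) * e\<^sup>2 = - 2 * (c + 1) * a" by (simp add: a_def algebra_simps)
    then show "emeasure \<pi> (space \<QQ> - Q') \<le> ennreal (exp (- 2 * (c + 1) * a))"
      using sieve by (simp only: p.emeasure_eq_measure) (rule ennreal_leI)
  qed simp
  also have "ennreal (1 / \<kappa>) * (ennreal (exp (- (c + 3) * a)) + ennreal (exp (- 2 * (c + 1) * a)))
      = ennreal (1 / \<kappa> * (exp (- (c + 3) * a) + exp (- 2 * (c + 1) * a)))"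
    using \<kappa> by (subst ennreal_mult) (simp_all add: less_imp_le)
  also have "1 / \<kappa> * (exp (- (c + 3) * a) + exp (- 2 * (c + 1) * a)) = 2 * exp (- a) + 2 * exp (- c * a)"
  proof -
    have "exp (- (c + 2) * a) = 1 / exp ((c + 2) * a)"
      by (simp only: mult_minus_left exp_minus inverse_eq_divide)
    then have "1 / \<kappa> = 2 * exp ((c + 2) * a)"
      unfolding \<kappa>_def by (simp only: divide_divide_eq_left divide_divide_eq_right mult_1)
    moreover have "exp ((c + 2) * a) * exp (- (c + 3) * a) = exp (- a)"
      "exp ((c + 2) * a) * exp (- 2 * (c + 1) * a) = exp (- c * a)"
      by (simp_all only: exp_add[symmetric]) (simp_all add: algebra_simps)
    ultimately show ?thesis by (simp only: distrib_left mult.assoc)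
  qed
  also have "ennreal (exp (- a) / (1 - exp (- a))) + ennreal (2 / a) + ennreal (2 * exp (- a) + 2 * exp (- c * a))
      = ennreal (exp (- a) / (1 - exp (- a)) + 2 / a + 2 * exp (- a) + 2 * exp (- c * a))"
    using a0 by (simp add: ennreal_plus[symmetric] add.assoc del: ennreal_plus)
  finally show ?thesis .
qed

end

theorem theorem1:
  fixes E :: "'e measure"
    and \<nu> :: "('e \<times> real) measure"
    and \<QQ> :: "'e kernel_density measure"
    and \<rho> :: "'e kernel_density \<Rightarrow> 'e measure"
    and Pr :: "'e kernel_density \<Rightarrow> 'w measure"
    and J :: "nat \<Rightarrow> 'w \<Rightarrow> 'e"
    and S :: "nat \<Rightarrow> 'w \<Rightarrow> real"
    and \<nu>s \<eta>s :: "'e measure"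
    and k l :: nat
  assumes model: "semi_markov_model E \<nu> \<QQ> \<rho> Pr J S"
    and sets_\<nu>s: "sets \<nu>s = sets E"
    and sets_\<eta>s: "sets \<eta>s = sets E"
    and k: "k \<ge> 1"
    and l: "l \<ge> 1"
    and minorization: "\<And>q x A. q \<in> space \<QQ> \<Longrightarrow> x \<in> space E \<Longrightarrow> A \<in> sets E \<Longrightarrow>
      emeasure \<nu>s A \<le> (\<Sum>u=1..k. emeasure (kernel_pow E (chain_kernel E \<nu> q) u x) A) / of_nat k"
    and majorization: "\<And>q x A. q \<in> space \<QQ> \<Longrightarrow> x \<in> space E \<Longrightarrow> A \<in> sets E \<Longrightarrow>
      emeasure (kernel_pow E (chain_kernel E \<nu> q) l x) A \<le> emeasure \<eta>s A"
  shows "\<exists>\<xi>::real. 0 < \<xi> \<and> \<xi> < 1 \<and>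
    (\<forall>q0 (Qn :: nat \<Rightarrow> 'e kernel_density set) (prior :: nat \<Rightarrow> 'e kernel_density measure)
        (\<epsilon> :: nat \<Rightarrow> real) (c :: real).
      q0 \<in> space \<QQ> \<longrightarrow>
      (\<forall>n\<ge>1. Qn n \<in> sets \<QQ>) \<longrightarrow>
      (\<forall>n\<ge>1. prob_space (prior n) \<and> sets (prior n) = sets \<QQ>) \<longrightarrow>
      (\<forall>n\<ge>1. 0 < \<epsilon> n) \<longrightarrow>
      \<epsilon> \<longlonglongrightarrow> 0 \<longrightarrow>
      filterlim (\<lambda>n. real n * (\<epsilon> n)\<^sup>2) at_top sequentially \<longrightarrow>
      (\<forall>n\<ge>1. (SUP r\<in>{\<epsilon> n<..}. ln_ennreal (ennreal_of_enat
          (covering_number (space \<QQ>) (r * \<xi>)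
            (closed_ball (Qn n) (semi_dist \<nu> \<nu>s) q0 r) (semi_dist \<nu> \<eta>s))))
        \<le> ereal (real n * (\<epsilon> n)\<^sup>2)) \<longrightarrow>
      0 < c \<longrightarrow>
      (\<forall>n\<ge>1. measure (prior n)
          (KL_neighbourhood (space \<QQ>) \<rho> n (history_law E (Pr q0) J S n) q0 (\<epsilon> n))
        > exp (- c * real n * (\<epsilon> n)\<^sup>2)) \<longrightarrow>
      (\<forall>n\<ge>1. measure (prior n) (space \<QQ> - Qn n) \<le> exp (- 2 * real n * (c + 1) * (\<epsilon> n)\<^sup>2)) \<longrightarrow>
      (\<exists>M0. \<forall>M\<ge>M0.
        (\<lambda>n. \<integral>\<^sup>+ h. posterior \<rho> n (prior n) h
                {q \<in> space \<QQ>. semi_dist \<nu> \<nu>s q0 q > ennreal (\<epsilon> n * M)}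
              \<partial>history_law E (Pr q0) J S n) \<longlonglongrightarrow> 0))"
proof -
  interpret sandwiched_semi_markov_model E \<nu> \<QQ> \<rho> Pr J S \<nu>s \<eta>s k l
    by (rule sandwiched_semi_markov_model.intro[OF model])
      (use sets_\<nu>s sets_\<eta>s k minorization majorization in unfold_locales)
  show ?thesis
  proof (rule exI[of _ "1/40 :: real"], intro conjI allI impI)
    fix q0 :: "'e kernel_density" and Qn :: "nat \<Rightarrow> 'e kernel_density set"
      and prior :: "nat \<Rightarrow> 'e kernel_density measure" and \<epsilon> :: "nat \<Rightarrow> real" and c :: real
    assume q0: "q0 \<in> space \<QQ>" and Qn: "\<forall>n\<ge>1. Qn n \<in> sets \<QQ>"
      and prior: "\<forall>n\<ge>1. prob_space (prior n) \<and> sets (prior n) = sets \<QQ>"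
      and pos: "\<forall>n\<ge>1. 0 < \<epsilon> n"
      and rate: "filterlim (\<lambda>n. real n * (\<epsilon> n)\<^sup>2) at_top sequentially"
      and entropy: "\<forall>n\<ge>1. (SUP r\<in>{\<epsilon> n<..}. ln_ennreal (ennreal_of_enat
          (covering_number (space \<QQ>) (r * (1/40))
            (closed_ball (Qn n) (semi_dist \<nu> \<nu>s) q0 r) (semi_dist \<nu> \<eta>s))))
        \<le> ereal (real n * (\<epsilon> n)\<^sup>2)"
      and c: "0 < c"
      and KL: "\<forall>n\<ge>1. measure (prior n)
          (KL_neighbourhood (space \<QQ>) \<rho> n (history_law E (Pr q0) J S n) q0 (\<epsilon> n))
        > exp (- c * real n * (\<epsilon> n)\<^sup>2)"
      and sieve: "\<forall>n\<ge>1. measure (prior n) (space \<QQ> - Qn n) \<le> exp (- 2 * real n * (c + 1) * (\<epsilon> n)\<^sup>2)"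
    define b where "b = (\<lambda>a. exp (- a) / (1 - exp (- a)) + 2 / a + 2 * exp (- a) + 2 * exp (- c * a))"
    have "(b \<longlongrightarrow> 0) at_top" unfolding b_def using c by real_asymp
    then have "(\<lambda>n. b (real n * (\<epsilon> n)\<^sup>2)) \<longlonglongrightarrow> 0" using rate by (rule filterlim_compose)
    then have lim: "(\<lambda>n. ennreal (b (real n * (\<epsilon> n)\<^sup>2))) \<longlonglongrightarrow> 0"
      using tendsto_ennrealI by fastforce
    show "\<exists>M0. \<forall>M\<ge>M0. (\<lambda>n. \<integral>\<^sup>+ h. posterior \<rho> n (prior n) h
          {q \<in> space \<QQ>. semi_dist \<nu> \<nu>s q0 q > ennreal (\<epsilon> n * M)}
        \<partial>history_law E (Pr q0) J S n) \<longlonglongrightarrow> 0"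
    \<comment> \<open>The root makes \<open>M\<^sup>2 / (200 * block_length)\<close> reach
      \<open>c + 3\<close>, and the summand 1 secures \<open>1 \<le> M\<close>.\<close>
    proof (intro exI[of _ "sqrt (200 * real block_length * (c + 3)) + 1"] allI impI)
      fix M assume M: "sqrt (200 * real block_length * (c + 3)) + 1 \<le> M"
      have sq: "0 \<le> sqrt (200 * real block_length * (c + 3))" using c by simp
      then have M1: "1 \<le> M" using M by linarith
      have "200 * real block_length * (c + 3) \<le> M\<^sup>2" using M by (intro sqrt_le_D) linarith
      then have \<beta>: "c + 3 \<le> M\<^sup>2 / (200 * real block_length)" by (simp add: le_divide_eq mult.commute)
      have "(\<integral>\<^sup>+ h. posterior \<rho> n (prior n) h {q \<in> space \<QQ>. semi_dist \<nu> \<nu>s q0 q > ennreal (\<epsilon> n * M)}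
          \<partial>history_law E (Pr q0) J S n) \<le> ennreal (b (real n * (\<epsilon> n)\<^sup>2))" if n: "block_length \<le> n" for n
      proof -
        have n1: "1 \<le> n" using n by simp
        show ?thesis unfolding b_def
          by (rule posterior_expectation_le[of q0 "Qn n" "prior n" n "\<epsilon> n" c M])
            (use q0 Qn prior pos entropy c KL sieve n n1 M1 \<beta> in simp_all)
      qed
      \<comment> \<open>For \<open>n\<close> below \<open>block_length\<close> there is not one
        complete block and no bound; the limit ignores these finitely many indices.\<close>
      then show "(\<lambda>n. \<integral>\<^sup>+ h. posterior \<rho> n (prior n) h
          {q \<in> space \<QQ>. semi_dist \<nu> \<nu>s q0 q > ennreal (\<epsilon> n * M)}
        \<partial>history_law E (Pr q0) J S n) \<longlonglongrightarrow> 0"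
        by (intro tendsto_sandwich[OF _ _ tendsto_const lim] eventually_sequentiallyI[of block_length]) simp_all
    qed
  qed simp_all
qed

end
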